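(* Let $G$ be a non-discrete locally compact group, let $\omega\ge1$ be a weight on $G$, let $1\le p<\infty$, and let $q\in(1,\infty]$ be the index conjugate to $p$. Suppose that there exist a bounded (measurable) function $u:G\to\mathbb{R}^+$, a real number $s<q$, and $r>0$ such that $\sigma(x)=\omega(x)u(x)$, $x\in G$, is bounded away from zero, $$\frac{\omega(xy)}{\omega(x)\omega(y)}\le u(x)+u(y)\quad (x,y\in G),\qquad\text{and}\qquad \int_G u(x)^s\omega(x)^r\,dx<\infty.$$ Let $\mathcal{A}=L^p(G,\omega)\cap L^2(G)$ and let $\widetilde{\mathcal{A}}$ be its unitization. Then $\widetilde{\mathcal{A}}$ is inverse-closed in $B(L^2(G))$ and $\widetilde{\mathcal{A}}$ admits norm-controlled inversion in $B(L^2(G))$.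
   Context: A weight on a locally compact group $G$ is a measurable function $\omega:G\to[0,\infty)$ with $\omega(e)=1$, $\omega(x)=\omega(x^{-1})$ and $\omega(xy)\le\omega(x)\omega(y)$ for all $x,y\in G$. $\mathbb{R}^+=[0,\infty)$, and $dx$ is (left) Haar measure. $L^p(G,\omega)=\{f: f\omega\in L^p(G)\}$ with norm $\|f\|_{p,\omega}=\|f\omega\|_p$. $\mathcal{A}=L^p(G,\omega)\cap L^2(G)$ carries the norm $\|f\|_{\mathcal{A}}=\max\{\|f\|_{p,\omega},\|f\|_2\}$, the convolution product and the usual involution of $L^1(G)$; under the hypotheses it is a Banach $*$-algebra in the sense that $\|f*g\|_{\mathcal{A}}\le K\|f\|_{\mathcal{A}}\|g\|_{\mathcal{A}}$ for some constant $K>0$. The unitization $\widetilde{\mathcal{A}}$ is $\mathcal{A}\times\mathbb{C}$ with coordinatewise linear operations, product $(f,t)(g,s)=(f*g+sf+tg,\,ts)$, involution $(f,t)^*=(f^*,\overline{t})$, unit $(0,1)$ and norm $\|(f,t)\|_{\widetilde{\mathcal{A}}}=\|f\|_{\mathcal{A}}+|t|$. It is regarded as a subalgebra of $B(L^2(G))$ through the injective map sending $(f,t)$ to the operator $g\mapsto f*g+tg$. For algebras $\mathcal{A}_0\subseteq\mathcal{B}$ with a common unit: $\mathcal{A}_0$ is inverse-closed in $\mathcal{B}$ if every $a\in\mathcal{A}_0$ invertible in $\mathcal{B}$ satisfies $a^{-1}\in\mathcal{A}_0$; in this case $\mathcal{A}_0$ admits norm-controlled inversion in $\mathcal{B}$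 if there is a function $h:\mathbb{R}^+\times\mathbb{R}^+\to\mathbb{R}^+$ such that $\|a^{-1}\|_{\mathcal{A}_0}\le h(\|a\|_{\mathcal{A}_0},\|a^{-1}\|_{\mathcal{B}})$ for every $a\in\mathcal{A}_0$ invertible in $\mathcal{B}$. *)

theory Defs
  imports "HOL-Analysis.Analysis" "HOL-Algebra.Module"
begin

section \<open>Haar measure and weights\<close>

text \<open>
  Topological groups are taken from the class \<open>topological_group_add\<close>, which is not
  commutative: \<open>x + y\<close>, \<open>- x\<close> and \<open>0\<close> stand for the product, the inverse and the neutral
  element. "Locally compact group" includes the Hausdorff property (class \<open>t2_space\<close>).
\<close>

definition left_haar_borel ::
  "'a::{topological_group_add, t2_space} measure \<Rightarrow> bool" where
  "left_haar_borel \<nu> \<longleftrightarrow>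
     sets \<nu> = sets borel \<and>
     emeasure \<nu> UNIV \<noteq> 0 \<and>
     (\<forall>K. compact K \<longrightarrow> emeasure \<nu> K < \<infinity>) \<and>
     (\<forall>A\<in>sets borel. emeasure \<nu> A = (INF U\<in>{U. open U \<and> A \<subseteq> U}. emeasure \<nu> U)) \<and>
     (\<forall>U. open U \<longrightarrow> emeasure \<nu> U = (SUP K\<in>{K. compact K \<and> K \<subseteq> U}. emeasure \<nu> K)) \<and>
     (\<forall>a. \<forall>A\<in>sets borel. emeasure \<nu> ((\<lambda>x. a + x) ` A) = emeasure \<nu> A)"

text \<open>
  The measure is completed, so that "measurable" means Haar measurable and not merely Borel
  measurable.
\<close>

definition left_haar_measure ::
  "'a::{topological_group_add, t2_space} measure \<Rightarrow> bool" where
  "left_haar_measure \<mu> \<longleftrightarrow> (\<exists>\<nu>. left_haar_borel \<nu> \<and> \<mu> = completion \<nu>)"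

definition weight :: "'a::group_add measure \<Rightarrow> ('a \<Rightarrow> real) \<Rightarrow> bool" where
  "weight \<mu> \<omega> \<longleftrightarrow>
     \<omega> \<in> borel_measurable \<mu> \<and> (\<forall>x. 0 \<le> \<omega> x) \<and> \<omega> 0 = 1 \<and> (\<forall>x. \<omega> x = \<omega> (- x)) \<and>
     (\<forall>x y. \<omega> (x + y) \<le> \<omega> x * \<omega> y)"

section \<open>Lebesgue spaces of classes of functions modulo equality almost everywhere\<close>

type_synonym 'a fclass = "('a \<Rightarrow> complex) set"

definition ae_class :: "'a measure \<Rightarrow> ('a \<Rightarrow> complex) \<Rightarrow> 'a fclass" where
  "ae_class \<mu> f = {g \<in> borel_measurable \<mu>. AE x in \<mu>. g x = f x}"

definition rep :: "'a fclass \<Rightarrow> 'a \<Rightarrow> complex" where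
  "rep F = (SOME f. f \<in> F)"

definition Lp_functions :: "'a measure \<Rightarrow> real \<Rightarrow> ('a \<Rightarrow> complex) set" where
  "Lp_functions \<mu> p = {f \<in> borel_measurable \<mu>. integrable \<mu> (\<lambda>x. cmod (f x) powr p)}"

definition Lp :: "'a measure \<Rightarrow> real \<Rightarrow> 'a fclass set" where
  "Lp \<mu> p = ae_class \<mu> ` Lp_functions \<mu> p"

definition Lp_weighted :: "'a measure \<Rightarrow> real \<Rightarrow> ('a \<Rightarrow> real) \<Rightarrow> 'a fclass set" where
  "Lp_weighted \<mu> p \<omega> =
     ae_class \<mu> ` {f \<in> borel_measurable \<mu>. (\<lambda>x. f x * of_real (\<omega> x)) \<in> Lp_functions \<mu> p}"

definition Lp_norm :: "'a measure \<Rightarrow> real \<Rightarrow> ('a \<Rightarrow> complex) \<Rightarrow> real" where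
  "Lp_norm \<mu> p f = (LINT x|\<mu>. cmod (f x) powr p) powr (1 / p)"

text \<open>Operations on classes, via representatives.\<close>

definition fc_zero :: "'a measure \<Rightarrow> 'a fclass" where
  "fc_zero \<mu> = ae_class \<mu> (\<lambda>x. 0)"

definition fc_add :: "'a measure \<Rightarrow> 'a fclass \<Rightarrow> 'a fclass \<Rightarrow> 'a fclass" where
  "fc_add \<mu> F G = ae_class \<mu> (\<lambda>x. rep F x + rep G x)"

definition fc_scale :: "'a measure \<Rightarrow> complex \<Rightarrow> 'a fclass \<Rightarrow> 'a fclass" where
  "fc_scale \<mu> c F = ae_class \<mu> (\<lambda>x. c * rep F x)"

definition convolution ::
  "'a::group_add measure \<Rightarrow> ('a \<Rightarrow> complex) \<Rightarrow> ('a \<Rightarrow> complex) \<Rightarrow> 'a \<Rightarrow> complex" where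
  "convolution \<mu> f g = (\<lambda>x. LINT y|\<mu>. f y * g (- y + x))"

definition fc_conv :: "'a::group_add measure \<Rightarrow> 'a fclass \<Rightarrow> 'a fclass \<Rightarrow> 'a fclass" where
  "fc_conv \<mu> F G = ae_class \<mu> (convolution \<mu> (rep F) (rep G))"

definition fc_norm :: "'a measure \<Rightarrow> real \<Rightarrow> 'a fclass \<Rightarrow> real" where
  "fc_norm \<mu> p F = Lp_norm \<mu> p (rep F)"

definition fc_norm_weighted :: "'a measure \<Rightarrow> real \<Rightarrow> ('a \<Rightarrow> real) \<Rightarrow> 'a fclass \<Rightarrow> real" where
  "fc_norm_weighted \<mu> p \<omega> F = Lp_norm \<mu> p (\<lambda>x. rep F x * of_real (\<omega> x))"

section \<open>Norm-controlled inversion\<close>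

record ('s, 'b) normed_algebra = "('s, 'b) module" +
  alg_norm :: "'b \<Rightarrow> real"

text \<open>
  \<open>A\<close> is regarded as a subalgebra of \<open>B\<close>, with the same unit, through the injective
  unital algebra homomorphism \<open>\<phi>\<close>.
\<close>

definition unital_embedding ::
  "('b \<Rightarrow> 'c) \<Rightarrow> ('s, 'b) normed_algebra \<Rightarrow> ('s, 'c) normed_algebra \<Rightarrow> bool" where
  "unital_embedding \<phi> A B \<longleftrightarrow>
     \<phi> \<in> ring_hom A B \<and>
     (\<forall>c. \<forall>a\<in>carrier A. \<phi> (c \<odot>\<^bsub>A\<^esub> a) = c \<odot>\<^bsub>B\<^esub> \<phi> a) \<and>
     inj_on \<phi> (carrier A)"

definition inverse_closed ::
  "('b \<Rightarrow> 'c) \<Rightarrow> ('s, 'b) normed_algebra \<Rightarrow> ('s, 'c) normed_algebra \<Rightarrow> bool" where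
  "inverse_closed \<phi> A B \<longleftrightarrow>
     unital_embedding \<phi> A B \<and>
     (\<forall>a\<in>carrier A. \<phi> a \<in> Units B \<longrightarrow> inv\<^bsub>B\<^esub> (\<phi> a) \<in> \<phi> ` carrier A)"

text \<open>
  The norm of an inverse in \<open>A\<close> is that of its preimage under \<open>\<phi>\<close>.
\<close>

definition norm_controlled_inversion ::
  "('b \<Rightarrow> 'c) \<Rightarrow> ('s, 'b) normed_algebra \<Rightarrow> ('s, 'c) normed_algebra \<Rightarrow> bool" where
  "norm_controlled_inversion \<phi> A B \<longleftrightarrow>
     inverse_closed \<phi> A B \<and>
     (\<exists>h :: real \<Rightarrow> real \<Rightarrow> real.
        (\<forall>x\<ge>0. \<forall>y\<ge>0. h x y \<ge> 0) \<and>
        (\<forall>a\<in>carrier A. \<phi> a \<in> Units B \<longrightarrow>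
           alg_norm A (the_inv_into (carrier A) \<phi> (inv\<^bsub>B\<^esub> (\<phi> a)))
             \<le> h (alg_norm A a) (alg_norm B (inv\<^bsub>B\<^esub> (\<phi> a)))))"

section \<open>The algebras of bounded operators and of convolution operators\<close>

text \<open>
  Operators are extensional functions on the set \<open>Lp \<mu> 2\<close>, so that equality in the
  carrier is equality of operators.
\<close>

definition bounded_ops_L2 ::
  "'a measure \<Rightarrow> (complex, 'a fclass \<Rightarrow> 'a fclass) normed_algebra" where
  "bounded_ops_L2 \<mu> =
     \<lparr> carrier = {T \<in> Lp \<mu> 2 \<rightarrow>\<^sub>E Lp \<mu> 2.
         (\<forall>F\<in>Lp \<mu> 2. \<forall>G\<in>Lp \<mu> 2. T (fc_add \<mu> F G) = fc_add \<mu> (T F) (T G)) \<and>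
         (\<forall>c. \<forall>F\<in>Lp \<mu> 2. T (fc_scale \<mu> c F) = fc_scale \<mu> c (T F)) \<and>
         (\<exists>C. \<forall>F\<in>Lp \<mu> 2. fc_norm \<mu> 2 (T F) \<le> C * fc_norm \<mu> 2 F)},
       monoid.mult = (\<lambda>S T. compose (Lp \<mu> 2) S T),
       one = (\<lambda>F\<in>Lp \<mu> 2. F),
       zero = (\<lambda>F\<in>Lp \<mu> 2. fc_zero \<mu>),
       add = (\<lambda>S T. \<lambda>F\<in>Lp \<mu> 2. fc_add \<mu> (S F) (T F)),
       smult = (\<lambda>c T. \<lambda>F\<in>Lp \<mu> 2. fc_scale \<mu> c (T F)),
       alg_norm = (\<lambda>T. SUP F\<in>{F \<in> Lp \<mu> 2. fc_norm \<mu> 2 F \<le> 1}. fc_norm \<mu> 2 (T F)) \<rparr>"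

definition conv_algebra :: "'a measure \<Rightarrow> real \<Rightarrow> ('a \<Rightarrow> real) \<Rightarrow> 'a fclass set" where
  "conv_algebra \<mu> p \<omega> = Lp_weighted \<mu> p \<omega> \<inter> Lp \<mu> 2"

definition conv_algebra_norm ::
  "'a measure \<Rightarrow> real \<Rightarrow> ('a \<Rightarrow> real) \<Rightarrow> 'a fclass \<Rightarrow> real" where
  "conv_algebra_norm \<mu> p \<omega> F = max (fc_norm_weighted \<mu> p \<omega> F) (fc_norm \<mu> 2 F)"

definition unitization ::
  "'a::group_add measure \<Rightarrow> real \<Rightarrow> ('a \<Rightarrow> real) \<Rightarrow> (complex, 'a fclass \<times> complex) normed_algebra"
  where
  "unitization \<mu> p \<omega> =
     \<lparr> carrier = conv_algebra \<mu> p \<omega> \<times> UNIV,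
       monoid.mult = (\<lambda>(F, t) (G, s).
         (fc_add \<mu> (fc_add \<mu> (fc_conv \<mu> F G) (fc_scale \<mu> s F)) (fc_scale \<mu> t G), t * s)),
       one = (fc_zero \<mu>, 1),
       zero = (fc_zero \<mu>, 0),
       add = (\<lambda>(F, t) (G, s). (fc_add \<mu> F G, t + s)),
       smult = (\<lambda>c (F, t). (fc_scale \<mu> c F, c * t)),
       alg_norm = (\<lambda>(F, t). conv_algebra_norm \<mu> p \<omega> F + cmod t) \<rparr>"

definition conv_operator ::
  "'a::group_add measure \<Rightarrow> 'a fclass \<times> complex \<Rightarrow> 'a fclass \<Rightarrow> 'a fclass" where
  "conv_operator \<mu> = (\<lambda>(F, t). \<lambda>G\<in>Lp \<mu> 2. fc_add \<mu> (fc_conv \<mu> F G) (fc_scale \<mu> t G))"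

end

theory Submission
  imports Defs
begin

text \<open>
  Let \<open>P\<close> be the weighted \<open>p\<close>-norm. Hoelder's inequality with three factors gives
  \<open>\<integral> \<bar>f\<bar> \<omega> u \<le> C (P f) powr (1 - \<eta>) (norm\<^sub>2 f) powr \<eta>\<close> for a small \<open>\<eta> > 0\<close>, so
  \<open>\<omega> (x + y) \<le> \<omega> x \<omega> y (u x + u y)\<close> and Young's inequality yield
  \<open>P (f \<star> f) \<le> 2 C (P f) powr (2 - \<eta>) (norm\<^sub>2 f) powr \<eta>\<close>: the weighted norm grows strictly less
  than quadratically under squaring. If \<open>a\<close> is bounded below by \<open>1 / Y\<close> on \<open>L\<^sup>2\<close>, then
  \<open>T = 1 - e a\<^sup>* a\<close> is, for suitable \<open>e\<close>, a contraction with a constant \<open>\<rho> < 1\<close> depending only on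
  \<open>Y\<close> and the norm of \<open>a\<close>, and \<open>a\<close> has the inverse \<open>e (\<Prod>k. 1 + T ^ (2 ^ k)) a\<^sup>*\<close>. By the
  squaring estimate the algebra norms of \<open>T ^ (2 ^ k)\<close> are summable with a bound of the same kind.
  Hence the partial products are bounded in the algebra norm. They converge in operator norm, and
  Fatou's lemma puts the limit into the algebra. The scalar part of \<open>a\<close> is at least \<open>1 / Y\<close> because
  convolution operators almost annihilate indicator functions of small sets; this needs a
  non-discrete group. For \<open>p = 1\<close> the function \<open>u\<close> has to be replaced by a multiple of a negative
  power of \<open>\<omega>\<close>.
\<close>

section \<open>Groups with a measurable addition\<close>

text \<open>The group need not be second countable, which puts Fubini for Borel functions out of
  reach; all analysis is therefore done on Baire sets, and the integrability hypothesis supplies the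
  \<sigma>-compactness on which this rests. Unimodularity is not assumed either, yet the involution
  has to be isometric and Young's inequality has to hold on both sides without modular factors; it
  is extracted from the growth of the weight. The size of \<eta> is dictated by the third Hoelder
  weight \<open>e = 1 - (1 - \<eta>) / p - \<eta> / 2\<close>: the function
  \<open>u * \<omega> powr \<eta>\<close> has to lie in L^(1/e). For p > 1, e tends to 1 / q as
  \<eta> tends to 0, so the power 1 / e of u exceeds s while the power \<eta> / e of \<omega>
  becomes small. For p = 1, e is \<eta> / 2 and the power of \<omega> is always 2, which the given
  integral need not control; this is the obstacle that the new u removes. Boundedness of the partial
  products suffices, because their limit is read off from the inverse on L^2; completeness of the
  algebra is never invoked.\<close>

text \<open>The set in \<open>window\<close> stands in for a relatively compact open set.\<close>

locale measurable_group = sigma_finite_measure M for M :: "'a::group_add measure" +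
  assumes space_M [simp]: "space M = UNIV"
    and add_measurable: "(\<lambda>(x, y). x + y) \<in> M \<Otimes>\<^sub>M M \<rightarrow>\<^sub>M M"
    and uminus_measurable [measurable]: "uminus \<in> M \<rightarrow>\<^sub>M M"
    and left_invariant: "\<And>a A. A \<in> sets M \<Longrightarrow> emeasure M ((\<lambda>x. a + x) -` A) = emeasure M A"
    and window: "\<exists>\<Omega>\<in>sets M. \<forall>y. 0 < emeasure M {x. x + y \<in> \<Omega>} \<and> emeasure M {x. x + y \<in> \<Omega>} < \<infinity>"
begin

sublocale pair: pair_sigma_finite M M ..

lemma measurable_plus [measurable (raw)]:
  assumes [measurable]: "f \<in> N \<rightarrow>\<^sub>M M" "g \<in> N \<rightarrow>\<^sub>M M"
  shows "(\<lambda>x. f x + g x) \<in> N \<rightarrow>\<^sub>M M"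
  using measurable_compose[OF measurable_Pair[OF assms] add_measurable] by simp

lemma measurable_neg [measurable (raw)]:
  assumes [measurable]: "f \<in> N \<rightarrow>\<^sub>M M"
  shows "(\<lambda>x. - f x) \<in> N \<rightarrow>\<^sub>M M"
  using measurable_compose[OF assms uminus_measurable] by simp

lemma distr_left: "distr M M (\<lambda>x. a + x) = M"
  by (rule measure_eqI) (simp_all add: emeasure_distr left_invariant)

lemma nn_integral_left:
  "f \<in> borel_measurable M \<Longrightarrow> (\<integral>\<^sup>+x. f (a + x) \<partial>M) = (\<integral>\<^sup>+x. f x \<partial>M)"
  by (subst (2) distr_left[of a, symmetric]) (simp add: nn_integral_distr)

lemma AE_left:
  assumes "AE x in M. P x"
  shows "AE x in M. P (a + x)"
proof -
  have "AE x in distr M M (\<lambda>x. a + x). P x"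
    by (subst distr_left) (rule assms)
  then show ?thesis by (rule AE_distrD[rotated]) simp
qed

lemma AE_ex:
  assumes "AE x in M. P x"
  shows "\<exists>x. P x"
proof (rule ccontr)
  assume "\<nexists>x. P x"
  with assms have "AE x in M. False" by simp
  then have "emeasure M UNIV = 0" using AE_iff_measurable[of UNIV M "\<lambda>_. False"] sets.top[of M] by simp
  moreover obtain \<Omega> where "\<Omega> \<in> sets M" "0 < emeasure M {x. x + 0 \<in> \<Omega>}" using window by blast
  ultimately show False
    using emeasure_mono[of \<Omega> UNIV M] sets.top[of M] by (simp del: sets.top)
qed

text \<open>Tonelli for the indicator of a null set N at -y + x: every integral over x is that of a
  left translate and vanishes, so some x has -y + x outside N for almost all y. Replacing y by x + y
  turns -y + x into -y. The measure itself need not be inversion invariant.\<close>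

lemma AE_uminus:
  assumes "AE x in M. P x"
  shows "AE x in M. P (- x)"
proof -
  obtain N where N [measurable]: "N \<in> sets M" "emeasure M N = 0" "{x. \<not> P x} \<subseteq> N"
    using assms by (auto elim!: AE_E)
  have "(\<integral>\<^sup>+x. \<integral>\<^sup>+y. indicator N (- y + x) \<partial>M \<partial>M) = (\<integral>\<^sup>+y. \<integral>\<^sup>+x. indicator N (- y + x) \<partial>M \<partial>M)"
    by (rule pair.Fubini') measurable
  also have "\<dots> = (\<integral>\<^sup>+y. \<integral>\<^sup>+x. indicator N x \<partial>M \<partial>M)"
    by (intro nn_integral_cong nn_integral_left) auto
  also have "\<dots> = 0" using N by simp
  finally have "AE x in M. (\<integral>\<^sup>+y. indicator N (- y + x) \<partial>M) = 0"
    by (subst (asm) nn_integral_0_iff_AE) auto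
  then obtain x where "(\<integral>\<^sup>+y. indicator N (- y + x) \<partial>M) = (0::ennreal)"
    using AE_ex by blast
  then have "AE y in M. indicator N (- y + x) = (0::ennreal)"
    by (subst (asm) nn_integral_0_iff_AE) auto
  then have "AE y in M. indicator N (- (x + y) + x) = (0::ennreal)" by (rule AE_left)
  then show ?thesis
    by eventually_elim (use N in \<open>auto simp: minus_add add.assoc indicator_def split: if_splits\<close>)
qed

lemma AE_right:
  assumes "AE x in M. P x"
  shows "AE x in M. P (x + a)"
  using AE_uminus[OF AE_left[OF AE_uminus[OF assms], of "- a"]] by (simp add: minus_add)

text \<open>The computation behind the uniqueness of Haar measure: Tonelli and two left translations
  uncouple f from the right translates of g. Applied to a fixed window and to a second function it
  shows how right translations scale integrals.\<close>

lemma nn_integral_swap_translates: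
  assumes [measurable]: "f \<in> borel_measurable M" "g \<in> borel_measurable M"
  shows "(\<integral>\<^sup>+y. f (- y) * (\<integral>\<^sup>+x. g (x + y) \<partial>M) \<partial>M) = (\<integral>\<^sup>+x. f x \<partial>M) * (\<integral>\<^sup>+x. g x \<partial>M)"
proof -
  have "(\<integral>\<^sup>+y. f (- y) * (\<integral>\<^sup>+x. g (x + y) \<partial>M) \<partial>M) = (\<integral>\<^sup>+y. \<integral>\<^sup>+x. f (- y) * g (x + y) \<partial>M \<partial>M)"
    by (intro nn_integral_cong nn_integral_cmult[symmetric]) measurable
  also have "\<dots> = (\<integral>\<^sup>+x. \<integral>\<^sup>+y. f (- y) * g (x + y) \<partial>M \<partial>M)"
    by (rule pair.Fubini') measurable
  also have "\<dots> = (\<integral>\<^sup>+x. \<integral>\<^sup>+y. f (- y + x) * g y \<partial>M \<partial>M)"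
  proof (rule nn_integral_cong)
    fix x
    show "(\<integral>\<^sup>+y. f (- y) * g (x + y) \<partial>M) = (\<integral>\<^sup>+y. f (- y + x) * g y \<partial>M)"
      using nn_integral_left[of "\<lambda>y. f (- y + x) * g y" x] by (simp add: minus_add add.assoc)
  qed
  also have "\<dots> = (\<integral>\<^sup>+y. \<integral>\<^sup>+x. f (- y + x) * g y \<partial>M \<partial>M)"
    by (rule pair.Fubini') measurable
  also have "\<dots> = (\<integral>\<^sup>+y. (\<integral>\<^sup>+x. f x \<partial>M) * g y \<partial>M)"
    by (intro nn_integral_cong) (simp add: nn_integral_multc nn_integral_left)
  also have "\<dots> = (\<integral>\<^sup>+x. f x \<partial>M) * (\<integral>\<^sup>+x. g x \<partial>M)"
    by (rule nn_integral_cmult) measurable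
  finally show ?thesis .
qed

text \<open>\<open>D y\<close> measures a right translate of the window. For each g, both sides of
  \<open>ae\<close> have the same integral over every measurable set by
  \<open>nn_integral_swap_translates\<close>, so right translation by almost every y scales
  integrals by \<open>D y / D 0\<close>.\<close>

theorem modular_function:
  obtains \<delta> :: "'a \<Rightarrow> ennreal"
  where "\<And>x. 0 < \<delta> x" "\<And>x. \<delta> x < \<infinity>"
    "\<And>x g. g \<in> borel_measurable M \<Longrightarrow> (\<integral>\<^sup>+z. g (z + x) \<partial>M) = \<delta> x * (\<integral>\<^sup>+z. g z \<partial>M)"
proof -
  obtain \<Omega> where \<Omega> [measurable]: "\<Omega> \<in> sets M"
    and pos: "\<And>y. 0 < emeasure M {x. x + y \<in> \<Omega>}" and fin: "\<And>y. emeasure M {x. x + y \<in> \<Omega>} < \<infinity>"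
    using window by blast
  define D :: "'a \<Rightarrow> ennreal" where "D y = (\<integral>\<^sup>+x. indicator \<Omega> (x + y) \<partial>M)" for y
  have D_eq: "D y = emeasure M {x. x + y \<in> \<Omega>}" for y
  proof -
    have *: "{x. x + y \<in> \<Omega>} \<in> sets M"
      using measurable_sets[of "\<lambda>x. x + y" M M \<Omega>] by (simp add: vimage_def)
    show ?thesis
      unfolding D_def nn_integral_indicator[OF *, symmetric] by (intro nn_integral_cong) (simp add: indicator_def)
  qed
  have D_pos: "0 < D y" and D_fin: "D y < \<infinity>" for y using pos fin by (auto simp: D_eq)
  have [measurable]: "D \<in> borel_measurable M" unfolding D_def by measurable
  have ae: "AE y in M. D y * (\<integral>\<^sup>+x. g x \<partial>M) = D 0 * (\<integral>\<^sup>+x. g (x + y) \<partial>M)"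
    if [measurable]: "g \<in> borel_measurable M" for g
  proof (rule density_unique2)
      fix A assume [measurable]: "A \<in> sets M"
      let ?f = "\<lambda>y. indicator A (- y) :: ennreal"
      have "(\<integral>\<^sup>+y\<in>A. (D y * (\<integral>\<^sup>+x. g x \<partial>M)) \<partial>M) = (\<integral>\<^sup>+y. ?f (- y) * D y * (\<integral>\<^sup>+x. g x \<partial>M) \<partial>M)"
        by (intro nn_integral_cong) (simp add: mult_ac)
      also have "\<dots> = (\<integral>\<^sup>+y. ?f (- y) * D y \<partial>M) * (\<integral>\<^sup>+x. g x \<partial>M)"
        by (rule nn_integral_multc) measurable
      also have "(\<integral>\<^sup>+y. ?f (- y) * D y \<partial>M) = (\<integral>\<^sup>+x. ?f x \<partial>M) * D 0"
        unfolding D_def by (subst nn_integral_swap_translates) auto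
      also have "(\<integral>\<^sup>+x. ?f x \<partial>M) * D 0 * (\<integral>\<^sup>+x. g x \<partial>M) = D 0 * ((\<integral>\<^sup>+x. ?f x \<partial>M) * (\<integral>\<^sup>+x. g x \<partial>M))"
        by (simp add: mult_ac)
      also have "\<dots> = D 0 * (\<integral>\<^sup>+y. ?f (- y) * (\<integral>\<^sup>+x. g (x + y) \<partial>M) \<partial>M)"
        by (subst nn_integral_swap_translates) auto
      also have "\<dots> = (\<integral>\<^sup>+y. D 0 * (?f (- y) * (\<integral>\<^sup>+x. g (x + y) \<partial>M)) \<partial>M)"
        by (rule nn_integral_cmult[symmetric]) measurable
      also have "\<dots> = (\<integral>\<^sup>+y\<in>A. (D 0 * (\<integral>\<^sup>+x. g (x + y) \<partial>M)) \<partial>M)"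
        by (intro nn_integral_cong) (simp add: mult_ac)
      finally show "(\<integral>\<^sup>+y\<in>A. (D y * (\<integral>\<^sup>+x. g x \<partial>M)) \<partial>M) = (\<integral>\<^sup>+y\<in>A. (D 0 * (\<integral>\<^sup>+x. g (x + y) \<partial>M)) \<partial>M)" .
  qed measurable
  show ?thesis
  proof
    show "0 < D x / D 0" "D x / D 0 < \<infinity>" for x
      using D_pos[of x] D_fin[of x] D_pos[of 0] D_fin[of 0]
      by (auto simp: ennreal_zero_less_divide divide_less_ennreal ennreal_top_mult)
    fix x and g :: "'a \<Rightarrow> ennreal" assume [measurable]: "g \<in> borel_measurable M"
    let ?G = "\<integral>\<^sup>+z. g z \<partial>M" and ?Gx = "\<integral>\<^sup>+z. g (z + x) \<partial>M"
    \<comment> \<open>The null set in \<open>ae\<close> depends on g, so a given x is reached by a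
      detour: some y is good for the translate of g by x, for g at y + x, and for the translated
      window. The three identities combine to the claim at x.\<close>
    have "AE y in M. D y * ?Gx = D 0 * (\<integral>\<^sup>+z. g (z + y + x) \<partial>M)"
      by (rule ae) measurable
    moreover have "AE y in M. D (y + x) * ?G = D 0 * (\<integral>\<^sup>+z. g (z + (y + x)) \<partial>M)"
      by (rule AE_right, rule ae) measurable
    moreover have "AE y in M. D y * (\<integral>\<^sup>+z. indicator \<Omega> (z + x) \<partial>M) = D 0 * (\<integral>\<^sup>+z. indicator \<Omega> (z + y + x) \<partial>M)"
      by (rule ae) measurable
    ultimately have "AE y in M. D y * ?Gx = D (y + x) * ?G \<and> D y * D x = D 0 * D (y + x)"
      by eventually_elim (simp add: add.assoc D_def)
    then obtain y where y: "D y * ?Gx = D (y + x) * ?G" "D y * D x = D 0 * D (y + x)"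
      using AE_ex by blast
    have "D y * (D 0 * ?Gx) = D 0 * (D (y + x) * ?G)"
      unfolding y(1)[symmetric] by (simp add: mult_ac)
    also have "\<dots> = (D y * D x) * ?G" unfolding y(2) by (simp add: mult_ac)
    finally have "D y * (D 0 * ?Gx) = D y * (D x * ?G)" by (simp add: mult_ac)
    then have "D 0 * ?Gx = D x * ?G"
      using D_pos[of y] D_fin[of y] by (auto simp: ennreal_mult_cancel_left)
    moreover have "?Gx = ?Gx * D 0 / D 0"
      using D_pos[of 0] D_fin[of 0] by (simp add: ennreal_mult_divide_eq)
    ultimately show "?Gx = D x / D 0 * ?G"
      by (simp add: ennreal_divide_times ennreal_times_divide mult.commute)
  qed
qed

text \<open>Under right invariance the inner integral in \<open>nn_integral_swap_translates\<close>
  is the constant measure of the window, which is positive and finite and cancels.\<close>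

lemma inversion_invariant:
  assumes right: "\<And>x A. A \<in> sets M \<Longrightarrow> emeasure M ((\<lambda>z. z + x) -` A) = emeasure M A"
  shows "distr M M uminus = M"
proof (rule measure_eqI)
  fix A assume "A \<in> sets (distr M M uminus)"
  then have A [measurable]: "A \<in> sets M" by simp
  obtain \<Omega> where \<Omega> [measurable]: "\<Omega> \<in> sets M"
    and pos: "\<And>y. 0 < emeasure M {x. x + y \<in> \<Omega>}" and fin: "\<And>y. emeasure M {x. x + y \<in> \<Omega>} < \<infinity>"
    using window by blast
  have [simp]: "(\<integral>\<^sup>+x. indicator \<Omega> (x + y) \<partial>M) = emeasure M \<Omega>" for y
  proof -
    have "(\<integral>\<^sup>+x. indicator \<Omega> (x + y) \<partial>M) = (\<integral>\<^sup>+x. indicator ((\<lambda>x. x + y) -` \<Omega>) x \<partial>M)"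
      by (simp add: indicator_def)
    also have "\<dots> = emeasure M ((\<lambda>x. x + y) -` \<Omega>)"
      by (rule nn_integral_indicator) (use measurable_sets[of "\<lambda>x. x + y" M M \<Omega>] in simp)
    finally show ?thesis by (simp add: right)
  qed
  have mA: "uminus -` A \<in> sets M" using measurable_sets[OF uminus_measurable A] by simp
  have "(\<integral>\<^sup>+y. indicator A (- y) * emeasure M \<Omega> \<partial>M) = emeasure M A * emeasure M \<Omega>"
    using nn_integral_swap_translates[of "indicator A" "indicator \<Omega>"] by simp
  also have "(\<integral>\<^sup>+y. indicator A (- y) * emeasure M \<Omega> \<partial>M) = (\<integral>\<^sup>+y. indicator A (- y) \<partial>M) * emeasure M \<Omega>"
    by (rule nn_integral_multc) measurable
  also have "(\<integral>\<^sup>+y. indicator A (- y) \<partial>M) = (\<integral>\<^sup>+y. indicator (uminus -` A) y \<partial>M)"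
    by (simp add: indicator_def)
  also have "\<dots> = emeasure M (uminus -` A)" by (rule nn_integral_indicator[OF mA])
  finally have "emeasure M (uminus -` A) = emeasure M A"
    using pos[of 0] fin[of 0] by (auto simp: mult.commute[of _ "emeasure M \<Omega>"] ennreal_mult_cancel_left)
  then show "emeasure (distr M M uminus) A = emeasure M A" by (simp add: emeasure_distr)
qed simp

end

section \<open>Haar measure on the Baire sets\<close>

text \<open>Addition need not be measurable for the product of the Borel \<open>\<sigma>\<close>-algebras. It is for the
  Baire sets of a \<open>\<sigma>\<close>-compact group, and Haar measurable functions agree almost everywhere with Baire
  measurable ones.\<close>

definition cozero :: "'a::topological_space set \<Rightarrow> bool" where
  "cozero U \<longleftrightarrow> (\<exists>f::'a \<Rightarrow> real. continuous_on UNIV f \<and> U = {x. 0 < f x})"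

definition baire :: "'a::topological_space measure" where
  "baire = sigma UNIV {U. cozero U}"

lemma cozeroI: "continuous_on UNIV f \<Longrightarrow> cozero {x. 0 < (f x :: real)}"
  unfolding cozero_def by auto

lemma cozero_open: "cozero U \<Longrightarrow> open U"
  unfolding cozero_def by (auto intro!: open_Collect_less)

lemma cozero_vimage:
  fixes h :: "'a::topological_space \<Rightarrow> 'b::topological_space"
  assumes "cozero U" "continuous_on UNIV h"
  shows "cozero (h -` U)"
proof -
  obtain f :: "'b \<Rightarrow> real" where f: "continuous_on UNIV f" "U = {x. 0 < f x}"
    using assms(1) unfolding cozero_def by auto
  have "continuous_on UNIV (\<lambda>x. f (h x))"
    by (rule continuous_on_compose2[OF f(1) assms(2)]) auto
  then show ?thesis unfolding f(2) vimage_def by (auto intro: cozeroI)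
qed

lemma cozero_Un:
  assumes "cozero U" "cozero V"
  shows "cozero (U \<union> V)"
proof -
  obtain f g :: "'a \<Rightarrow> real" where fg: "continuous_on UNIV f" "U = {x. 0 < f x}"
    "continuous_on UNIV g" "V = {x. 0 < g x}"
    using assms unfolding cozero_def by auto
  have "cozero {x. 0 < max (f x) (g x)}"
    by (intro cozeroI continuous_intros fg)
  also have "{x. 0 < max (f x) (g x)} = U \<union> V" using fg by auto
  finally show ?thesis .
qed

lemma cozero_empty: "cozero {}"
  using cozeroI[of "\<lambda>x. 0"] by simp

lemma cozero_UN:
  assumes "finite I" "\<And>i. i \<in> I \<Longrightarrow> cozero (U i)"
  shows "cozero (\<Union>i\<in>I. U i)"
  using assms by (induction I rule: finite_induct) (auto intro: cozero_Un cozero_empty)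

lemma space_baire [simp]: "space baire = UNIV"
  by (simp add: baire_def)

lemma sets_baire: "sets baire = sigma_sets UNIV {U. cozero U}"
  by (simp add: baire_def)

lemma cozero_baire: "cozero U \<Longrightarrow> U \<in> sets baire"
  by (auto simp: sets_baire)

lemma sets_baire_subset: "sets (baire :: 'a::topological_space measure) \<subseteq> sets borel"
  unfolding sets_baire
  by (rule sets.sigma_sets_subset'[of _ borel UNIV, simplified]) (auto dest: cozero_open)

lemma id_borel_baire: "(\<lambda>x. x) \<in> measurable borel baire"
  by (rule measurableI) (use sets_baire_subset in auto)

lemma continuous_baire:
  fixes f :: "'a::topological_space \<Rightarrow> real"
  assumes "continuous_on UNIV f"
  shows "f \<in> borel_measurable baire"
proof (rule borel_measurableI_greater)
  fix a
  have "cozero {x. 0 < f x - a}" by (intro cozeroI continuous_intros assms)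
  then show "{x \<in> space baire. a < f x} \<in> sets baire" by (auto dest: cozero_baire)
qed

lemma measurable_baire:
  assumes "\<And>f::'a::topological_space \<Rightarrow> real. continuous_on UNIV f \<Longrightarrow> (\<lambda>x. f (h x)) \<in> borel_measurable N"
  shows "h \<in> measurable N baire"
  unfolding baire_def
proof (rule measurable_measure_of)
  fix U :: "'a set" assume "U \<in> {U. cozero U}"
  then obtain f :: "'a \<Rightarrow> real" where f: "continuous_on UNIV f" "U = {x. 0 < f x}"
    unfolding cozero_def by auto
  have "(\<lambda>x. f (h x)) -` {0<..} \<inter> space N \<in> sets N"
    using measurable_sets[OF assms[OF f(1)]] by auto
  also have "(\<lambda>x. f (h x)) -` {0<..} = h -` U" by (auto simp: f(2))
  finally show "h -` U \<inter> space N \<in> sets N" .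
qed auto

lemma continuous_measurable_baire:
  "continuous_on UNIV h \<Longrightarrow> h \<in> measurable baire baire"
  by (intro measurable_baire continuous_baire) (auto intro: continuous_on_compose2)

lemma baire_vimage: "continuous_on UNIV h \<Longrightarrow> A \<in> sets baire \<Longrightarrow> h -` A \<in> sets baire"
  using measurable_sets[OF continuous_measurable_baire] by fastforce

section \<open>Separation by cozero sets in locally compact Hausdorff spaces\<close>

lemma locally_compactE:
  assumes "locally_compact_space (euclidean :: 'a::topological_space topology)"
  obtains V C where "open V" "compact C" "(x::'a) \<in> V" "V \<subseteq> C"
proof -
  have "\<exists>V C. openin euclidean V \<and> compactin euclidean C \<and> x \<in> V \<and> V \<subseteq> C"
    using assms unfolding locally_compact_space_def by (rule bspec) simp
  then show thesis using that by (auto simp: open_openin[symmetric])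
qed

lemma cozero_nbhd:
  fixes x :: "'a::t2_space"
  assumes lc: "locally_compact_space (euclidean :: 'a topology)" and "open U" "x \<in> U"
  obtains W where "cozero W" "x \<in> W" "W \<subseteq> U"
proof -
  have "Hausdorff_space (euclidean :: 'a topology)"
    unfolding Hausdorff_space_def disjnt_def using hausdorff by (simp, blast)
  then have "completely_regular_space (euclidean :: 'a topology)"
    using lc locally_compact_regular_imp_completely_regular_space by blast
  moreover have "closedin euclidean (- U)" "x \<in> topspace euclidean - (- U)"
    using assms by (auto simp: closed_closedin[symmetric])
  ultimately obtain f :: "'a \<Rightarrow> real" where f: "continuous_map euclidean (top_of_set {0..1}) f"
      "f x = 0" "f ` (- U) \<subseteq> {1}"
    unfolding completely_regular_space_def by blast
  then have "continuous_on UNIV f" by (simp add: continuous_map_in_subtopology)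
  then have "cozero {x. 0 < 1 - f x}" by (intro cozeroI continuous_intros)
  moreover have "x \<in> {x. 0 < 1 - f x}" "{x. 0 < 1 - f x} \<subseteq> U" using f by force+
  ultimately show thesis by (rule that)
qed

text \<open>Finitely many relatively compact cozero neighbourhoods cover K. Inner regularity on open
  sets can thereby be tested on cozero sets, the open sets that generate the Baire
  \<sigma>-algebra.\<close>

lemma cozero_between:
  fixes K :: "'a::t2_space set"
  assumes lc: "locally_compact_space (euclidean :: 'a topology)" and "open U" "compact K" "K \<subseteq> U"
  obtains W C where "cozero W" "compact C" "K \<subseteq> W" "W \<subseteq> U" "W \<subseteq> C"
proof -
  have "\<exists>W C. cozero W \<and> compact C \<and> x \<in> W \<and> W \<subseteq> U \<and> W \<subseteq> C" if "x \<in> K" for x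
  proof -
    obtain V C where V: "open V" "compact C" "x \<in> V" "V \<subseteq> C"
      by (rule locally_compactE[OF lc, of x])
    obtain W where "cozero W" "x \<in> W" "W \<subseteq> U \<inter> V"
      by (rule cozero_nbhd[OF lc, of "U \<inter> V" x]) (use \<open>x \<in> K\<close> assms V in auto)
    with V show ?thesis by blast
  qed
  then obtain W C where WC: "\<And>x. x \<in> K \<Longrightarrow> cozero (W x) \<and> compact (C x) \<and> x \<in> W x \<and> W x \<subseteq> U \<and> W x \<subseteq> C x"
    by metis
  have op: "open (W x)" if "x \<in> K" for x using WC[OF that] cozero_open by blast
  obtain D where D: "D \<subseteq> K" "finite D" "K \<subseteq> (\<Union>x\<in>D. W x)"
    by (rule compactE_image[OF assms(3) op]) (use WC in auto)
  show thesis
  proof (rule that[of "\<Union>x\<in>D. W x" "\<Union>x\<in>D. C x"])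
    show "cozero (\<Union>x\<in>D. W x)" using D WC by (intro cozero_UN) auto
    show "compact (\<Union>x\<in>D. C x)" using D WC by (intro compact_UN) auto
    show "K \<subseteq> (\<Union>x\<in>D. W x)" by (rule D(3))
    show "(\<Union>x\<in>D. W x) \<subseteq> U" using D(1) WC by (intro UN_least) blast
    show "(\<Union>x\<in>D. W x) \<subseteq> (\<Union>x\<in>D. C x)" using D(1) WC by (intro UN_mono) blast+
  qed
qed

text \<open>The function in \<open>positive_integrable\<close>, later \<open>u powr s * \<omega> powr r\<close>, forces \<open>\<sigma>\<close>-compactness.\<close>

locale haar_group =
  fixes \<nu> :: "'a::{topological_group_add, t2_space} measure"
  assumes loc_compact: "locally_compact_space (euclidean :: 'a topology)"
    and haar: "left_haar_borel \<nu>"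
    and positive_integrable: "\<exists>v\<in>borel_measurable (completion \<nu>). (\<forall>x. 0 < v x) \<and> (\<integral>\<^sup>+x. v x \<partial>completion \<nu>) < \<infinity>"
begin

section \<open>Positivity on open sets and \<sigma>-compactness\<close>

lemmas haar_conjuncts = haar[unfolded left_haar_borel_def]

lemma sets_nu [measurable_cong, simp]: "sets \<nu> = sets borel"
  by (rule haar_conjuncts[THEN conjunct1])

lemma nu_nonzero: "emeasure \<nu> UNIV \<noteq> 0"
  by (rule haar_conjuncts[THEN conjunct2, THEN conjunct1])

lemma compact_finite: "compact K \<Longrightarrow> emeasure \<nu> K < \<infinity>"
  by (rule haar_conjuncts[THEN conjunct2, THEN conjunct2, THEN conjunct1, rule_format])

lemma outer_regular:
  "A \<in> sets borel \<Longrightarrow> emeasure \<nu> A = (INF U\<in>{U. open U \<and> A \<subseteq> U}. emeasure \<nu> U)"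
  by (rule haar_conjuncts[THEN conjunct2, THEN conjunct2, THEN conjunct2, THEN conjunct1, rule_format])

lemma inner_regular:
  "open U \<Longrightarrow> emeasure \<nu> U = (SUP K\<in>{K. compact K \<and> K \<subseteq> U}. emeasure \<nu> K)"
  by (rule haar_conjuncts[THEN conjunct2, THEN conjunct2, THEN conjunct2, THEN conjunct2, THEN conjunct1, rule_format])

lemma left_image: "A \<in> sets borel \<Longrightarrow> emeasure \<nu> ((\<lambda>x. a + x) ` A) = emeasure \<nu> A"
  by (rule haar_conjuncts[THEN conjunct2, THEN conjunct2, THEN conjunct2, THEN conjunct2, THEN conjunct2, rule_format])

lemma space_nu [simp]: "space \<nu> = UNIV"
  using sets_eq_imp_space_eq[OF sets_nu] by simp

lemma continuous_translations: "continuous_on UNIV (\<lambda>x::'a. a + x)" "continuous_on UNIV (\<lambda>x::'a. x + a)"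
  "continuous_on UNIV (\<lambda>x::'a. - x)"
  by (auto intro!: continuous_intros)

lemma left_image_eq: "(\<lambda>x. a + x) ` A = (\<lambda>x. - a + x) -` A" for a :: 'a
  using image_eqI[of _ "\<lambda>x. a + x" "- a + _" A] by (auto simp: add.assoc[symmetric])

text \<open>A compact set is covered by finitely many left translates of U. If U were null, all
  compact sets would be, and by inner regularity so would the whole group.\<close>

lemma open_pos:
  assumes "open U" "U \<noteq> {}"
  shows "0 < emeasure \<nu> U"
proof (rule ccontr)
  assume "\<not> 0 < emeasure \<nu> U"
  then have U0: "emeasure \<nu> U = 0" by (simp add: zero_less_iff_neq_zero)
  obtain z where z: "z \<in> U" using assms by auto
  have "emeasure \<nu> K = 0" if K: "compact K" for K
  proof -
    define T where "T k = (\<lambda>x. (k + - z) + x) ` U" for k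
    have op: "open (T k)" for k
      unfolding T_def left_image_eq using assms(1) continuous_translations(1) by (intro open_vimage) auto
    have T0: "emeasure \<nu> (T k) = 0" for k unfolding T_def using U0 assms(1) by (subst left_image) auto
    have "k \<in> T k" for k unfolding T_def by (rule image_eqI[OF _ z]) (simp add: add.assoc)
    then obtain D where D: "D \<subseteq> K" "finite D" "K \<subseteq> (\<Union>k\<in>D. T k)"
      by (metis (no_types, lifting) compactE_image[OF K, of K T] UN_iff op subsetI)
    have "emeasure \<nu> K \<le> emeasure \<nu> (\<Union>k\<in>D. T k)"
      using D op by (intro emeasure_mono) auto
    also have "\<dots> = 0"
    proof -
      have "(\<Union>k\<in>D. T k) \<in> null_sets \<nu>"
        using D(2) op T0 by (intro null_sets_UN' countable_finite) (auto simp: null_sets_def)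
      then show ?thesis by (simp add: null_sets_def)
    qed
    finally show ?thesis by simp
  qed
  then have "emeasure \<nu> UNIV = 0"
    by (subst inner_regular) (auto simp: bot_ennreal[symmetric])
  with nu_nonzero show False by simp
qed

text \<open>The sets where n times the positive integrable v is at least 1 cover the group and have
  finite measure. Each lies in an open \<open>U n\<close> of finite measure, exhausted in measure by
  compact sets \<open>K n j\<close>. A neighbourhood in \<open>U n\<close> of one of its points that
  missed all \<open>K n j\<close> would add positive measure to \<open>U n\<close>. Hence the point
  lies in \<open>K n j - V\<close> for some j, and thus in a compact set.\<close>

lemma sigma_compact:
  obtains C :: "nat \<Rightarrow> 'a set" where "\<And>n. compact (C n)" "(\<Union>n. C n) = UNIV"
proof -
  obtain v where v [measurable]: "v \<in> borel_measurable (completion \<nu>)"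
    and v_pos: "\<And>x. 0 < v x" and v_fin: "(\<integral>\<^sup>+x. v x \<partial>completion \<nu>) < \<infinity>"
    using positive_integrable by auto
  define A where "A n = {x. 1 \<le> of_nat n * v x}" for n
  have A_sets: "A n \<in> sets (completion \<nu>)" for n
  proof -
    have "{x \<in> space (completion \<nu>). 1 \<le> of_nat n * v x} \<in> sets (completion \<nu>)" by measurable
    then show ?thesis by (simp add: A_def)
  qed
  have "\<exists>n. x \<in> A n" for x
  proof (cases "v x")
    case (real r)
    with v_pos[of x] have "0 < r" by auto
    then obtain n :: nat where "1 \<le> real n * r" using ex_less_of_nat_mult[of r 1] by (auto intro: less_imp_le)
    then have "ennreal 1 \<le> ennreal (real n) * ennreal r"
      using \<open>0 < r\<close> by (subst ennreal_mult[symmetric]) (auto simp del: ennreal_1)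
    then show ?thesis using real by (auto simp: A_def ennreal_of_nat_eq_real_of_nat)
  next
    case top
    then show ?thesis by (auto simp: A_def intro!: exI[of _ 1])
  qed
  then have "(\<Union>n. A n) = UNIV" by auto
  have A_fin: "emeasure (completion \<nu>) (A n) < \<infinity>" for n
  proof -
    have "emeasure (completion \<nu>) (A n) \<le> of_nat n * (\<integral>\<^sup>+x. v x \<partial>completion \<nu>)"
      using nn_integral_Markov_inequality[of v UNIV "completion \<nu>" "of_nat n"] by (simp add: A_def)
    also have "\<dots> < \<infinity>" using v_fin by (simp add: ennreal_mult_less_top of_nat_less_top)
    finally show ?thesis .
  qed
  have "\<exists>U. open U \<and> A n \<subseteq> U \<and> emeasure \<nu> U < \<infinity>" for n
  proof -
    obtain A' where A': "A' \<in> sets \<nu>" "A n \<subseteq> A'" "emeasure (completion \<nu>) (A n) = emeasure \<nu> A'"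
      using completion_upper[OF A_sets[of n]] by metis
    have "(INF U\<in>{U. open U \<and> A' \<subseteq> U}. emeasure \<nu> U) < \<infinity>"
      using A_fin[of n] A' by (subst outer_regular[symmetric]) auto
    then show ?thesis using A' by (auto simp: INF_less_iff)
  qed
  then obtain U where U: "\<And>n. open (U n)" "\<And>n. A n \<subseteq> U n" "\<And>n. emeasure \<nu> (U n) < \<infinity>" by metis
  have "\<exists>K::nat \<Rightarrow> 'a set. (\<forall>j. compact (K j) \<and> K j \<subseteq> U n) \<and> emeasure \<nu> (U n) = (SUP j. emeasure \<nu> (K j))" for n
  proof -
    have "{K. compact K \<and> K \<subseteq> U n} \<noteq> {}" by (auto intro: exI[of _ "{}"])
    from ennreal_SUP_countable_SUP[OF this, of "emeasure \<nu>"]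
    obtain f :: "nat \<Rightarrow> ennreal" where f: "range f \<subseteq> emeasure \<nu> ` {K. compact K \<and> K \<subseteq> U n}"
      "emeasure \<nu> (U n) = (SUP i. f i)" using inner_regular[OF U(1)] by metis
    then have "\<exists>K. compact K \<and> K \<subseteq> U n \<and> f j = emeasure \<nu> K" for j by blast
    then obtain K where "\<And>j. compact (K j) \<and> K j \<subseteq> U n \<and> f j = emeasure \<nu> (K j)" by metis
    then show ?thesis using f(2) by (intro exI[of _ K]) auto
  qed
  then obtain K where K: "\<And>n j. compact (K n (j::nat))" "\<And>n j. K n j \<subseteq> U n"
      "\<And>n. emeasure \<nu> (U n) = (SUP j. emeasure \<nu> (K n j))" by metis
  obtain V C where V: "open V" "compact C" "0 \<in> V" "V \<subseteq> (C::'a set)"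
    by (rule locally_compactE[OF loc_compact, of 0])
  define D where "D n j = (\<lambda>(y, w). y + - w) ` (K n j \<times> C)" for n j
  have cD: "compact (D n j)" for n j
    unfolding D_def using K V
    by (intro compact_continuous_image compact_Times) (auto intro!: continuous_intros simp: case_prod_beta)
  have "\<exists>n j. x \<in> D n j" for x
  proof -
    have "x \<in> (\<Union>n. A n)" using \<open>(\<Union>n. A n) = UNIV\<close> by simp
    then obtain n where n: "x \<in> U n" using U(2) by blast
    define T where "T = (\<lambda>w. x + w) ` V \<inter> U n"
    have T: "open T" "x \<in> T"
      unfolding T_def left_image_eq
      using V U n continuous_translations(1) by (auto intro!: open_Int open_vimage)
    have "\<exists>j. K n j \<inter> T \<noteq> {}"
    proof (rule ccontr)
      assume "\<nexists>j. K n j \<inter> T \<noteq> {}"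
      then have disj: "K n j \<inter> T = {}" for j by auto
      have "emeasure \<nu> (K n j) + emeasure \<nu> T \<le> emeasure \<nu> (U n)" for j
      proof -
        have "emeasure \<nu> (K n j) + emeasure \<nu> T = emeasure \<nu> (K n j \<union> T)"
          using disj T K by (intro plus_emeasure) (auto intro: borel_compact)
        also have "\<dots> \<le> emeasure \<nu> (U n)"
          using K(2) U(1) by (intro emeasure_mono) (auto simp: T_def)
        finally show ?thesis .
      qed
      then have "(SUP j. emeasure \<nu> (K n j) + emeasure \<nu> T) \<le> emeasure \<nu> (U n)" by (rule SUP_least)
      then have "emeasure \<nu> (U n) + emeasure \<nu> T \<le> emeasure \<nu> (U n)"
        using K(3)[of n] by (simp add: ennreal_SUP_add_left)
      then have "emeasure \<nu> T = 0" using U(3)[of n]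
        by (metis add.right_neutral ennreal_add_left_cancel_le infinity_ennreal_def le_zero_eq top.not_eq_extremum)
      with open_pos[OF T(1)] T(2) show False by auto
    qed
    then obtain j y w where "y \<in> K n j" "y = x + w" "w \<in> V" unfolding T_def by blast
    then have "x \<in> D n j" unfolding D_def using V(4) by (auto intro!: image_eqI[of _ _ "(x + w, w)"] simp: add.assoc)
    then show ?thesis by blast
  qed
  then have "(\<Union>m. case prod_decode m of (n, j) \<Rightarrow> D n j) = UNIV"
    by (auto intro!: bexI[of _ "prod_encode _"]) (metis case_prod_conv prod_encode_inverse)
  then show thesis using cD by (intro that[of "\<lambda>m. case prod_decode m of (n, j) \<Rightarrow> D n j"]) (auto split: prod.split)
qed

lemma exhaustion:
  obtains W :: "nat \<Rightarrow> 'a set" and D where "\<And>n. cozero (W n)" "\<And>n. compact (D n)" "\<And>n. W n \<subseteq> D n"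
    "(\<Union>n. W n) = UNIV"
proof -
  obtain C :: "nat \<Rightarrow> 'a set" where C: "\<And>n. compact (C n)" "(\<Union>n. C n) = UNIV"
    by (rule sigma_compact) blast
  have "\<exists>W D. cozero W \<and> compact D \<and> C n \<subseteq> W \<and> W \<subseteq> D" for n
    by (rule cozero_between[OF loc_compact open_UNIV C(1)[of n]]) auto
  then obtain W D where "\<And>n. cozero (W n) \<and> compact (D n) \<and> C n \<subseteq> W n \<and> W n \<subseteq> D n" by metis
  then have WD: "\<And>n. cozero (W n)" "\<And>n. compact (D n)" "\<And>n. C n \<subseteq> W n" "\<And>n. W n \<subseteq> D n" by simp_all
  have "(\<Union>n. C n) \<subseteq> (\<Union>n. W n)" by (intro UN_mono WD order_refl)
  then have "(\<Union>n. W n) = UNIV" by (simp only: C(2) top_unique)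
  with WD show thesis by (intro that)
qed

lemma emeasure_subset_compact: "A \<subseteq> K \<Longrightarrow> compact K \<Longrightarrow> emeasure \<nu> A < \<infinity>"
  using compact_finite[of K] emeasure_mono[of A K \<nu>] by (auto simp: borel_compact intro: le_less_trans)

section \<open>Continuous functions on the product and the Baire \<sigma>-algebras\<close>

lemma compact_between_product:
  assumes K: "compact K" and O: "open P" "K \<subseteq> P"
  obtains B :: "('a \<times> 'a) set" where "B \<in> sets (baire \<Otimes>\<^sub>M baire)" "K \<subseteq> B" "B \<subseteq> P"
proof -
  have "\<exists>U V. cozero U \<and> cozero V \<and> p \<in> U \<times> V \<and> U \<times> V \<subseteq> P" if "p \<in> K" for p
  proof -
    obtain A B where AB: "open A" "open B" "p \<in> A \<times> B" "A \<times> B \<subseteq> P"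
      using open_prod_elim[OF O(1), of p] O(2) \<open>p \<in> K\<close> by blast
    obtain U where U: "cozero U" "fst p \<in> U" "U \<subseteq> A"
      by (rule cozero_nbhd[OF loc_compact AB(1), of "fst p"]) (use AB(3) in \<open>auto simp: mem_Times_iff\<close>)
    obtain V where V: "cozero V" "snd p \<in> V" "V \<subseteq> B"
      by (rule cozero_nbhd[OF loc_compact AB(2), of "snd p"]) (use AB(3) in \<open>auto simp: mem_Times_iff\<close>)
    show ?thesis using U V AB(4) by (intro exI[of _ U] exI[of _ V]) (auto simp: mem_Times_iff)
  qed
  then obtain U V where UV: "\<And>p. p \<in> K \<Longrightarrow> cozero (U p) \<and> cozero (V p) \<and> p \<in> U p \<times> V p \<and> U p \<times> V p \<subseteq> P"
    by metis
  have op: "open (U p \<times> V p)" if "p \<in> K" for p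
    using UV[OF that] cozero_open by (intro open_Times) blast+
  obtain D where D: "D \<subseteq> K" "finite D" "K \<subseteq> (\<Union>p\<in>D. U p \<times> V p)"
    by (rule compactE_image[OF K op]) (use UV in blast)+
  show thesis
  proof (rule that[of "\<Union>p\<in>D. U p \<times> V p"])
    show "(\<Union>p\<in>D. U p \<times> V p) \<in> sets (baire \<Otimes>\<^sub>M baire)"
      using D UV by (intro sets.finite_UN pair_measureI cozero_baire) blast+
  qed (use D UV in blast)+
qed

text \<open>\<sigma>-compactness acts here: the set where F > a is a countable union of compact
  sets, and a finite union of cozero rectangles fits between each of them and that open set. For F a
  continuous function of x + y this yields the measurability of addition.\<close>

lemma continuous_measurable_product:
  fixes F :: "'a \<times> 'a \<Rightarrow> real"
  assumes "continuous_on UNIV F"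
  shows "F \<in> borel_measurable (baire \<Otimes>\<^sub>M baire)"
proof (rule borel_measurableI_greater)
  fix a
  obtain C :: "nat \<Rightarrow> 'a set" where C: "\<And>n. compact (C n)" "(\<Union>n. C n) = UNIV"
    by (rule sigma_compact) blast
  define P where "P = {p. a < F p}"
  define K where "K n m k = {p. a + 1 / real (Suc n) \<le> F p} \<inter> (C m \<times> C k)" for n m k
  have P: "open P" unfolding P_def by (intro open_Collect_less continuous_intros assms)
  have K: "compact (K n m k)" for n m k
    unfolding K_def using C
    by (intro closed_Int_compact compact_Times closed_Collect_le continuous_intros assms) auto
  have KP: "K n m k \<subseteq> P" for n m k
  proof
    fix p assume "p \<in> K n m k"
    then have "a + 1 / real (Suc n) \<le> F p" unfolding K_def by blast
    moreover have "0 < 1 / real (Suc n)" by simp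
    ultimately show "p \<in> P" unfolding P_def mem_Collect_eq by linarith
  qed
  have "\<exists>B\<in>sets (baire \<Otimes>\<^sub>M baire). K n m k \<subseteq> B \<and> B \<subseteq> P" for n m k
    by (rule compact_between_product[OF K[of n m k] P KP]) blast
  then obtain B where B: "\<And>n m k. B n m k \<in> sets (baire \<Otimes>\<^sub>M baire)" "\<And>n m k. K n m k \<subseteq> B n m k"
      "\<And>n m k. B n m k \<subseteq> P" by metis
  have "P \<subseteq> (\<Union>n. \<Union>m. \<Union>k. B n m k)"
  proof
    fix p assume "p \<in> P"
    then have "0 < F p - a" by (simp add: P_def)
    then obtain n where "inverse (real (Suc n)) < F p - a" using reals_Archimedean by blast
    then have "a + 1 / real (Suc n) \<le> F p" by (simp add: inverse_eq_divide)
    moreover obtain m k where "fst p \<in> C m" "snd p \<in> C k" using C(2) by blast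
    ultimately have "p \<in> K n m k" unfolding K_def by (simp add: mem_Times_iff)
    with B(2)[of n m k] have "p \<in> B n m k" by (rule subsetD)
    then show "p \<in> (\<Union>n. \<Union>m. \<Union>k. B n m k)" by (intro UN_I UNIV_I)
  qed
  moreover have "(\<Union>n. \<Union>m. \<Union>k. B n m k) \<subseteq> P" by (intro UN_least B(3))
  ultimately have "P = (\<Union>n. \<Union>m. \<Union>k. B n m k)" by (rule antisym)
  also have "\<dots> \<in> sets (baire \<Otimes>\<^sub>M baire)" using B(1) by (intro sets.countable_UN) auto
  finally show "{x \<in> space (baire \<Otimes>\<^sub>M baire). a < F x} \<in> sets (baire \<Otimes>\<^sub>M baire)"
    by (simp add: P_def space_pair_measure)
qed

text \<open>The restriction of \<nu> to the Baire sets, written as an image under the identity so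
  that the transfer rules for \<open>distr\<close> apply.\<close>

definition BM :: "'a measure" where
  "BM = distr \<nu> baire (\<lambda>x. x)"

lemma id_nu_baire [measurable]: "(\<lambda>x. x) \<in> measurable \<nu> baire"
  by (subst measurable_cong_sets[OF sets_nu refl]) (rule id_borel_baire)

lemma sets_BM [simp, measurable_cong]: "sets BM = sets baire"
  by (simp add: BM_def)

lemma space_BM [simp]: "space BM = UNIV"
  by (simp add: BM_def)

lemma emeasure_BM: "A \<in> sets baire \<Longrightarrow> emeasure BM A = emeasure \<nu> A"
  by (simp add: BM_def emeasure_distr)

text \<open>A nonempty relatively compact cozero set serves as window: its right translates are open
  and nonempty, hence of positive measure, and lie in compact sets, hence have finite
  measure.\<close>

sublocale BM: measurable_group BM
proof
  obtain W D where WD: "\<And>n::nat. cozero (W n)" "\<And>n. compact (D n)" "\<And>n. W n \<subseteq> D n"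
    "(\<Union>n. W n) = (UNIV :: 'a set)" by (rule exhaustion) blast
  show "\<exists>A. countable A \<and> A \<subseteq> sets BM \<and> \<Union> A = space BM \<and> (\<forall>a\<in>A. emeasure BM a \<noteq> \<infinity>)"
    using WD emeasure_subset_compact[OF WD(3) WD(2)]
    by (intro exI[of _ "range W"]) (auto simp: cozero_baire emeasure_BM less_top)
  have "(\<lambda>(x, y). x + y) \<in> measurable (baire \<Otimes>\<^sub>M baire) (baire :: 'a measure)"
    unfolding case_prod_beta
  proof (intro measurable_baire continuous_measurable_product)
    fix f :: "'a \<Rightarrow> real" assume "continuous_on UNIV f"
    then show "continuous_on UNIV (\<lambda>p::'a \<times> 'a. f (fst p + snd p))"
      by (rule continuous_on_compose2) (auto intro!: continuous_intros)
  qed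
  then show "(\<lambda>(x, y). x + y) \<in> measurable (BM \<Otimes>\<^sub>M BM) BM"
    by (subst measurable_cong_sets[OF sets_pair_measure_cong[OF sets_BM sets_BM] sets_BM])
  have "uminus \<in> measurable baire (baire :: 'a measure)"
    by (rule continuous_measurable_baire) (use continuous_translations(3) in simp)
  then show "uminus \<in> measurable BM BM" by (subst measurable_cong_sets[OF sets_BM sets_BM])
  show "emeasure BM ((\<lambda>x. a + x) -` A) = emeasure BM A" if "A \<in> sets BM" for a A
  proof -
    have "A \<in> sets borel" using that sets_baire_subset by auto
    from left_image[OF this, of "- a"] show ?thesis
      using that by (simp add: left_image_eq emeasure_BM baire_vimage continuous_translations)
  qed
  have "W n \<noteq> {} \<Longrightarrow> \<forall>y. 0 < emeasure BM {x. x + y \<in> W n} \<and> emeasure BM {x. x + y \<in> W n} < \<infinity>" for n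
  proof
    fix y assume ne: "W n \<noteq> {}"
    have *: "{x. x + y \<in> W n} = (\<lambda>x. x + y) -` W n" by auto
    have c: "cozero {x. x + y \<in> W n}"
      unfolding * by (intro cozero_vimage WD continuous_translations)
    obtain w where "w \<in> W n" using ne by auto
    then have "w + - y \<in> {x. x + y \<in> W n}" by (simp add: add.assoc)
    then have "{x. x + y \<in> W n} \<noteq> {}" by blast
    from open_pos[OF cozero_open[OF c] this] have 1: "0 < emeasure BM {x. x + y \<in> W n}"
      using c by (simp only: emeasure_BM cozero_baire)
    have "x \<in> (\<lambda>z. z + - y) ` D n" if "x + y \<in> W n" for x
      using that WD(3) by (intro image_eqI[of _ _ "x + y"]) (auto simp: add.assoc)
    then have "{x. x + y \<in> W n} \<subseteq> (\<lambda>z. z + - y) ` D n" by blast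
    moreover have "compact ((\<lambda>z. z + - y) ` D n)"
      by (intro compact_continuous_image WD) (auto intro!: continuous_intros)
    ultimately have "emeasure \<nu> {x. x + y \<in> W n} < \<infinity>" by (rule emeasure_subset_compact)
    with 1 c show "0 < emeasure BM {x. x + y \<in> W n} \<and> emeasure BM {x. x + y \<in> W n} < \<infinity>"
      by (simp add: emeasure_BM cozero_baire)
  qed
  moreover have "(0::'a) \<in> (\<Union>n. W n)" unfolding WD(4) by simp
  then obtain n where "W n \<noteq> {}" by blast
  moreover have "W n \<in> sets BM" using WD(1) by (simp add: cozero_baire)
  ultimately show "\<exists>\<Omega>\<in>sets BM. \<forall>y. 0 < emeasure BM {x. x + y \<in> \<Omega>} \<and> emeasure BM {x. x + y \<in> \<Omega>} < \<infinity>"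
    by (intro bexI[of _ "W n"])
qed simp

text \<open>Carries scaling properties from \<open>BM\<close> back to \<nu>. Inner regularity passes
  from cozero to open sets by way of \<open>cozero_between\<close>, and outer regularity from open
  to Borel sets. In the last step an open set around the preimage of A is turned into one around A,
  whence the continuous inverse h'.\<close>

lemma homeomorphism_scale:
  assumes h: "continuous_on UNIV h" "continuous_on UNIV h'" "\<And>x. h (h' x) = x" "\<And>x. h' (h x) = x"
    and c: "0 < c" "c < \<infinity>"
    and W: "\<And>W. cozero W \<Longrightarrow> emeasure \<nu> (h -` W) = c * emeasure \<nu> W"
    and A: "A \<in> sets borel"
  shows "emeasure \<nu> (h -` A) = c * emeasure \<nu> A"
proof -
  have hA: "h -` A \<in> sets borel"
    using measurable_sets[OF borel_measurable_continuous_onI[OF h(1)] A] by simp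
  have op: "emeasure \<nu> (h -` U) = c * emeasure \<nu> U" if U: "open U" for U
  proof (rule antisym)
    have hU: "open (h -` U)" using h(1) U by (simp add: open_vimage)
    show "emeasure \<nu> (h -` U) \<le> c * emeasure \<nu> U"
      unfolding inner_regular[OF hU]
    proof (rule SUP_least)
      fix K assume "K \<in> {K. compact K \<and> K \<subseteq> h -` U}"
      then have K: "compact (h ` K)" "h ` K \<subseteq> U"
        by (auto intro!: compact_continuous_image continuous_on_subset[OF h(1)])
      obtain V C where V: "cozero V" "compact C" "h ` K \<subseteq> V" "V \<subseteq> U" "V \<subseteq> C"
        by (rule cozero_between[OF loc_compact U K])
      have "emeasure \<nu> K \<le> emeasure \<nu> (h -` V)"
        using V h(1) cozero_open[OF V(1)] by (intro emeasure_mono) (auto intro!: borel_open open_vimage)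
      also have "\<dots> \<le> c * emeasure \<nu> U"
        unfolding W[OF V(1)] using V U by (intro mult_left_mono emeasure_mono) auto
      finally show "emeasure \<nu> K \<le> c * emeasure \<nu> U" .
    qed
    show "c * emeasure \<nu> U \<le> emeasure \<nu> (h -` U)"
      unfolding inner_regular[OF U] SUP_mult_left_ennreal
    proof (rule SUP_least)
      fix K assume "K \<in> {K. compact K \<and> K \<subseteq> U}"
      then have K: "compact K" "K \<subseteq> U" by auto
      obtain V C where V: "cozero V" "compact C" "K \<subseteq> V" "V \<subseteq> U" "V \<subseteq> C"
        by (rule cozero_between[OF loc_compact U K])
      have "c * emeasure \<nu> K \<le> c * emeasure \<nu> V"
        using V by (intro mult_left_mono emeasure_mono) (auto intro!: borel_open cozero_open)
      also have "\<dots> \<le> emeasure \<nu> (h -` U)"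
        unfolding W[OF V(1), symmetric] using V hU by (intro emeasure_mono) auto
      finally show "c * emeasure \<nu> K \<le> emeasure \<nu> (h -` U)" .
    qed
  qed
  show ?thesis
  proof (rule antisym)
    have "emeasure \<nu> (h -` A) / c \<le> emeasure \<nu> A"
      unfolding outer_regular[OF A]
    proof (rule INF_greatest)
      fix U assume "U \<in> {U. open U \<and> A \<subseteq> U}"
      then have U: "open U" "A \<subseteq> U" by auto
      have "emeasure \<nu> (h -` A) \<le> emeasure \<nu> (h -` U)"
        using U h(1) by (intro emeasure_mono) (auto intro!: borel_open open_vimage)
      then show "emeasure \<nu> (h -` A) / c \<le> emeasure \<nu> U"
        unfolding op[OF U(1)] using c by (intro divide_le_posI_ennreal) auto
    qed
    then have "c * (emeasure \<nu> (h -` A) / c) \<le> c * emeasure \<nu> A" by (intro mult_left_mono) auto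
    also have "c * (emeasure \<nu> (h -` A) / c) = emeasure \<nu> (h -` A)"
      using c ennreal_mult_divide_eq[of c "emeasure \<nu> (h -` A)"] by (simp add: ennreal_times_divide mult.commute)
    finally show "emeasure \<nu> (h -` A) \<le> c * emeasure \<nu> A" .
    show "c * emeasure \<nu> A \<le> emeasure \<nu> (h -` A)"
      unfolding outer_regular[OF hA]
    proof (rule INF_greatest)
      fix U' assume "U' \<in> {U. open U \<and> h -` A \<subseteq> U}"
      then have U': "open U'" "h -` A \<subseteq> U'" by auto
      have U: "open (h' -` U')" using h(2) U' by (simp add: open_vimage)
      have "A \<subseteq> h' -` U'" using U'(2) h(3) by (metis subsetD subsetI vimageI vimage_eq)
      then have "c * emeasure \<nu> A \<le> c * emeasure \<nu> (h' -` U')"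
        using U by (intro mult_left_mono emeasure_mono) auto
      also have "\<dots> = emeasure \<nu> (h -` (h' -` U'))" by (rule op[OF U, symmetric])
      also have "h -` (h' -` U') = U'" using h(4) by auto
      finally show "c * emeasure \<nu> A \<le> emeasure \<nu> U'" .
    qed
  qed
qed

lemma modular:
  obtains \<delta> :: "'a \<Rightarrow> ennreal" where "\<And>x. 0 < \<delta> x" "\<And>x. \<delta> x < \<infinity>"
    "\<And>x A. A \<in> sets borel \<Longrightarrow> emeasure \<nu> ((\<lambda>z. z + x) -` A) = \<delta> x * emeasure \<nu> A"
proof -
  obtain \<delta> :: "'a \<Rightarrow> ennreal" where \<delta>: "\<And>x. 0 < \<delta> x" "\<And>x. \<delta> x < \<infinity>"
    "\<And>x g. g \<in> borel_measurable BM \<Longrightarrow> (\<integral>\<^sup>+z. g (z + x) \<partial>BM) = \<delta> x * (\<integral>\<^sup>+z. g z \<partial>BM)"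
    by (rule BM.modular_function) blast
  show thesis
  proof (rule that[OF \<delta>(1,2)])
    fix x :: 'a and A :: "'a set" assume "A \<in> sets borel"
    then show "emeasure \<nu> ((\<lambda>z. z + x) -` A) = \<delta> x * emeasure \<nu> A"
    proof (rule homeomorphism_scale[where h' = "\<lambda>z. z + - x", rotated -1])
      fix W :: "'a set" assume W: "cozero W"
      then have W': "W \<in> sets baire" "(\<lambda>z. z + x) -` W \<in> sets baire"
        by (auto intro!: cozero_baire cozero_vimage continuous_translations)
      have "(\<integral>\<^sup>+z. indicator W (z + x) \<partial>BM) = (\<integral>\<^sup>+z. indicator ((\<lambda>z. z + x) -` W) z \<partial>BM)"
        by (intro nn_integral_cong) (simp add: indicator_def)
      moreover have "(indicator W :: 'a \<Rightarrow> ennreal) \<in> borel_measurable BM"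
        by (intro borel_measurable_indicator) (use W' in simp)
      ultimately show "emeasure \<nu> ((\<lambda>z. z + x) -` W) = \<delta> x * emeasure \<nu> W"
        using W' \<delta>(3)[of "indicator W" x] by (simp add: emeasure_BM)
    qed (use \<delta> in \<open>auto simp: add.assoc intro!: continuous_intros\<close>)
  qed
qed

section \<open>Almost everywhere approximation by Baire sets and Baire functions\<close>

lemma approx_open:
  assumes U: "open U" "emeasure \<nu> U < \<infinity>"
  shows "\<exists>B\<in>sets baire. AE x in \<nu>. x \<in> U \<longleftrightarrow> x \<in> B"
proof -
  have "{K. compact K \<and> K \<subseteq> U} \<noteq> {}" by (auto intro: exI[of _ "{}"])
  from ennreal_SUP_countable_SUP[OF this, of "emeasure \<nu>"]
  obtain f :: "nat \<Rightarrow> ennreal" where f: "range f \<subseteq> emeasure \<nu> ` {K. compact K \<and> K \<subseteq> U}"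
    "emeasure \<nu> U = (SUP i. f i)" using inner_regular[OF U(1)] by metis
  have "\<exists>W. cozero W \<and> W \<subseteq> U \<and> f j \<le> emeasure \<nu> W" for j
  proof -
    obtain K where K: "compact K" "K \<subseteq> U" "f j = emeasure \<nu> K" using f(1) by blast
    obtain W C where W: "cozero W" "compact C" "K \<subseteq> W" "W \<subseteq> U" "W \<subseteq> C"
      by (rule cozero_between[OF loc_compact U(1) K(1,2)])
    then show ?thesis using K by (auto intro!: exI[of _ W] emeasure_mono borel_open cozero_open)
  qed
  then obtain W where W: "\<And>j. cozero (W j)" "\<And>j. W j \<subseteq> U" "\<And>j. f j \<le> emeasure \<nu> (W j)" by metis
  define B where "B = (\<Union>j. W j)"
  have B: "B \<in> sets baire" unfolding B_def using W cozero_baire by blast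
  have Bo: "open B" unfolding B_def using W cozero_open by blast
  have BU: "B \<subseteq> U" unfolding B_def using W by blast
  have "f j \<le> emeasure \<nu> B" for j
    using W(3)[of j] emeasure_mono[of "W j" B \<nu>] Bo by (auto simp: B_def intro: order_trans)
  then have "emeasure \<nu> U \<le> emeasure \<nu> B" unfolding f(2) by (rule SUP_least)
  then have "emeasure \<nu> (U - B) = 0"
    using emeasure_Diff[of \<nu> B U] BU Bo U emeasure_mono[OF BU, of \<nu>] by (auto simp: diff_eq_0_iff_ennreal less_top)
  then have "AE x in \<nu>. x \<notin> U - B" using U Bo by (intro AE_not_in) (auto simp: null_sets_def)
  then show ?thesis using B BU by (intro bexI[of _ B]) (auto elim: eventually_mono)
qed

text \<open>The regularity arguments compare nested sets by their measures, which must be finite, so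
  A is cut down to the relatively compact \<open>W n\<close>. There A is almost equal to a countable
  intersection of open sets, and these are handled by \<open>approx_open\<close>.\<close>

lemma approx_borel:
  assumes A: "A \<in> sets borel"
  shows "\<exists>B\<in>sets baire. AE x in \<nu>. x \<in> A \<longleftrightarrow> x \<in> B"
proof -
  obtain W D where WD: "\<And>n::nat. cozero (W n)" "\<And>n. compact (D n)" "\<And>n. W n \<subseteq> D n"
    "(\<Union>n. W n) = (UNIV :: 'a set)" by (rule exhaustion) blast
  have Wo: "open (W n)" for n using WD cozero_open by blast
  have *: "\<exists>B\<in>sets baire. AE x in \<nu>. x \<in> A \<inter> W n \<longleftrightarrow> x \<in> B" for n
  proof -
    let ?A = "A \<inter> W n"
    have A': "?A \<in> sets borel" using A Wo by auto
    have fin: "emeasure \<nu> ?A < \<infinity>" by (rule emeasure_subset_compact[OF _ WD(2)[of n]]) (use WD(3) in blast)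
    let ?I = "{U. open U \<and> ?A \<subseteq> U}"
    have "emeasure \<nu> ` ?I \<noteq> {}" by (auto intro: exI[of _ UNIV])
    from ennreal_Inf_countable_INF[OF this]
    obtain f :: "nat \<Rightarrow> ennreal" where f: "range f \<subseteq> emeasure \<nu> ` ?I"
      "emeasure \<nu> ?A = (INF i. f i)" using outer_regular[OF A'] by metis
    then have "\<exists>U. open U \<and> ?A \<subseteq> U \<and> f j = emeasure \<nu> U" for j by blast
    then obtain U where U: "\<And>j. open (U j)" "\<And>j. ?A \<subseteq> U j" "\<And>j. f j = emeasure \<nu> (U j)" by metis
    have "\<exists>B\<in>sets baire. AE x in \<nu>. x \<in> U j \<inter> W n \<longleftrightarrow> x \<in> B" for j
    proof (rule approx_open)
      show "open (U j \<inter> W n)" using U Wo by auto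
      show "emeasure \<nu> (U j \<inter> W n) < \<infinity>" by (rule emeasure_subset_compact[OF _ WD(2)[of n]]) (use WD(3) in blast)
    qed
    then obtain B where B: "\<And>j. B j \<in> sets baire" "\<And>j. AE x in \<nu>. x \<in> U j \<inter> W n \<longleftrightarrow> x \<in> B j" by metis
    define G where "G = (\<Inter>j. U j \<inter> W n)"
    have G: "G \<in> sets borel" unfolding G_def using U Wo by (intro sets.countable_INT) auto
    have AG: "?A \<subseteq> G" unfolding G_def using U by blast
    have "emeasure \<nu> G \<le> f j" for j
      unfolding U(3) using U(1) by (intro emeasure_mono) (auto simp: G_def)
    then have "emeasure \<nu> G \<le> emeasure \<nu> ?A" unfolding f(2) by (rule INF_greatest)
    then have "emeasure \<nu> (G - ?A) = 0"
      using emeasure_Diff[of \<nu> ?A G] AG G A' fin emeasure_mono[OF AG, of \<nu>] by (auto simp: diff_eq_0_iff_ennreal less_top)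
    then have "AE x in \<nu>. x \<notin> G - ?A" using G A' by (intro AE_not_in) (auto simp: null_sets_def)
    moreover have "AE x in \<nu>. \<forall>j. x \<in> U j \<inter> W n \<longleftrightarrow> x \<in> B j" using B(2) by (simp add: AE_all_countable)
    ultimately have "AE x in \<nu>. x \<in> ?A \<longleftrightarrow> x \<in> (\<Inter>j. B j)"
      by eventually_elim (use AG in \<open>auto simp: G_def\<close>)
    moreover have "(\<Inter>j. B j) \<in> sets baire" using B(1) by (intro sets.countable_INT) auto
    ultimately show ?thesis by blast
  qed
  then obtain B where B: "\<And>n. B n \<in> sets baire" "\<And>n. AE x in \<nu>. x \<in> A \<inter> W n \<longleftrightarrow> x \<in> B n" by metis
  have "AE x in \<nu>. \<forall>n. x \<in> A \<inter> W n \<longleftrightarrow> x \<in> B n" using B(2) by (simp add: AE_all_countable)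
  then have "AE x in \<nu>. x \<in> A \<longleftrightarrow> x \<in> (\<Union>n. B n)"
    by eventually_elim (use WD(4) in blast)
  moreover have "(\<Union>n. B n) \<in> sets baire" using B(1) by auto
  ultimately show ?thesis by blast
qed

lemma approx_set:
  assumes A: "A \<in> sets (completion \<nu>)"
  shows "\<exists>B\<in>sets baire. AE x in \<nu>. x \<in> A \<longleftrightarrow> x \<in> B"
proof -
  obtain S N N' where SN: "A = S \<union> N" "S \<in> sets \<nu>" "N' \<in> null_sets \<nu>" "N \<subseteq> N'"
    using A by (rule sets_completionE)
  obtain B where B: "B \<in> sets baire" "AE x in \<nu>. x \<in> S \<longleftrightarrow> x \<in> B" using approx_borel SN by auto
  have "AE x in \<nu>. x \<notin> N'" using SN(3) by (rule AE_not_in)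
  then have "AE x in \<nu>. x \<in> A \<longleftrightarrow> x \<in> B" using B(2) by eventually_elim (use SN in auto)
  with B(1) show ?thesis by (intro bexI[of _ B])
qed

text \<open>Each simple function of an approximating sequence is altered level set by level set.
  Taking \<open>lim\<close> yields a Baire function defined everywhere; its values where the altered
  sequence diverges are irrelevant, since this happens only on a null set.\<close>

lemma approx_function:
  fixes f :: "'a \<Rightarrow> 'b::{banach, second_countable_topology}"
  assumes f: "f \<in> borel_measurable (completion \<nu>)"
  obtains g where "g \<in> borel_measurable baire" "AE x in \<nu>. f x = g x"
proof -
  obtain F where F: "\<And>i. simple_function (completion \<nu>) (F i)" "\<And>x. (\<lambda>i. F i x) \<longlonglongrightarrow> f x"
    using borel_measurable_implies_sequence_metric[OF f, of 0] by auto
  have "\<exists>g\<in>borel_measurable baire. AE x in \<nu>. F i x = g x" for i :: nat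
  proof -
    have fin: "finite (range (F i))" using F(1)[of i] by (simp add: simple_function_def)
    have "F i -` {c} \<in> sets (completion \<nu>)" for c
      using simple_functionD(2)[OF F(1)[of i], of "{c}"] by simp
    from approx_set[OF this]
    obtain B where B: "\<And>c. B c \<in> sets baire" "\<And>c. AE x in \<nu>. x \<in> F i -` {c} \<longleftrightarrow> x \<in> B c" by metis
    define g where "g x = (\<Sum>c\<in>range (F i). indicator (B c) x *\<^sub>R c)" for x
    have "AE x in \<nu>. \<forall>c\<in>range (F i). x \<in> F i -` {c} \<longleftrightarrow> x \<in> B c"
      using B(2) fin by (intro AE_finite_allI) auto
    then have "AE x in \<nu>. F i x = g x"
    proof eventually_elim
      fix x assume *: "\<forall>c\<in>range (F i). x \<in> F i -` {c} \<longleftrightarrow> x \<in> B c"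
      have "g x = (\<Sum>c\<in>range (F i). if c = F i x then c else 0)"
        unfolding g_def
      proof (intro sum.cong refl)
        fix c assume "c \<in> range (F i)"
        with * have "x \<in> F i -` {c} \<longleftrightarrow> x \<in> B c" by blast
        then show "indicator (B c) x *\<^sub>R c = (if c = F i x then c else 0)"
          by (auto simp: indicator_def)
      qed
      also have "\<dots> = F i x" using fin by simp
      finally show "F i x = g x" by simp
    qed
    moreover have "g \<in> borel_measurable baire"
      unfolding g_def using B(1) by measurable
    ultimately show ?thesis by blast
  qed
  then obtain G where G: "\<And>i. G i \<in> borel_measurable baire" "\<And>i. AE x in \<nu>. F i x = G i x" by metis
  show thesis
  proof (rule that)
    show "(\<lambda>x. lim (\<lambda>i. G i x)) \<in> borel_measurable baire"
      using G(1) by (rule borel_measurable_lim_metric)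
    have "AE x in \<nu>. \<forall>i. F i x = G i x" using G(2) by (simp add: AE_all_countable)
    then show "AE x in \<nu>. f x = lim (\<lambda>i. G i x)"
    proof eventually_elim
      fix x assume "\<forall>i. F i x = G i x"
      then have "(\<lambda>i. G i x) \<longlonglongrightarrow> f x" using F(2)[of x] by simp
      then show "f x = lim (\<lambda>i. G i x)" by (simp add: limI)
    qed
  qed
qed

end

section \<open>Consequences of the weight inequality\<close>

text \<open>By induction \<open>L n \<le> (2 - \<theta>) ^ n * (L 0 + n * e)\<close>, and the linear
  factor is harmless against \<open>(1 - \<theta> / 2) ^ n\<close>. It serves for logarithms of
  sequences whose next term is at most a constant times the power 2 - \<theta> of the current one:
  the weight along doublings of a point, and the weighted norms of dyadic powers.\<close>

lemma subdoubling_tendsto_zero: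
  fixes L :: "nat \<Rightarrow> real"
  assumes \<theta>: "0 < \<theta>" "\<theta> < 1" and e: "0 \<le> e"
    and L0: "\<And>n. 0 \<le> L n" and L: "\<And>n. L (Suc n) \<le> e + (2 - \<theta>) * L n"
  shows "(\<lambda>n. L n / 2 ^ n) \<longlonglongrightarrow> 0"
proof -
  have Ln: "L n \<le> (2 - \<theta>) ^ n * (L 0 + real n * e)" for n
  proof (induction n)
    case (Suc n)
    have "1 \<le> (2 - \<theta>) ^ Suc n" using \<theta> by (intro one_le_power) auto
    then have "e \<le> (2 - \<theta>) ^ Suc n * e" using e mult_right_mono[of 1 "(2 - \<theta>) ^ Suc n" e] by simp
    moreover have "(2 - \<theta>) * L n \<le> (2 - \<theta>) * ((2 - \<theta>) ^ n * (L 0 + real n * e))"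
      using Suc \<theta> by (intro mult_left_mono) auto
    ultimately show ?case using L[of n] by (simp add: algebra_simps)
  qed simp
  define x where "x = 1 - \<theta> / 2"
  have x: "0 < x" "x < 1" using \<theta> by (auto simp: x_def)
  have upper: "L n / 2 ^ n \<le> L 0 * x ^ n + e * (real n * x ^ n)" for n
  proof -
    have "(2 - \<theta>) ^ n = 2 ^ n * x ^ n" by (simp add: x_def power_mult_distrib[symmetric] algebra_simps)
    then have "L n \<le> 2 ^ n * (L 0 * x ^ n + e * (real n * x ^ n))" using Ln[of n] by (simp add: algebra_simps)
    then show ?thesis by (simp add: divide_le_eq mult.commute)
  qed
  have "(\<lambda>n. L 0 * x ^ n + e * (real n * x ^ n)) \<longlonglongrightarrow> L 0 * 0 + e * 0"
    using x by (intro tendsto_intros LIMSEQ_power_zero powser_times_n_limit_0) auto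
  then have "(\<lambda>n. L 0 * x ^ n + e * (real n * x ^ n)) \<longlonglongrightarrow> 0" by simp
  then show ?thesis
    by (rule Lim_null_comparison[rotated]) (use L0 upper in auto)
qed

context haar_group
begin

lemma modular_real:
  obtains \<delta> :: "'a \<Rightarrow> real" where "\<And>x. 0 < \<delta> x"
    "\<And>x A. A \<in> sets borel \<Longrightarrow> emeasure \<nu> ((\<lambda>z. z + x) -` A) = ennreal (\<delta> x) * emeasure \<nu> A"
    "\<And>x y. \<delta> (x + y) = \<delta> x * \<delta> y"
proof -
  obtain d where d: "\<And>x. 0 < d x" "\<And>x. d x < \<infinity>"
    "\<And>x A. A \<in> sets borel \<Longrightarrow> emeasure \<nu> ((\<lambda>z. z + x) -` A) = d x * emeasure \<nu> A"
    by (rule modular) blast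
  obtain W D where WD: "\<And>n::nat. cozero (W n)" "\<And>n. compact (D n)" "\<And>n. W n \<subseteq> D n"
    "(\<Union>n. W n) = (UNIV :: 'a set)" by (rule exhaustion) blast
  have "(0::'a) \<in> (\<Union>n. W n)" unfolding WD(4) by simp
  then obtain n where n: "W n \<noteq> {}" by blast
  have pos: "0 < emeasure \<nu> (W n)" using open_pos[OF cozero_open[OF WD(1)] n] .
  have fin: "emeasure \<nu> (W n) < \<infinity>" by (rule emeasure_subset_compact[OF WD(3) WD(2)])
  have Wb: "W n \<in> sets borel" using cozero_open[OF WD(1)] by simp
  have mult: "d (x + y) = d x * d y" for x y
  proof -
    have "(\<lambda>z. z + y) -` W n \<in> sets borel"
      using cozero_open[OF cozero_vimage[OF WD(1) continuous_translations(2)]] by simp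
    note * = d(3)[OF this, of x]
    have "d (x + y) * emeasure \<nu> (W n) = emeasure \<nu> ((\<lambda>z. z + (x + y)) -` W n)"
      by (rule d(3)[OF Wb, symmetric])
    also have "(\<lambda>z. z + (x + y)) -` W n = (\<lambda>z. z + x) -` ((\<lambda>z. z + y) -` W n)"
      by (auto simp: add.assoc)
    also have "emeasure \<nu> \<dots> = d x * (d y * emeasure \<nu> (W n))" by (simp only: * d(3)[OF Wb])
    finally have "d (x + y) * emeasure \<nu> (W n) = d x * (d y * emeasure \<nu> (W n))" .
    then have "emeasure \<nu> (W n) * d (x + y) = emeasure \<nu> (W n) * (d x * d y)" by (simp add: mult_ac)
    then show ?thesis using pos fin by (auto simp: ennreal_mult_cancel_left)
  qed
  have r: "d x = ennreal (enn2real (d x))" for x using d(2)[of x] by simp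
  show thesis
  proof (rule that[of "\<lambda>x. enn2real (d x)"])
    show "0 < enn2real (d x)" for x using d(1,2)[of x] by (simp add: enn2real_positive_iff)
    show "emeasure \<nu> ((\<lambda>z. z + x) -` A) = ennreal (enn2real (d x)) * emeasure \<nu> A"
      if "A \<in> sets borel" for x A using d(3)[OF that] r[of x] by simp
    show "enn2real (d (x + y)) = enn2real (d x) * enn2real (d y)" for x y
      by (simp add: mult enn2real_mult)
  qed
qed

text \<open>Averaging \<open>u powr s * \<omega> powr r\<close> over a translate of a fixed set \<open>B\<close> produces points of the
  translate where \<open>u\<close> is at most a multiple of \<open>\<omega> powr - (r / s)\<close>. If the modular function \<open>\<delta>\<close>
  exceeded 1 at \<open>- x\<close>, it would grow like \<open>exp (2 ^ n * const)\<close> along \<open>x, 2 x, 4 x, \<dots>\<close>, whereas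
  \<open>\<delta> (- x)\<close> is bounded by a power of \<open>\<omega> x\<close> and \<open>ln \<omega>\<close> grows by a factor less than 2 at each doubling.\<close>

lemma weight_consequences:
  fixes \<omega> u :: "'a \<Rightarrow> real" and r s c :: real
  assumes meas: "\<omega> \<in> borel_measurable (completion \<nu>)" "u \<in> borel_measurable (completion \<nu>)"
    and w1: "\<And>x. 1 \<le> \<omega> x" and w_sym: "\<And>x. \<omega> (- x) = \<omega> x"
    and w_sub: "\<And>x y. \<omega> (x + y) \<le> \<omega> x * \<omega> y"
    and u0: "\<And>x. 0 \<le> u x" and c: "0 < c" "\<And>x. c \<le> \<omega> x * u x"
    and ineq: "\<And>x y. \<omega> (x + y) \<le> \<omega> x * \<omega> y * (u x + u y)"
    and rs: "0 < r" "r < s"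
    and fin: "(\<integral>\<^sup>+x. ennreal (u x powr s * \<omega> x powr r) \<partial>completion \<nu>) < \<infinity>"
  shows "\<And>x A. A \<in> sets borel \<Longrightarrow> emeasure \<nu> ((\<lambda>z. z + x) -` A) = emeasure \<nu> A"
    and "\<exists>D>0. \<forall>x y. \<omega> (x + y) \<le> D * \<omega> x * \<omega> y * (\<omega> x powr - (r / s) + \<omega> y powr - (r / s))"
proof -
  have s0: "0 < s" using rs by simp
  have w0: "0 < \<omega> x" for x using w1[of x] by linarith
  define v where "v x = u x powr s * \<omega> x powr r" for x
  have v_meas: "v \<in> borel_measurable (completion \<nu>)"
    unfolding v_def using meas by measurable
  define I where "I = enn2real (\<integral>\<^sup>+x. ennreal (v x) \<partial>completion \<nu>)"
  have I: "(\<integral>\<^sup>+x. ennreal (v x) \<partial>completion \<nu>) = ennreal I"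
    using fin by (simp add: I_def v_def)
  have I0: "0 \<le> I" by (simp add: I_def)
  have v_low: "c powr s * \<omega> x powr (r - s) \<le> v x" for x
  proof -
    have "c / \<omega> x \<le> u x" using c(2)[of x] w0[of x] by (simp add: field_simps)
    then have "(c / \<omega> x) powr s \<le> u x powr s" using c w0[of x] s0 by (intro powr_mono2) auto
    then have "(c / \<omega> x) powr s * \<omega> x powr r \<le> v x" unfolding v_def by (intro mult_right_mono) auto
    also have "(c / \<omega> x) powr s * \<omega> x powr r = c powr s * \<omega> x powr (r - s)"
      using c w0[of x] by (simp add: powr_divide powr_diff)
    finally show ?thesis .
  qed
  have cheb: "\<kappa> * b \<le> I" if A: "A \<in> sets borel" "emeasure \<nu> A = ennreal b" "0 \<le> b" "0 \<le> \<kappa>" "\<And>x. x \<in> A \<Longrightarrow> \<kappa> \<le> v x" for A b \<kappa>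
  proof -
    have A': "A \<in> sets (completion \<nu>)" using A by (simp add: sets_completionI_sets)
    have "ennreal (\<kappa> * b) = ennreal \<kappa> * emeasure (completion \<nu>) A" using A by (simp add: ennreal_mult)
    also have "\<dots> = (\<integral>\<^sup>+x. ennreal \<kappa> * indicator A x \<partial>completion \<nu>)" using A' by (simp add: nn_integral_cmult_indicator)
    also have "\<dots> \<le> (\<integral>\<^sup>+x. ennreal (v x) \<partial>completion \<nu>)"
      using A by (intro nn_integral_mono) (auto simp: indicator_def intro!: ennreal_leI)
    finally show ?thesis unfolding I using I0 by (simp add: ennreal_le_iff)
  qed
  have "\<exists>n. emeasure (completion \<nu>) {x. \<omega> x \<le> real n} \<noteq> 0"
  proof (rule ccontr)
    assume "\<nexists>n. emeasure (completion \<nu>) {x. \<omega> x \<le> real n} \<noteq> 0"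
    then have z: "emeasure (completion \<nu>) {x. \<omega> x \<le> real n} = 0" for n by blast
    have m: "{x. \<omega> x \<le> real n} \<in> sets (completion \<nu>)" for n
      using measurable_sets[OF meas(1), of "{..real n}"] by (simp add: vimage_def)
    have "emeasure (completion \<nu>) (\<Union>n. {x. \<omega> x \<le> real n}) = 0"
      by (intro emeasure_UN_eq_0 z) (use m in auto)
    moreover have "(\<Union>n. {x. \<omega> x \<le> real n}) = UNIV" using real_arch_simple by auto
    ultimately show False using nu_nonzero sets.top[of "completion \<nu>"] by (simp del: sets.top)
  qed
  then obtain n where n: "emeasure (completion \<nu>) {x. \<omega> x \<le> real n} \<noteq> 0" by blast
  define S where "S = {x. \<omega> x \<le> real n}"
  have S: "S \<in> sets (completion \<nu>)"
    unfolding S_def using measurable_sets[OF meas(1), of "{..real n}"] by (simp add: vimage_def)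
  \<comment> \<open>S is measurable only for the completion; its main part is a Borel set of the
    same measure, so the modular function applies to its translates.\<close>
  define B where "B = main_part \<nu> S"
  have B: "B \<in> sets borel" using main_part_sets[OF S] by (simp add: B_def)
  have BS: "B \<subseteq> S" using main_part_null_part_Un[OF S] by (auto simp: B_def)
  have Bpos: "0 < emeasure \<nu> B"
    using n S unfolding B_def S_def[symmetric] by (simp add: zero_less_iff_neq_zero)
  have "B \<noteq> {}" using Bpos by auto
  then obtain z0 where "z0 \<in> B" by auto
  define R where "R = real n"
  have BR: "\<omega> z \<le> R" if "z \<in> B" for z using BS that by (auto simp: S_def R_def)
  have R1: "1 \<le> R" using BR[OF \<open>z0 \<in> B\<close>] w1[of z0] by linarith
  have v_B: "c powr s * (R * M) powr (r - s) \<le> v x" if "\<omega> x \<le> R * M" "1 \<le> M" for x M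
  proof -
    have "(R * M) powr (r - s) \<le> \<omega> x powr (r - s)"
      using that w0[of x] rs R1 by (intro powr_mono2') auto
    then show ?thesis using v_low[of x] mult_left_mono[of "(R * M) powr (r - s)" "\<omega> x powr (r - s)" "c powr s"] by simp
  qed
  \<comment> \<open>On B the integrand v stays above a positive constant, so the finite integral
    bounds the measure of B.\<close>
  have "emeasure \<nu> B < \<infinity>"
  proof (rule ccontr)
    assume "\<not> emeasure \<nu> B < \<infinity>"
    then have top: "emeasure \<nu> B = \<infinity>" by (simp add: less_top[symmetric])
    define \<kappa> where "\<kappa> = c powr s * (R * 1) powr (r - s)"
    have k0: "0 < \<kappa>" using c R1 by (simp add: \<kappa>_def)
    have "ennreal \<kappa> * emeasure (completion \<nu>) B = (\<integral>\<^sup>+x. ennreal \<kappa> * indicator B x \<partial>completion \<nu>)"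
      using B by (simp add: nn_integral_cmult_indicator sets_completionI_sets)
    also have "\<dots> \<le> (\<integral>\<^sup>+x. ennreal (v x) \<partial>completion \<nu>)"
      using v_B[of _ 1] BR by (intro nn_integral_mono) (auto simp: indicator_def \<kappa>_def intro!: ennreal_leI)
    finally show False using B top k0 unfolding I by (simp add: ennreal_mult_top top_unique)
  qed
  then obtain b where b: "emeasure \<nu> B = ennreal b" "0 < b"
    using Bpos by (cases "emeasure \<nu> B") auto
  have Ipos: "0 < I"
  proof -
    have "c powr s * (R * 1) powr (r - s) * b \<le> I" using b v_B[of _ 1] BR by (intro cheb[OF B]) auto
    moreover have "0 < c powr s * (R * 1) powr (r - s) * b" using b c R1 by simp
    ultimately show ?thesis by linarith
  qed
  obtain \<delta> :: "'a \<Rightarrow> real" where \<delta>: "\<And>x. 0 < \<delta> x"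
    "\<And>x A. A \<in> sets borel \<Longrightarrow> emeasure \<nu> ((\<lambda>z. z + x) -` A) = ennreal (\<delta> x) * emeasure \<nu> A"
    "\<And>x y. \<delta> (x + y) = \<delta> x * \<delta> y" by (rule modular_real) blast
  define \<theta> where "\<theta> = r / s"
  have th: "0 < \<theta>" "\<theta> < 1" using rs by (auto simp: \<theta>_def)
  \<comment> \<open>If u powr s exceeded K * \<omega> x powr -r on a whole translate of B, v would
    be at least 2 * I / b there and its integral at least 2 * I. The factor R powr r makes up for
    \<omega> w, which on the translate is only known to be at least \<omega> x / R.\<close>
  define K where "K = 2 * I / b * R powr r"
  have K0: "0 < K" using Ipos b R1 by (simp add: K_def)
  have small: "u w \<le> K powr (1 / s) * \<omega> x powr - \<theta>" if "u w powr s \<le> K * \<omega> x powr - r" for w x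
  proof -
    have "u w = (u w powr s) powr (1 / s)" using u0[of w] s0 by (simp add: powr_powr)
    also have "\<dots> \<le> (K * \<omega> x powr - r) powr (1 / s)" using that s0 by (intro powr_mono2) auto
    also have "\<dots> = K powr (1 / s) * \<omega> x powr - \<theta>"
      using K0 w0[of x] by (simp add: powr_mult powr_powr \<theta>_def)
    finally show ?thesis .
  qed
  have average: "\<exists>w\<in>A. u w powr s \<le> K * \<omega> x powr - r"
    if A: "A \<in> sets borel" "emeasure \<nu> A = ennreal b'" "b \<le> b'" and Ax: "\<And>w. w \<in> A \<Longrightarrow> \<omega> x \<le> R * \<omega> w" for A b' x
  proof (rule ccontr)
    assume "\<not> ?thesis"
    then have *: "K * \<omega> x powr - r < u w powr s" if "w \<in> A" for w using that by auto
    have "2 * I / b * b' \<le> I"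
    proof (rule cheb[OF A(1,2)])
      fix w assume w: "w \<in> A"
      have "2 * I / b = K * \<omega> x powr - r * (\<omega> x / R) powr r"
        using R1 w0[of x] by (simp add: K_def powr_divide powr_minus field_simps)
      also have "\<dots> \<le> u w powr s * \<omega> w powr r"
        using *[OF w] Ax[OF w] R1 w0[of x] w0[of w] rs K0
        by (intro mult_mono powr_mono2) (auto simp: field_simps)
      finally show "2 * I / b \<le> v w" by (simp add: v_def)
    qed (use b A Ipos in auto)
    moreover have "2 * I \<le> 2 * I / b * b'" using A(3) b Ipos by (simp add: field_simps)
    ultimately show False using Ipos by linarith
  qed
  \<comment> \<open>The average is taken over the right translate B + x. Its measure is \<delta>
    (-x) * b, and the condition on \<delta> keeps this at least b; left translates have measure b
    without any condition.\<close>
  have right: "\<exists>z\<in>B. u (z + x) \<le> K powr (1 / s) * \<omega> x powr - \<theta>" if "1 \<le> \<delta> (- x)" for x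
  proof -
    let ?A = "(\<lambda>z. z + - x) -` B"
    have "?A \<in> sets borel"
      using measurable_sets[OF borel_measurable_continuous_onI[OF continuous_translations(2)[of "- x"]] B]
      by (simp only: space_borel Int_UNIV_right)
    moreover have "emeasure \<nu> ?A = ennreal (\<delta> (- x) * b)"
      using \<delta>(1)[of "- x"] by (simp only: \<delta>(2)[OF B] b(1) ennreal_mult')
    moreover have "b \<le> \<delta> (- x) * b" using that b by simp
    moreover have "\<omega> x \<le> R * \<omega> w" if "w \<in> ?A" for w
    proof -
      have "\<omega> x = \<omega> (- (w + - x) + w)" by (simp add: minus_add add.assoc)
      also have "\<dots> \<le> \<omega> (w + - x) * \<omega> w" using w_sub[of "- (w + - x)" w] by (simp only: w_sym)
      also have "\<dots> \<le> R * \<omega> w" using that BR w0[of w] by (intro mult_right_mono) auto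
      finally show ?thesis .
    qed
    ultimately obtain w where w: "w \<in> ?A" "u w powr s \<le> K * \<omega> x powr - r" using average by blast
    then show ?thesis using small[OF w(2)] by (intro bexI[of _ "w + - x"]) (auto simp: add.assoc)
  qed
  have left: "\<exists>z\<in>B. u (y + z) \<le> K powr (1 / s) * \<omega> y powr - \<theta>" for y
  proof -
    let ?A = "(\<lambda>z. - y + z) -` B"
    have "?A \<in> sets borel"
      using measurable_sets[OF borel_measurable_continuous_onI[OF continuous_translations(1)] B] by simp
    moreover have "emeasure \<nu> ?A = ennreal b"
      using left_image[OF B, of y] b unfolding left_image_eq by simp
    moreover have "\<omega> y \<le> R * \<omega> w" if "w \<in> ?A" for w
    proof -
      have "\<omega> y = \<omega> (w + - (- y + w))" by (simp add: minus_add add.assoc[symmetric])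
      also have "\<dots> \<le> \<omega> w * \<omega> (- y + w)" using w_sub[of w "- (- y + w)"] by (simp only: w_sym)
      also have "\<dots> \<le> \<omega> w * R" using that BR w0[of w] by (intro mult_left_mono) auto
      finally show ?thesis by (simp add: mult.commute)
    qed
    ultimately obtain w where w: "w \<in> ?A" "u w powr s \<le> K * \<omega> y powr - r" using average[of ?A b y] by blast
    then show ?thesis using small[OF w(2)] by (intro bexI[of _ "- y + w"]) (auto simp: add.assoc[symmetric])
  qed
  define D where "D = R ^ 4 * K powr (1 / s)"
  have D0: "0 < D" using R1 K0 by (simp add: D_def)
  have doubling: "\<omega> (x + y) \<le> D * \<omega> x * \<omega> y * (\<omega> x powr - \<theta> + \<omega> y powr - \<theta>)" if "1 \<le> \<delta> (- x)" for x y
  proof -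
    obtain z where z: "z \<in> B" "u (z + x) \<le> K powr (1 / s) * \<omega> x powr - \<theta>" using right \<open>1 \<le> \<delta> (- x)\<close> by blast
    obtain z' where z': "z' \<in> B" "u (y + z') \<le> K powr (1 / s) * \<omega> y powr - \<theta>" using left by blast
    let ?k = "K powr (1 / s)" and ?p = "\<omega> x powr - \<theta> + \<omega> y powr - \<theta>"
    have zx: "\<omega> (z + x) \<le> R * \<omega> x"
      using order_trans[OF w_sub[of z x] mult_right_mono[OF BR[OF z(1)], of "\<omega> x"]] w0[of x] by simp
    have yz: "\<omega> (y + z') \<le> \<omega> y * R"
      using order_trans[OF w_sub[of y z'] mult_left_mono[OF BR[OF z'(1)], of "\<omega> y"]] w0[of y] by simp
    \<comment> \<open>The inequality is applied at the perturbed points z + x and y + z', where u is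
      small. Splitting off -z and -z', and comparing \<omega> at the two perturbed points with
      \<omega> x and \<omega> y, costs a factor R each time: hence R ^ 4 in D.\<close>
    have "\<omega> (x + y) = \<omega> (- z + ((z + x) + (y + z')) + - z')" by (simp add: add.assoc) (simp add: add.assoc[symmetric])
    also have "\<dots> \<le> \<omega> (- z + ((z + x) + (y + z'))) * \<omega> (- z')" by (rule w_sub)
    also have "\<dots> \<le> (\<omega> (- z) * \<omega> ((z + x) + (y + z'))) * \<omega> (- z')"
      using w0[of "- z'"] by (intro mult_right_mono w_sub) simp
    also have "\<dots> = \<omega> z * \<omega> z' * \<omega> ((z + x) + (y + z'))" by (simp add: w_sym)
    also have "\<dots> \<le> (R * R) * (((R * \<omega> x) * (\<omega> y * R)) * (?k * ?p))"
    proof (intro mult_mono)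
      show "\<omega> ((z + x) + (y + z')) \<le> ((R * \<omega> x) * (\<omega> y * R)) * (?k * ?p)"
      proof (rule order_trans[OF ineq], intro mult_mono)
        show "u (z + x) + u (y + z') \<le> ?k * ?p" using z z' by (simp add: algebra_simps)
      qed (use zx yz w0[of x] w0[of y] w0[of "z + x"] w0[of "y + z'"] R1 u0 in auto)
    qed (use BR[OF z(1)] BR[OF z'(1)] w0[of z] w0[of z'] w0 R1 less_imp_le[OF w0] in auto)
    also have "\<dots> = D * \<omega> x * \<omega> y * ?p" by (simp add: D_def power4_eq_xxxx algebra_simps)
    finally show ?thesis .
  qed
  define C where "C = I / (c powr s * b) * R powr (s - r)"
  have C0: "0 < C" using Ipos c b R1 by (simp add: C_def)
  \<comment> \<open>On B + x the weight is at most R * \<omega> x, which bounds v from below there;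
    the integral I then limits the measure \<delta> (-x) * b of this set.\<close>
  have growth: "\<delta> (- x) \<le> C * \<omega> x powr (s - r)" for x
  proof -
    let ?A = "(\<lambda>z. z + - x) -` B"
    have A: "?A \<in> sets borel"
      using measurable_sets[OF borel_measurable_continuous_onI[OF continuous_translations(2)[of "- x"]] B]
      by (simp only: space_borel Int_UNIV_right)
    have mA: "emeasure \<nu> ?A = ennreal (\<delta> (- x) * b)"
      using \<delta>(1)[of "- x"] by (simp only: \<delta>(2)[OF B] b(1) ennreal_mult')
    have "c powr s * (R * \<omega> x) powr (r - s) * (\<delta> (- x) * b) \<le> I"
    proof (rule cheb[OF A mA])
      fix w assume w: "w \<in> ?A"
      have "\<omega> w = \<omega> ((w + - x) + x)" by (simp add: add.assoc)
      also have "\<dots> \<le> \<omega> (w + - x) * \<omega> x" by (rule w_sub)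
      also have "\<dots> \<le> R * \<omega> x" using w BR w0[of x] by (intro mult_right_mono) auto
      finally show "c powr s * (R * \<omega> x) powr (r - s) \<le> v w" by (intro v_B w1)
    qed (use \<delta>(1)[of "- x"] b in auto)
    moreover have "(R * \<omega> x) powr (r - s) = inverse (R powr (s - r) * \<omega> x powr (s - r))"
      using R1 w0[of x] by (simp add: powr_minus[symmetric] powr_mult[symmetric])
    ultimately show ?thesis
      using c b R1 w0[of x] by (simp add: C_def field_simps)
  qed
  have le1: "\<delta> (- x) \<le> 1" for x
  proof (rule ccontr)
    assume "\<not> \<delta> (- x) \<le> 1"
    then have gt: "1 < \<delta> (- x)" by simp
    define X where "X = rec_nat x (\<lambda>_ z. z + z)"
    have X: "X 0 = x" "X (Suc n) = X n + X n" for n by (auto simp: X_def)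
    have dX: "\<delta> (- X n) = \<delta> (- x) ^ (2 ^ n)" for n
    proof (induction n)
      case (Suc n)
      have "\<delta> (- X (Suc n)) = \<delta> (- X n) * \<delta> (- X n)" using \<delta>(3)[of "- X n" "- X n"] by (simp add: X minus_add)
      then show ?case using Suc by (simp add: power_add[symmetric] mult_2)
    qed (simp add: X)
    define L where "L n = ln (\<omega> (X n))" for n
    have L: "L (Suc n) \<le> ln (2 * max D 1) + (2 - \<theta>) * L n" for n
    proof -
      have "1 \<le> \<delta> (- X n)" using gt by (simp add: dX)
      from doubling[OF this, of "X n"]
      have "\<omega> (X (Suc n)) \<le> D * (\<omega> (X n) * \<omega> (X n) * (2 * \<omega> (X n) powr - \<theta>))" by (simp add: X mult.assoc)
      also have "\<dots> \<le> max D 1 * (\<omega> (X n) * \<omega> (X n) * (2 * \<omega> (X n) powr - \<theta>))"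
        using less_imp_le[OF w0[of "X n"]] by (intro mult_right_mono) auto
      also have "\<dots> = 2 * max D 1 * \<omega> (X n) powr (2 - \<theta>)"
        using w0[of "X n"] by (simp add: powr_diff powr_minus power2_eq_square field_simps)
      finally have "ln (\<omega> (X (Suc n))) \<le> ln (2 * max D 1 * \<omega> (X n) powr (2 - \<theta>))"
        using w0[of "X (Suc n)"] by simp
      also have "\<dots> = ln (2 * max D 1) + (2 - \<theta>) * L n"
        unfolding L_def using w0[of "X n"] by (subst ln_mult) (auto simp: ln_powr)
      finally show ?thesis by (simp add: L_def)
    qed
    have "(\<lambda>n. L n / 2 ^ n) \<longlonglongrightarrow> 0"
      by (rule subdoubling_tendsto_zero[where L = L, OF th _ _ L]) (auto simp: L_def w1 ln_ge_zero)
    then have "(\<lambda>n. ln C * (1 / 2) ^ n + (s - r) * (L n / 2 ^ n)) \<longlonglongrightarrow> ln C * 0 + (s - r) * 0"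
      by (intro tendsto_intros LIMSEQ_power_zero) simp_all
    then have "\<forall>\<^sub>F n in sequentially. ln C * (1 / 2) ^ n + (s - r) * (L n / 2 ^ n) < ln (\<delta> (- x))"
      by (rule order_tendstoD(2)) (use gt in simp)
    then obtain n where "ln C * (1 / 2) ^ n + (s - r) * (L n / 2 ^ n) < ln (\<delta> (- x))"
      using eventually_happens'[OF sequentially_bot] by blast
    then have n: "ln C + (s - r) * L n < 2 ^ n * ln (\<delta> (- x))" by (simp add: field_simps)
    have "ln (\<delta> (- X n)) \<le> ln (C * \<omega> (X n) powr (s - r))"
      using growth[of "X n"] \<delta>(1)[of "- X n"] C0 w0[of "X n"] by simp
    also have "\<dots> = ln C + (s - r) * L n"
      unfolding L_def using C0 w0[of "X n"] by (subst ln_mult) (auto simp: ln_powr)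
    also have "ln (\<delta> (- X n)) = 2 ^ n * ln (\<delta> (- x))" using \<delta>(1)[of "- x"] by (simp add: dX ln_realpow)
    finally show False using n by simp
  qed
  have d1: "\<delta> x = 1" for x
  proof -
    have "\<delta> 0 = 1" using \<delta>(3)[of 0 0] \<delta>(1)[of 0] by simp
    then have "\<delta> x * \<delta> (- x) = 1" using \<delta>(3)[of x "- x"] by simp
    moreover have "\<delta> x \<le> 1" using le1[of "- x"] by simp
    ultimately show ?thesis using le1[of x] \<delta>(1)[of x] \<delta>(1)[of "- x"]
      by (smt (verit) mult_left_le mult_le_one mult_right_le_one_le)
  qed
  show "emeasure \<nu> ((\<lambda>z. z + x) -` A) = emeasure \<nu> A" if "A \<in> sets borel" for x A
    using \<delta>(2)[OF that, of x] d1 by simp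
  show "\<exists>D>0. \<forall>x y. \<omega> (x + y) \<le> D * \<omega> x * \<omega> y * (\<omega> x powr - (r / s) + \<omega> y powr - (r / s))"
    using D0 doubling unfolding \<theta>_def by (intro exI[of _ D]) (simp add: d1)
qed

end

section \<open>Integral inequalities\<close>

text \<open>The tangent of \<open>ln\<close> at the weighted mean S gives
  \<open>ln X \<le> ln S + (X / S - 1)\<close>, and the weighted sum of the error terms is 0. If a
  base is 0 the product is 0 even for exponent 0, because \<open>0 powr 0 = 0\<close>.\<close>

lemma weighted_am_gm3:
  fixes a b c A B C :: real
  assumes "0 \<le> a" "0 \<le> b" "0 \<le> c" "a + b + c = 1" "0 \<le> A" "0 \<le> B" "0 \<le> C"
  shows "A powr a * B powr b * C powr c \<le> a * A + b * B + c * C"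
proof (cases "A = 0 \<or> B = 0 \<or> C = 0")
  case True
  then show ?thesis using assms by auto
next
  case False
  then have pos: "0 < A" "0 < B" "0 < C" using assms by auto
  define S where "S = a * A + b * B + c * C"
  have S: "0 < S"
  proof -
    have "0 \<le> a * A" "0 \<le> b * B" "0 \<le> c * C" using assms by auto
    moreover have "0 < a * A \<or> 0 < b * B \<or> 0 < c * C" using pos assms(1-4) by (auto simp: zero_less_mult_iff)
    ultimately show ?thesis unfolding S_def by linarith
  qed
  have ln: "ln X \<le> ln S + (X / S - 1)" if "0 < X" for X
    using ln_le_minus_one[of "X / S"] that S by (simp add: ln_div)
  have "a * ln A + b * ln B + c * ln C
      \<le> a * (ln S + (A / S - 1)) + b * (ln S + (B / S - 1)) + c * (ln S + (C / S - 1))"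
    using assms pos by (intro add_mono mult_left_mono ln) auto
  also have "\<dots> = (a + b + c) * ln S + ((a * A + b * B + c * C) / S - (a + b + c))"
    by (simp add: algebra_simps add_divide_distrib)
  also have "\<dots> = ln S" using S unfolding S_def[symmetric] by (simp add: assms(4))
  finally have "exp (a * ln A + b * ln B + c * ln C) \<le> S"
    using S by (metis exp_le_cancel_iff exp_ln)
  then show ?thesis using pos by (simp add: powr_def exp_add S_def)
qed

text \<open>Dividing each function by its integral reduces the inequality to an integration of
  \<open>weighted_am_gm3\<close>. If an integral is 0, the function vanishes almost everywhere and,
  by the convention \<open>0 powr 0 = 0\<close>, so does the product, whatever the exponent.\<close>

lemma holder3:
  fixes A B C :: "'a \<Rightarrow> real"
  assumes w: "0 \<le> a" "0 \<le> b" "0 \<le> c" "a + b + c = 1"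
    and int: "integrable M A" "integrable M B" "integrable M C"
    and nn: "\<And>x. 0 \<le> A x" "\<And>x. 0 \<le> B x" "\<And>x. 0 \<le> C x"
  shows "integrable M (\<lambda>x. A x powr a * B x powr b * C x powr c)"
    and "(LINT x|M. A x powr a * B x powr b * C x powr c)
      \<le> (LINT x|M. A x) powr a * (LINT x|M. B x) powr b * (LINT x|M. C x) powr c"
proof -
  let ?F = "\<lambda>x. A x powr a * B x powr b * C x powr c"
  have [measurable]: "A \<in> borel_measurable M" "B \<in> borel_measurable M" "C \<in> borel_measurable M"
    using int by auto
  show integ: "integrable M ?F"
  proof (rule Bochner_Integration.integrable_bound)
    show "integrable M (\<lambda>x. a * A x + b * B x + c * C x)" using int by auto
    show "AE x in M. norm (?F x) \<le> norm (a * A x + b * B x + c * C x)"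
      using weighted_am_gm3[OF w nn] nn w by (auto intro!: AE_I2 order_trans[OF _ abs_ge_self])
  qed measurable
  show "(LINT x|M. ?F x) \<le> (LINT x|M. A x) powr a * (LINT x|M. B x) powr b * (LINT x|M. C x) powr c"
  proof (cases "(LINT x|M. A x) = 0 \<or> (LINT x|M. B x) = 0 \<or> (LINT x|M. C x) = 0")
    case True
    have z: "AE x in M. f x = 0" if "integrable M f" "\<And>x. 0 \<le> f x" "(LINT x|M. f x) = 0" for f :: "'a \<Rightarrow> real"
      using that integral_nonneg_eq_0_iff_AE[of M f] by auto
    have "AE x in M. ?F x = 0"
      using True
    proof (elim disjE)
      assume "(LINT x|M. A x) = 0"
      from z[OF int(1) nn(1) this] show ?thesis by eventually_elim simp
    next
      assume "(LINT x|M. B x) = 0"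
      from z[OF int(2) nn(2) this] show ?thesis by eventually_elim simp
    next
      assume "(LINT x|M. C x) = 0"
      from z[OF int(3) nn(3) this] show ?thesis by eventually_elim simp
    qed
    then have "(LINT x|M. ?F x) = 0" by (subst integral_cong_AE[of _ _ "\<lambda>_. 0"]) auto
    then show ?thesis by simp
  next
    case False
    define IA IB IC where I: "IA = (LINT x|M. A x)" "IB = (LINT x|M. B x)" "IC = (LINT x|M. C x)"
    have pos: "0 < IA" "0 < IB" "0 < IC"
      using False Bochner_Integration.integral_nonneg[of M A] Bochner_Integration.integral_nonneg[of M B]
        Bochner_Integration.integral_nonneg[of M C] nn unfolding I by (auto simp: less_le)
    let ?K = "IA powr a * IB powr b * IC powr c"
    have "?F x \<le> ?K * (a * (A x / IA) + b * (B x / IB) + c * (C x / IC))" for x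
    proof -
      have "?F x = ?K * ((A x / IA) powr a * (B x / IB) powr b * (C x / IC) powr c)"
        using pos nn[of x] by (simp add: powr_divide)
      also have "\<dots> \<le> ?K * (a * (A x / IA) + b * (B x / IB) + c * (C x / IC))"
        using pos nn[of x] w by (intro mult_left_mono weighted_am_gm3) auto
      finally show ?thesis .
    qed
    then have "(LINT x|M. ?F x) \<le> (LINT x|M. ?K * (a * (A x / IA) + b * (B x / IB) + c * (C x / IC)))"
      using int by (intro integral_mono integ) auto
    also have "\<dots> = ?K * (a + b + c)"
      using int pos by (simp add: I[symmetric])
    finally show ?thesis by (simp add: w I)
  qed
qed

text \<open>B doubles as the third function, with exponent 0:
  \<open>x powr b * x powr 0 = x powr b\<close> holds even at x = 0, and the constant 1, which need
  not be integrable, is avoided.\<close>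

lemma holder2:
  fixes A B :: "'a \<Rightarrow> real"
  assumes w: "0 \<le> a" "0 < b" "a + b = 1"
    and int: "integrable M A" "integrable M B"
    and nn: "\<And>x. 0 \<le> A x" "\<And>x. 0 \<le> B x"
  shows "integrable M (\<lambda>x. A x powr a * B x powr b)"
    and "(LINT x|M. A x powr a * B x powr b) \<le> (LINT x|M. A x) powr a * (LINT x|M. B x) powr b"
proof -
  have *: "x powr b * x powr 0 = x powr b" for x :: real by simp
  show "integrable M (\<lambda>x. A x powr a * B x powr b)"
    "(LINT x|M. A x powr a * B x powr b) \<le> (LINT x|M. A x) powr a * (LINT x|M. B x) powr b"
    using holder3[of a b 0 M A B B] assms by (simp_all only: * mult.assoc)
qed

lemma powr_convex_combination:
  fixes X Y :: real
  assumes "1 \<le> p" "0 \<le> X" "0 \<le> Y" "0 \<le> a" "0 \<le> b" "a + b = 1"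
  shows "(a * X + b * Y) powr p \<le> a * X powr p + b * Y powr p"
proof -
  have le: "(t * Z) powr p \<le> t * Z powr p" if "0 \<le> t" "t \<le> 1" "0 \<le> Z" for t Z :: real
  proof (cases "t = 0")
    case False
    then have "t powr p \<le> t powr 1" using that assms(1) by (intro powr_mono') auto
    then show ?thesis using that mult_right_mono[of "t powr p" t "Z powr p"] by (simp add: powr_mult)
  qed simp
  show ?thesis
  proof (cases "X = 0 \<or> Y = 0")
    case True
    then show ?thesis using le[of a X] le[of b Y] assms by auto
  next
    case False
    moreover have a: "1 - b = a" using assms by simp
    ultimately show ?thesis
      using convex_onD[OF powr_convex[OF assms(1)], of b X Y, unfolded a] assms by simp
  qed
qed

section \<open>Lebesgue norms of nonnegative functions\<close>

definition lpn :: "'a measure \<Rightarrow> real \<Rightarrow> ('a \<Rightarrow> real) \<Rightarrow> real" where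
  "lpn M p f = (LINT x|M. f x powr p) powr (1 / p)"

definition lpint :: "'a measure \<Rightarrow> real \<Rightarrow> ('a \<Rightarrow> real) \<Rightarrow> bool" where
  "lpint M p f \<longleftrightarrow> f \<in> borel_measurable M \<and> (\<forall>x. 0 \<le> f x) \<and> integrable M (\<lambda>x. f x powr p)"

lemma lpn_nonneg [simp]: "0 \<le> lpn M p f"
  by (simp add: lpn_def)

lemma lpintD:
  assumes "lpint M p f"
  shows "f \<in> borel_measurable M" "0 \<le> f x" "integrable M (\<lambda>x. f x powr p)"
  using assms by (auto simp: lpint_def)

lemma lpn_powr: "p \<noteq> 0 \<Longrightarrow> lpn M p f powr p = (LINT x|M. f x powr p)"
  by (simp add: lpn_def powr_powr)

lemma lpint_1: "lpint M 1 f \<longleftrightarrow> (\<forall>x. 0 \<le> f x) \<and> integrable M f"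
proof -
  have "(\<forall>x. 0 \<le> f x) \<Longrightarrow> (\<lambda>x. f x powr 1) = f" by auto
  then show ?thesis by (auto simp: lpint_def)
qed

lemma lpn_1: "(\<And>x. 0 \<le> f x) \<Longrightarrow> lpn M 1 f = (LINT x|M. f x)"
  by (simp add: lpn_def Bochner_Integration.integral_nonneg)

lemma lpint_mono:
  assumes "lpint M p g" "0 \<le> p" "f \<in> borel_measurable M" "\<And>x. 0 \<le> f x" "AE x in M. f x \<le> g x"
  shows "lpint M p f" "lpn M p f \<le> lpn M p g"
proof -
  have [measurable]: "f \<in> borel_measurable M" using assms by simp
  have le: "AE x in M. f x powr p \<le> g x powr p"
    using assms(5) by eventually_elim (use assms in \<open>auto intro!: powr_mono2\<close>)
  have int: "integrable M (\<lambda>x. f x powr p)"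
    by (rule Bochner_Integration.integrable_bound[OF lpintD(3)[OF assms(1)]])
      (use le in \<open>auto elim!: eventually_mono\<close>)
  show "lpint M p f" using int assms by (auto simp: lpint_def)
  have "(LINT x|M. f x powr p) \<le> (LINT x|M. g x powr p)"
    by (rule integral_mono_AE[OF int lpintD(3)[OF assms(1)] le])
  then show "lpn M p f \<le> lpn M p g" unfolding lpn_def using assms(2)
    by (intro powr_mono2) (auto intro: Bochner_Integration.integral_nonneg)
qed

lemma lpn_cong_AE:
  assumes "f \<in> borel_measurable M" "g \<in> borel_measurable M" "AE x in M. f x = g x"
  shows "lpn M p f = lpn M p g"
proof -
  have [measurable]: "f \<in> borel_measurable M" "g \<in> borel_measurable M" using assms by auto
  have "(LINT x|M. f x powr p) = (LINT x|M. g x powr p)"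
    by (rule integral_cong_AE) (use assms(3) in auto)
  then show ?thesis by (simp add: lpn_def)
qed

lemma lpint_cmult:
  assumes "lpint M p f" "0 \<le> c" "p \<noteq> 0"
  shows "lpint M p (\<lambda>x. c * f x)" "lpn M p (\<lambda>x. c * f x) = c * lpn M p f"
proof -
  have eq: "(c * f x) powr p = c powr p * f x powr p" for x using lpintD(2)[OF assms(1)] assms(2) by (simp add: powr_mult)
  show "lpint M p (\<lambda>x. c * f x)" using assms lpintD[OF assms(1)] by (auto simp: lpint_def eq)
  show "lpn M p (\<lambda>x. c * f x) = c * lpn M p f"
    using assms by (simp add: lpn_def eq powr_mult powr_powr Bochner_Integration.integral_nonneg)
qed

lemma lpn_eq_0:
  assumes "lpint M p f" "lpn M p f = 0"
  shows "AE x in M. f x = 0"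
proof -
  have "(LINT x|M. f x powr p) = 0" using assms(2) by (simp add: lpn_def)
  then have "AE x in M. f x powr p = 0"
    using integral_nonneg_eq_0_iff_AE[OF lpintD(3)[OF assms(1)]] by auto
  then show ?thesis by eventually_elim simp
qed

text \<open>Minkowski's inequality from convexity: with F and G the two norms, f + g is F + G times
  the convex combination of f / F and g / G with weights F / (F + G) and G / (F + G), and the p-th
  powers of f / F and g / G have integral 1. The choice F = G = 1 gives integrability before the
  norms are compared.\<close>

lemma lpint_add:
  assumes f: "lpint M p f" and g: "lpint M p g" and p: "1 \<le> p"
  shows "lpint M p (\<lambda>x. f x + g x)" "lpn M p (\<lambda>x. f x + g x) \<le> lpn M p f + lpn M p g"
proof -
  have [measurable]: "f \<in> borel_measurable M" "g \<in> borel_measurable M" using f g by (auto simp: lpint_def)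
  note fn = lpintD(2)[OF f] and gn = lpintD(2)[OF g]
  note fi = lpintD(3)[OF f] and gi = lpintD(3)[OF g]
  have pw: "(f x + g x) powr p \<le> (F + G) powr p * (F / (F + G) * (f x / F) powr p + G / (F + G) * (g x / G) powr p)"
    if "0 < F" "0 < G" for F G x
  proof -
    have "f x + g x = (F + G) * (F / (F + G) * (f x / F) + G / (F + G) * (g x / G))"
    proof -
      have "F / (F + G) * (f x / F) = f x / (F + G)" "G / (F + G) * (g x / G) = g x / (F + G)" using that by auto
      then show ?thesis using that by (simp add: add_divide_distrib[symmetric])
    qed
    then have "(f x + g x) powr p = (F + G) powr p * (F / (F + G) * (f x / F) + G / (F + G) * (g x / G)) powr p"
      using that fn[of x] gn[of x] by (simp add: powr_mult)
    also have "\<dots> \<le> (F + G) powr p * (F / (F + G) * (f x / F) powr p + G / (F + G) * (g x / G) powr p)"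
      using that fn[of x] gn[of x] p
      by (intro mult_left_mono powr_convex_combination) (auto simp: add_divide_distrib[symmetric])
    finally show ?thesis .
  qed
  have pw': "(f x + g x) powr p \<le> (F + G) powr p * (F / (F + G) * (f x powr p / F powr p) + G / (F + G) * (g x powr p / G powr p))"
    if "0 < F" "0 < G" for F G x
    using pw[OF that] fn[of x] gn[of x] that by (simp add: powr_divide)
  have int: "integrable M (\<lambda>x. (f x + g x) powr p)"
  proof (rule Bochner_Integration.integrable_bound)
    show "integrable M (\<lambda>x. (1 + 1) powr p * (1 / (1 + 1) * (f x powr p / 1 powr p) + 1 / (1 + 1) * (g x powr p / 1 powr p)))"
      using fi gi by auto
    show "AE x in M. norm ((f x + g x) powr p)
       \<le> norm ((1 + 1) powr p * (1 / (1 + 1) * (f x powr p / 1 powr p) + 1 / (1 + 1) * (g x powr p / 1 powr p)))"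
      using pw'[of 1 1] by (auto intro!: AE_I2 order_trans[OF _ abs_ge_self])
  qed measurable
  then show "lpint M p (\<lambda>x. f x + g x)" using fn gn by (auto simp: lpint_def add_nonneg_nonneg)
  define F G where FG: "F = lpn M p f" "G = lpn M p g"
  have F0: "0 \<le> F" "0 \<le> G" by (auto simp: FG)
  show "lpn M p (\<lambda>x. f x + g x) \<le> lpn M p f + lpn M p g"
  proof (cases "F = 0 \<or> G = 0")
    case True
    then show ?thesis
    proof
      assume "F = 0"
      then have "AE x in M. f x = 0" using lpn_eq_0[OF f] FG by simp
      then have "AE x in M. f x + g x = g x" by eventually_elim simp
      then have "lpn M p (\<lambda>x. f x + g x) = lpn M p g" by (intro lpn_cong_AE) auto
      then show ?thesis by simp
    next
      assume "G = 0"
      then have "AE x in M. g x = 0" using lpn_eq_0[OF g] FG by simp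
      then have "AE x in M. f x + g x = f x" by eventually_elim simp
      then have "lpn M p (\<lambda>x. f x + g x) = lpn M p f" by (intro lpn_cong_AE) auto
      then show ?thesis by simp
    qed
  next
    case False
    then have pos: "0 < F" "0 < G" using F0 by auto
    have IF: "(LINT x|M. f x powr p) = F powr p" "(LINT x|M. g x powr p) = G powr p"
      using p by (simp_all add: FG lpn_powr)
    have "(LINT x|M. (f x + g x) powr p)
      \<le> (LINT x|M. (F + G) powr p * (F / (F + G) * (f x powr p / F powr p) + G / (F + G) * (g x powr p / G powr p)))"
      using fi gi by (intro integral_mono int pw' pos) auto
    also have "\<dots> = (F + G) powr p * (F / (F + G) + G / (F + G))"
      using fi gi pos by (simp add: IF)
    also have "F / (F + G) + G / (F + G) = 1" using pos by (simp add: add_divide_distrib[symmetric])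
    finally have "lpn M p (\<lambda>x. f x + g x) \<le> ((F + G) powr p) powr (1 / p)"
      unfolding lpn_def using p by (intro powr_mono2) (auto intro: Bochner_Integration.integral_nonneg)
    then show ?thesis using p pos by (simp add: powr_powr FG)
  qed
qed

lemma cauchy_schwarz:
  assumes f: "lpint M 2 f" and g: "lpint M 2 g"
  shows "integrable M (\<lambda>x. f x * g x)" "(LINT x|M. f x * g x) \<le> lpn M 2 f * lpn M 2 g"
proof -
  have *: "(z powr 2) powr (1 / 2) = z" if "0 \<le> z" for z :: real using that by (subst powr_powr) simp
  have eq: "f x * g x = (f x powr 2) powr (1 / 2) * (g x powr 2) powr (1 / 2)" for x
    using lpintD(2)[OF f, of x] lpintD(2)[OF g, of x] by (simp only: *)
  show "integrable M (\<lambda>x. f x * g x)" "(LINT x|M. f x * g x) \<le> lpn M 2 f * lpn M 2 g"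
    unfolding eq lpn_def using holder2[OF _ _ _ lpintD(3)[OF f] lpintD(3)[OF g], of "1 / 2" "1 / 2"] by simp_all
qed

lemma borel_measurable_cnj [measurable (raw)]:
  "f \<in> borel_measurable M \<Longrightarrow> (\<lambda>x. cnj (f x)) \<in> borel_measurable M"
  by (rule measurable_compose[OF _ borel_measurable_continuous_onI]) (auto intro: continuous_intros)

section \<open>Convolution on a unimodular group\<close>

locale unimodular_group = measurable_group +
  assumes distr_uminus: "distr M M uminus = M"
begin

lemma distr_conv: "distr M M (\<lambda>y. - y + x) = M"
proof -
  have "distr (distr M M (\<lambda>z. - x + z)) M uminus = distr M M (uminus \<circ> (\<lambda>z. - x + z))"
    by (rule distr_distr) measurable
  then show ?thesis by (simp add: distr_left distr_uminus comp_def minus_add)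
qed

lemma AE_conv:
  assumes "AE y in M. P y"
  shows "AE y in M. P (- y + x)"
proof -
  have "AE y in distr M M (\<lambda>y. - y + x). P y" by (subst distr_conv) (rule assms)
  then show ?thesis by (rule AE_distrD[rotated]) simp
qed

context
  fixes f :: "'a \<Rightarrow> 'b::{banach, second_countable_topology}"
  assumes f [measurable]: "f \<in> borel_measurable M"
begin

lemma integrable_conv_iff: "integrable M (\<lambda>y. f (- y + x)) \<longleftrightarrow> integrable M f"
  by (subst (2) distr_conv[of x, symmetric]) (simp add: integrable_distr_eq)

lemma integral_conv: "(LINT y|M. f (- y + x)) = (LINT y|M. f y)"
  by (subst (2) distr_conv[of x, symmetric]) (simp add: integral_distr)

lemma integrable_left_iff: "integrable M (\<lambda>y. f (x + y)) \<longleftrightarrow> integrable M f"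
  by (subst (2) distr_left[of x, symmetric]) (simp add: integrable_distr_eq)

lemma integral_left: "(LINT y|M. f (x + y)) = (LINT y|M. f y)"
  by (subst (2) distr_left[of x, symmetric]) (simp add: integral_distr)

lemma integral_uminus_eq: "(LINT y|M. f (- y)) = (LINT y|M. f y)"
  using integral_conv[of 0] by simp

end

lemma lpint_conv: "lpint M p f \<Longrightarrow> lpint M p (\<lambda>y. f (- y + x))"
  using integrable_conv_iff[of "\<lambda>y. f y powr p" x] by (auto simp: lpint_def)

lemma lpn_conv: "lpint M p f \<Longrightarrow> lpn M p (\<lambda>y. f (- y + x)) = lpn M p f"
  using integral_conv[of "\<lambda>y. f y powr p" x] by (auto simp: lpint_def lpn_def)

lemma lpint_uminus: "lpint M p f \<Longrightarrow> lpint M p (\<lambda>y. f (- y))"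
  using lpint_conv[of p f 0] by simp

lemma lpn_uminus: "lpint M p f \<Longrightarrow> lpn M p (\<lambda>y. f (- y)) = lpn M p f"
  using lpn_conv[of p f 0] by simp

definition rconv :: "('a \<Rightarrow> real) \<Rightarrow> ('a \<Rightarrow> real) \<Rightarrow> 'a \<Rightarrow> real" where
  "rconv a b x = (LINT y|M. a y * b (- y + x))"

lemma rconv_measurable [measurable]:
  assumes [measurable]: "a \<in> borel_measurable M" "b \<in> borel_measurable M"
  shows "rconv a b \<in> borel_measurable M"
  unfolding rconv_def[abs_def] by measurable

lemma rconv_nonneg: "(\<And>x. 0 \<le> a x) \<Longrightarrow> (\<And>x. 0 \<le> b x) \<Longrightarrow> 0 \<le> rconv a b x"
  unfolding rconv_def by (intro Bochner_Integration.integral_nonneg) auto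

text \<open>Hoelder's inequality in y for the factors \<open>a y powr (1 - 1 / p)\<close> and
  \<open>(a y * b (- y + x) powr p) powr (1 / p)\<close>. The double integral of
  \<open>a y * b (- y + x) powr p\<close> is evaluated by Tonelli and left invariance.\<close>

lemma young_left:
  assumes a: "lpint M 1 a" and b: "lpint M p b" and p: "1 \<le> p"
  shows "AE x in M. integrable M (\<lambda>y. a y * b (- y + x))"
    and "lpint M p (rconv a b)" "lpn M p (rconv a b) \<le> lpn M 1 a * lpn M p b"
proof -
  have [measurable]: "a \<in> borel_measurable M" "b \<in> borel_measurable M" using a b by (auto simp: lpint_def)
  have a0: "0 \<le> a x" and b0: "0 \<le> b x" for x using a b by (auto simp: lpint_def)
  have ai: "integrable M a" using a by (simp add: lpint_1)
  define Na where "Na = (LINT y|M. a y)"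
  define B where "B = (LINT y|M. b y powr p)"
  have Na: "0 \<le> Na" "lpn M 1 a = Na" unfolding Na_def using a0 by (auto intro: Bochner_Integration.integral_nonneg simp: lpn_1)
  have B: "0 \<le> B" unfolding B_def by (auto intro: Bochner_Integration.integral_nonneg)
  let ?K = "\<lambda>x y. a y * b (- y + x) powr p"
  have "(\<integral>\<^sup>+x. \<integral>\<^sup>+y. ennreal (?K x y) \<partial>M \<partial>M) = (\<integral>\<^sup>+y. \<integral>\<^sup>+x. ennreal (?K x y) \<partial>M \<partial>M)"
    by (rule pair.Fubini') measurable
  also have "\<dots> = (\<integral>\<^sup>+y. ennreal (a y) * ennreal B \<partial>M)"
  proof (rule nn_integral_cong)
    fix y
    have "(\<integral>\<^sup>+x. ennreal (?K x y) \<partial>M) = (\<integral>\<^sup>+x. ennreal (a y) * ennreal (b (- y + x) powr p) \<partial>M)"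
      using a0 by (simp add: ennreal_mult)
    also have "\<dots> = ennreal (a y) * (\<integral>\<^sup>+x. ennreal (b (- y + x) powr p) \<partial>M)"
      by (rule nn_integral_cmult) measurable
    also have "(\<integral>\<^sup>+x. ennreal (b (- y + x) powr p) \<partial>M) = (\<integral>\<^sup>+x. ennreal (b x powr p) \<partial>M)"
      by (rule nn_integral_left[of "\<lambda>x. ennreal (b x powr p)"]) measurable
    also have "\<dots> = ennreal B"
      unfolding B_def using lpintD(3)[OF b] by (intro nn_integral_eq_integral) auto
    finally show "(\<integral>\<^sup>+x. ennreal (?K x y) \<partial>M) = ennreal (a y) * ennreal B" .
  qed
  also have "\<dots> = (\<integral>\<^sup>+y. ennreal (a y) \<partial>M) * ennreal B" by (rule nn_integral_multc) measurable
  also have "(\<integral>\<^sup>+y. ennreal (a y) \<partial>M) = ennreal Na"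
    unfolding Na_def using ai a0 by (intro nn_integral_eq_integral) auto
  also have "ennreal Na * ennreal B = ennreal (Na * B)" using Na B by (simp add: ennreal_mult)
  finally have total: "(\<integral>\<^sup>+x. \<integral>\<^sup>+y. ennreal (?K x y) \<partial>M \<partial>M) = ennreal (Na * B)" .
  have "AE x in M. (\<integral>\<^sup>+y. ennreal (?K x y) \<partial>M) \<noteq> \<infinity>"
    by (rule nn_integral_noteq_infinite) (use total in auto)
  then have K_int: "AE x in M. integrable M (?K x)"
    by eventually_elim (use a0 in \<open>auto intro!: integrableI_nonneg simp: less_top\<close>)
  define g where "g x = (LINT y|M. ?K x y)" for x
  have [measurable]: "g \<in> borel_measurable M" unfolding g_def[abs_def] by measurable
  have g0: "0 \<le> g x" for x unfolding g_def using a0 by (auto intro: Bochner_Integration.integral_nonneg)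
  have g_eq: "AE x in M. (\<integral>\<^sup>+y. ennreal (?K x y) \<partial>M) = ennreal (g x)"
    using K_int by eventually_elim (unfold g_def, rule nn_integral_eq_integral, use a0 in auto)
  have g_total: "(\<integral>\<^sup>+x. ennreal (g x) \<partial>M) = ennreal (Na * B)"
    unfolding total[symmetric] by (rule nn_integral_cong_AE) (use g_eq in \<open>auto elim: eventually_mono\<close>)
  have g_int: "integrable M g" using g_total g0 by (intro integrableI_nonneg) auto
  have g_val: "(LINT x|M. g x) = Na * B"
    using g_total nn_integral_eq_integral[OF g_int] g0 Na B
    by (simp add: Bochner_Integration.integral_nonneg)
  have root: "a y powr (1 - 1 / p) * ?K x y powr (1 / p) = a y * b (- y + x)" for x y
  proof (cases "a y = 0")
    case False
    then have "a y powr (1 - 1 / p) * a y powr (1 / p) = a y"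
      using a0[of y] by (simp add: powr_add[symmetric])
    moreover have "?K x y powr (1 / p) = a y powr (1 / p) * b (- y + x)"
      using a0[of y] b0[of "- y + x"] p by (simp add: powr_mult powr_powr)
    ultimately show ?thesis by (metis mult.assoc)
  qed simp
  have pt: "AE x in M. integrable M (\<lambda>y. a y * b (- y + x)) \<and> rconv a b x \<le> Na powr (1 - 1 / p) * g x powr (1 / p)"
    using K_int
  proof eventually_elim
    fix x assume Kx: "integrable M (?K x)"
    have w: "0 \<le> 1 - 1 / p" "0 < 1 / p" "1 - 1 / p + 1 / p = 1" using p by auto
    from holder2[OF w ai Kx a0] a0
    show "integrable M (\<lambda>y. a y * b (- y + x)) \<and> rconv a b x \<le> Na powr (1 - 1 / p) * g x powr (1 / p)"
      unfolding root by (simp add: rconv_def Na_def g_def)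
  qed
  then show "AE x in M. integrable M (\<lambda>y. a y * b (- y + x))" by eventually_elim simp
  have rc0: "0 \<le> rconv a b x" for x using a0 b0 by (rule rconv_nonneg)
  have le: "AE x in M. rconv a b x powr p \<le> Na powr (p - 1) * g x"
    using pt
  proof eventually_elim
    fix x assume *: "integrable M (\<lambda>y. a y * b (- y + x)) \<and> rconv a b x \<le> Na powr (1 - 1 / p) * g x powr (1 / p)"
    have "rconv a b x powr p \<le> (Na powr (1 - 1 / p) * g x powr (1 / p)) powr p"
      using * rc0 p by (intro powr_mono2) auto
    also have "\<dots> = Na powr (p - 1) * g x"
      using p g0[of x] by (simp add: powr_mult powr_powr algebra_simps)
    finally show "rconv a b x powr p \<le> Na powr (p - 1) * g x" .
  qed
  have int: "integrable M (\<lambda>x. rconv a b x powr p)"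
    by (rule Bochner_Integration.integrable_bound[of _ "\<lambda>x. Na powr (p - 1) * g x"])
      (use le g_int in \<open>auto elim!: eventually_mono intro: order_trans[OF _ abs_ge_self]\<close>)
  then show "lpint M p (rconv a b)" using rc0 by (auto simp: lpint_def)
  have "(LINT x|M. rconv a b x powr p) \<le> (LINT x|M. Na powr (p - 1) * g x)"
    using int g_int by (intro integral_mono_AE le) auto
  also have "\<dots> = Na powr (p - 1) * Na * B" using g_int by (simp add: g_val)
  also have "Na powr (p - 1) * Na = Na powr p"
    using Na by (cases "Na = 0") (auto simp: powr_diff)
  finally have "lpn M p (rconv a b) \<le> (Na powr p * B) powr (1 / p)"
    unfolding lpn_def using p by (intro powr_mono2) (auto intro: Bochner_Integration.integral_nonneg)
  also have "\<dots> = Na * lpn M p b" using p Na B by (simp add: powr_mult powr_powr lpn_def B_def)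
  finally show "lpn M p (rconv a b) \<le> lpn M 1 a * lpn M p b" by (simp add: Na)
qed

lemma conv_flip:
  assumes [measurable]: "f \<in> borel_measurable M" "g \<in> borel_measurable M"
  shows "integrable M (\<lambda>y. f y * g (- y + x)) \<longleftrightarrow> integrable M (\<lambda>y. g (- y) * f (x + y) :: 'b::{banach, second_countable_topology, real_normed_algebra, comm_monoid_mult})"
    and "(LINT y|M. f y * g (- y + x)) = (LINT y|M. g (- y) * f (x + y))"
  using integrable_left_iff[of "\<lambda>y. f y * g (- y + x)" x] integral_left[of "\<lambda>y. f y * g (- y + x)" x]
  by (simp_all add: minus_add add.assoc mult.commute)

text \<open>Inversion reverses the order of convolution and, the group being unimodular, preserves
  both norms, so this is \<open>young_left\<close> for the inverted functions.\<close>

lemma young_right: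
  assumes a: "lpint M p a" and b: "lpint M 1 b" and p: "1 \<le> p"
  shows "AE x in M. integrable M (\<lambda>y. a y * b (- y + x))"
    and "lpint M p (rconv a b)" "lpn M p (rconv a b) \<le> lpn M p a * lpn M 1 b"
proof -
  have [measurable]: "a \<in> borel_measurable M" "b \<in> borel_measurable M" using a b by (auto simp: lpint_def)
  let ?a = "\<lambda>y. a (- y)" and ?b = "\<lambda>y. b (- y)"
  note Y = young_left[OF lpint_uminus[OF b] lpint_uminus[OF a] p]
  have eq: "integrable M (\<lambda>y. a y * b (- y + - x)) \<longleftrightarrow> integrable M (\<lambda>y. ?b y * ?a (- y + x))"
    "rconv a b (- x) = rconv ?b ?a x" for x
    unfolding rconv_def using conv_flip[of a b "- x"] by (simp_all add: minus_add)
  have "AE x in M. integrable M (\<lambda>y. a y * b (- y + - x))"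
    using Y(1) unfolding eq by simp
  from AE_uminus[OF this] show "AE x in M. integrable M (\<lambda>y. a y * b (- y + x))" by simp
  have r: "rconv a b = (\<lambda>x. rconv ?b ?a (- x))" using eq(2)[of "- _"] by (auto simp: fun_eq_iff)
  show "lpint M p (rconv a b)" by (subst r) (rule lpint_uminus[OF Y(2)])
  have "lpn M p (rconv a b) = lpn M p (rconv ?b ?a)" by (subst r) (rule lpn_uminus[OF Y(2)])
  then show "lpn M p (rconv a b) \<le> lpn M p a * lpn M 1 b"
    using Y(3) by (simp add: lpn_uminus[OF a] lpn_uminus[OF b] mult.commute)
qed

lemma rconv_L2:
  assumes a: "lpint M 2 a" and b: "lpint M 2 b"
  shows "integrable M (\<lambda>y. a y * b (- y + x))" "rconv a b x \<le> lpn M 2 a * lpn M 2 b"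
  using cauchy_schwarz[OF a lpint_conv[OF b]] by (simp_all add: rconv_def lpn_conv[OF b])

section \<open>Complex convolution on L^1 and L^2\<close>

definition L2 :: "('a \<Rightarrow> complex) set" where
  "L2 = {f \<in> borel_measurable M. lpint M 2 (\<lambda>x. cmod (f x))}"

definition L1 :: "('a \<Rightarrow> complex) set" where
  "L1 = {f \<in> borel_measurable M. lpint M 1 (\<lambda>x. cmod (f x))}"

abbreviation n1 :: "('a \<Rightarrow> complex) \<Rightarrow> real" where
  "n1 f \<equiv> lpn M 1 (\<lambda>x. cmod (f x))"

abbreviation n2 :: "('a \<Rightarrow> complex) \<Rightarrow> real" where
  "n2 f \<equiv> lpn M 2 (\<lambda>x. cmod (f x))"

abbreviation conv (infixl "\<star>" 70) where
  "f \<star> g \<equiv> convolution M f g"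

lemma L2_measurable [measurable_dest]: "f \<in> L2 \<Longrightarrow> f \<in> borel_measurable M"
  and L2_lpint: "f \<in> L2 \<Longrightarrow> lpint M 2 (\<lambda>x. cmod (f x))"
  by (auto simp: L2_def)

lemma L1_measurable [measurable_dest]: "f \<in> L1 \<Longrightarrow> f \<in> borel_measurable M"
  and L1_lpint: "f \<in> L1 \<Longrightarrow> lpint M 1 (\<lambda>x. cmod (f x))"
  by (auto simp: L1_def)

lemma conv_measurable [measurable]:
  assumes [measurable]: "f \<in> borel_measurable M" "g \<in> borel_measurable M"
  shows "f \<star> g \<in> borel_measurable M"
  unfolding convolution_def by measurable

lemma cmod_conv_le: "cmod ((f \<star> g) x) \<le> rconv (\<lambda>x. cmod (f x)) (\<lambda>x. cmod (g x)) x"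
  unfolding convolution_def rconv_def
  using integral_norm_bound[of M "\<lambda>y. f y * g (- y + x)"] by (simp add: norm_mult)

text \<open>By Cauchy-Schwarz the integral exists at every point x. This lets the algebraic laws of
  convolution hold as identities of functions, before any passage to classes.\<close>

lemma conv_integrable:
  assumes "f \<in> L2" "g \<in> L2"
  shows "integrable M (\<lambda>y. f y * g (- y + x))"
proof (rule Bochner_Integration.integrable_bound)
  show "integrable M (\<lambda>y. cmod (f y) * cmod (g (- y + x)))"
    using rconv_L2(1)[OF L2_lpint[OF assms(1)] L2_lpint[OF assms(2)]] .
  show "(\<lambda>y. f y * g (- y + x)) \<in> borel_measurable M"
    using assms[THEN L2_measurable] by measurable
qed (simp add: norm_mult)

lemma conv_bound:
  assumes "f \<in> L2" "g \<in> L2"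
  shows "cmod ((f \<star> g) x) \<le> n2 f * n2 g"
  using order_trans[OF cmod_conv_le rconv_L2(2)[OF L2_lpint[OF assms(1)] L2_lpint[OF assms(2)]]] .

lemma conv_L2:
  assumes f: "f \<in> L1" and g: "g \<in> L2"
  shows "f \<star> g \<in> L2" "n2 (f \<star> g) \<le> n1 f * n2 g"
proof -
  note [measurable] = L1_measurable[OF f] L2_measurable[OF g]
  note Y = young_left[OF L1_lpint[OF f] L2_lpint[OF g]]
  have m: "(\<lambda>x. cmod ((f \<star> g) x)) \<in> borel_measurable M" by measurable
  have le: "AE x in M. cmod ((f \<star> g) x) \<le> rconv (\<lambda>x. cmod (f x)) (\<lambda>x. cmod (g x)) x"
    using cmod_conv_le by auto
  note l = lpint_mono[OF Y(2) _ m _ le]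
  show "f \<star> g \<in> L2" unfolding L2_def using l(1) by simp
  show "n2 (f \<star> g) \<le> n1 f * n2 g" using l(2) Y(3) by simp
qed

lemma conv_L2':
  assumes f: "f \<in> L2" and g: "g \<in> L1"
  shows "f \<star> g \<in> L2" "n2 (f \<star> g) \<le> n2 f * n1 g"
proof -
  note [measurable] = L2_measurable[OF f] L1_measurable[OF g]
  note Y = young_right[OF L2_lpint[OF f] L1_lpint[OF g]]
  have m: "(\<lambda>x. cmod ((f \<star> g) x)) \<in> borel_measurable M" by measurable
  have le: "AE x in M. cmod ((f \<star> g) x) \<le> rconv (\<lambda>x. cmod (f x)) (\<lambda>x. cmod (g x)) x"
    using cmod_conv_le by auto
  note l = lpint_mono[OF Y(2) _ m _ le]
  show "f \<star> g \<in> L2" unfolding L2_def using l(1) by simp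
  show "n2 (f \<star> g) \<le> n2 f * n1 g" using l(2) Y(3) by simp
qed

lemma conv_cong_AE:
  assumes [measurable]: "f \<in> borel_measurable M" "g \<in> borel_measurable M"
      "f' \<in> borel_measurable M" "g' \<in> borel_measurable M"
    and "AE x in M. f x = f' x" "AE x in M. g x = g' x"
  shows "f \<star> g = f' \<star> g'"
proof
  fix x
  have "AE y in M. f y * g (- y + x) = f' y * g' (- y + x)"
    using assms(5) AE_conv[OF assms(6), of x] by eventually_elim simp
  then show "(f \<star> g) x = (f' \<star> g') x"
    unfolding convolution_def by (intro integral_cong_AE) auto
qed

lemma conv_add_left:
  assumes "f \<in> L2" "f' \<in> L2" "g \<in> L2"
  shows "((\<lambda>x. f x + f' x) \<star> g) x = (f \<star> g) x + (f' \<star> g) x"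
  using conv_integrable[OF assms(1,3), of x] conv_integrable[OF assms(2,3), of x]
  by (simp add: convolution_def distrib_right)

lemma conv_add_right:
  assumes "f \<in> L2" "g \<in> L2" "g' \<in> L2"
  shows "(f \<star> (\<lambda>x. g x + g' x)) x = (f \<star> g) x + (f \<star> g') x"
  using conv_integrable[OF assms(1,2), of x] conv_integrable[OF assms(1,3), of x]
  by (simp add: convolution_def distrib_left)

lemma conv_scale_left: "((\<lambda>x. c * f x) \<star> g) x = c * (f \<star> g) x"
  by (simp add: convolution_def mult.assoc)

lemma conv_scale_right: "(f \<star> (\<lambda>x. c * g x)) x = c * (f \<star> g) x"
  by (simp add: convolution_def mult.left_commute)

lemma L2_add:
  assumes "f \<in> L2" "g \<in> L2"
  shows "(\<lambda>x. f x + g x) \<in> L2" "n2 (\<lambda>x. f x + g x) \<le> n2 f + n2 g"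
proof -
  note [measurable] = assms[THEN L2_measurable]
  note a = lpint_add[OF L2_lpint[OF assms(1)] L2_lpint[OF assms(2)]]
  have m: "(\<lambda>x. cmod (f x + g x)) \<in> borel_measurable M" by measurable
  note l = lpint_mono[OF a(1) _ m]
  show "(\<lambda>x. f x + g x) \<in> L2" unfolding L2_def using l(1) by (simp add: norm_triangle_ineq)
  show "n2 (\<lambda>x. f x + g x) \<le> n2 f + n2 g" using l(2) a(2) by (simp add: norm_triangle_ineq)
qed

lemma L2_scale:
  assumes "f \<in> L2"
  shows "(\<lambda>x. c * f x) \<in> L2" "n2 (\<lambda>x. c * f x) = cmod c * n2 f"
  using assms lpint_cmult[OF L2_lpint[OF assms], of "cmod c"] by (auto simp: L2_def norm_mult)

text \<open>Integrating the modulus of the integrand over y leaves the product of |f| convolved with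
  |g|, at v, and |h (- v + z)|; both are square integrable in v, which justifies Fubini. Translating
  v by y then separates f from the convolution of g and h.\<close>

lemma conv_assoc:
  assumes f: "f \<in> L1 \<inter> L2" and g: "g \<in> L2" and h: "h \<in> L2" and fg: "g \<in> L1 \<or> h \<in> L1"
  shows "((f \<star> g) \<star> h) z = (f \<star> (g \<star> h)) z"
proof -
  have f1: "f \<in> L1" and f2: "f \<in> L2" using f by auto
  note [measurable] = L2_measurable[OF f2] L2_measurable[OF g] L2_measurable[OF h]
  let ?F = "\<lambda>v y. f y * g (- y + v) * h (- v + z)"
  have int: "integrable (M \<Otimes>\<^sub>M M) (\<lambda>(v, y). ?F v y)"
  proof (rule pair.Fubini_integrable)
    have "integrable M (\<lambda>v. rconv (\<lambda>x. cmod (f x)) (\<lambda>x. cmod (g x)) v * cmod (h (- v + z)))"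
      using cauchy_schwarz(1)[OF young_left(2)[OF L1_lpint[OF f1] L2_lpint[OF g]] lpint_conv[OF L2_lpint[OF h]]] by simp
    moreover have "(LINT y|M. norm (?F v y)) = rconv (\<lambda>x. cmod (f x)) (\<lambda>x. cmod (g x)) v * cmod (h (- v + z))" for v
      by (simp add: rconv_def norm_mult)
    ultimately show "integrable M (\<lambda>v. LINT y|M. norm (case (v, y) of (v, y) \<Rightarrow> ?F v y))" by simp
    show "AE v in M. integrable M (\<lambda>y. case (v, y) of (v, y) \<Rightarrow> ?F v y)"
      using conv_integrable[OF f2 g] by simp
  qed measurable
  have "((f \<star> g) \<star> h) z = (LINT v|M. LINT y|M. ?F v y)" by (simp add: convolution_def)
  also have "\<dots> = (LINT y|M. LINT v|M. ?F v y)" by (rule pair.Fubini_integral[OF int, symmetric])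
  also have "\<dots> = (LINT y|M. f y * (g \<star> h) (- y + z))"
  proof (intro Bochner_Integration.integral_cong refl)
    fix y
    have "(LINT v|M. ?F v y) = (LINT v|M. ?F (y + v) y)"
      by (rule integral_left[symmetric]) measurable
    also have "\<dots> = f y * (g \<star> h) (- y + z)"
      by (simp add: convolution_def minus_add add.assoc[symmetric] mult.assoc)
    finally show "(LINT v|M. ?F v y) = f y * (g \<star> h) (- y + z)" .
  qed
  also have "\<dots> = (f \<star> (g \<star> h)) z" by (simp add: convolution_def)
  finally show ?thesis .
qed

text \<open>The involution of L^1; it carries no modular factor because inversion preserves
  \<open>M\<close>.\<close>

definition star :: "('a \<Rightarrow> complex) \<Rightarrow> 'a \<Rightarrow> complex" where
  "star f x = cnj (f (- x))"

lemma star_measurable [measurable]: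
  assumes [measurable]: "f \<in> borel_measurable M"
  shows "star f \<in> borel_measurable M"
  unfolding star_def[abs_def] by measurable

lemma star_L1: "f \<in> L1 \<Longrightarrow> star f \<in> L1" and n1_star: "f \<in> L1 \<Longrightarrow> n1 (star f) = n1 f"
  using lpint_uminus[of 1 "\<lambda>x. cmod (f x)"] lpn_uminus[of 1 "\<lambda>x. cmod (f x)"]
  by (auto simp: L1_def star_def)

lemma star_L2: "f \<in> L2 \<Longrightarrow> star f \<in> L2" and n2_star: "f \<in> L2 \<Longrightarrow> n2 (star f) = n2 f"
  using lpint_uminus[of 2 "\<lambda>x. cmod (f x)"] lpn_uminus[of 2 "\<lambda>x. cmod (f x)"]
  by (auto simp: L2_def star_def)

lemma L2_inner:
  assumes f: "f \<in> L2" and g: "g \<in> L2"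
  shows "integrable M (\<lambda>x. f x * cnj (g x))"
proof (rule Bochner_Integration.integrable_bound)
  show "integrable M (\<lambda>x. cmod (f x) * cmod (g x))"
    using cauchy_schwarz(1)[OF L2_lpint[OF f] L2_lpint[OF g]] .
  show "(\<lambda>x. f x * cnj (g x)) \<in> borel_measurable M"
    using L2_measurable[OF f] L2_measurable[OF g] by measurable
qed (simp add: norm_mult)

text \<open>Fubini on both sides, joined by the substitutions v to -v and z to -v + z: convolution
  by \<open>star f\<close> is the Hilbert space adjoint of convolution by f.\<close>

lemma conv_adjoint:
  assumes f: "f \<in> L1 \<inter> L2" and x: "x \<in> L2" and y: "y \<in> L2"
  shows "(LINT z|M. (star f \<star> x) z * cnj (y z)) = (LINT z|M. x z * cnj ((f \<star> y) z))"
proof -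
  have f1: "f \<in> L1" and f2: "f \<in> L2" using f by auto
  note [measurable] = L2_measurable[OF f2] L2_measurable[OF x] L2_measurable[OF y]
  let ?H = "\<lambda>z v. star f v * x (- v + z) * cnj (y z)"
  let ?G = "\<lambda>z v. x z * cnj (f v * y (- v + z))"
  have intH: "integrable (M \<Otimes>\<^sub>M M) (\<lambda>(z, v). ?H z v)"
  proof (rule pair.Fubini_integrable)
    have "integrable M (\<lambda>z. rconv (\<lambda>x. cmod (star f x)) (\<lambda>z. cmod (x z)) z * cmod (y z))"
      using cauchy_schwarz(1)[OF young_left(2)[OF L1_lpint[OF star_L1[OF f1]] L2_lpint[OF x]] L2_lpint[OF y]] by simp
    moreover have "(LINT v|M. norm (?H z v)) = rconv (\<lambda>x. cmod (star f x)) (\<lambda>z. cmod (x z)) z * cmod (y z)" for z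
      by (simp add: rconv_def norm_mult)
    ultimately show "integrable M (\<lambda>z. LINT v|M. norm (case (z, v) of (z, v) \<Rightarrow> ?H z v))" by simp
    show "AE z in M. integrable M (\<lambda>v. case (z, v) of (z, v) \<Rightarrow> ?H z v)"
      using conv_integrable[OF star_L2[OF f2] x] by simp
  qed measurable
  have intG: "integrable (M \<Otimes>\<^sub>M M) (\<lambda>(z, v). ?G z v)"
  proof (rule pair.Fubini_integrable)
    have "integrable M (\<lambda>z. cmod (x z) * rconv (\<lambda>x. cmod (f x)) (\<lambda>z. cmod (y z)) z)"
      using cauchy_schwarz(1)[OF L2_lpint[OF x] young_left(2)[OF L1_lpint[OF f1] L2_lpint[OF y]]] by simp
    moreover have "(LINT v|M. norm (?G z v)) = cmod (x z) * rconv (\<lambda>x. cmod (f x)) (\<lambda>z. cmod (y z)) z" for z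
      by (simp add: rconv_def norm_mult)
    ultimately show "integrable M (\<lambda>z. LINT v|M. norm (case (z, v) of (z, v) \<Rightarrow> ?G z v))" by simp
    show "AE z in M. integrable M (\<lambda>v. case (z, v) of (z, v) \<Rightarrow> ?G z v)"
      using conv_integrable[OF f2 y] by (auto intro!: AE_I2 integrable_mult_right simp: integrable_cnj simp del: complex_cnj_mult)
  qed measurable
  have "(LINT z|M. (star f \<star> x) z * cnj (y z)) = (LINT z|M. LINT v|M. ?H z v)"
    by (simp add: convolution_def)
  also have "\<dots> = (LINT v|M. LINT z|M. ?H z v)" by (rule pair.Fubini_integral[OF intH, symmetric])
  also have "\<dots> = (LINT v|M. LINT z|M. ?H z (- v))"
    by (rule integral_uminus_eq[symmetric]) measurable
  also have "\<dots> = (LINT v|M. LINT z|M. ?G z v)"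
  proof (rule Bochner_Integration.integral_cong[OF refl])
    fix v
    have "(LINT z|M. ?H z (- v)) = (LINT z|M. ?H (- v + z) (- v))"
      by (rule integral_left[symmetric]) measurable
    also have "\<dots> = (LINT z|M. ?G z v)"
      by (intro Bochner_Integration.integral_cong refl) (simp add: star_def add.assoc[symmetric])
    finally show "(LINT z|M. ?H z (- v)) = (LINT z|M. ?G z v)" .
  qed
  also have "\<dots> = (LINT z|M. LINT v|M. ?G z v)" by (rule pair.Fubini_integral[OF intG])
  also have "\<dots> = (LINT z|M. x z * cnj ((f \<star> y) z))"
    by (simp add: convolution_def del: complex_cnj_mult)
  finally show ?thesis .
qed

end

section \<open>Recursive bounds for the norms of dyadic powers\<close>

text \<open>For the L^2 norm of the function part h of T ^ (2 ^ k) = (h, t). The function part of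
  the square is T ^ (2 ^ k) applied to h, plus t * h; the operator norm and |t| are both at most
  \<rho> ^ (2 ^ k), hence the 2.\<close>

primrec L2_bound :: "real \<Rightarrow> real \<Rightarrow> nat \<Rightarrow> real" where
  "L2_bound \<rho> B 0 = B"
| "L2_bound \<rho> B (Suc k) = 2 * \<rho> ^ (2 ^ k) * L2_bound \<rho> B k"

text \<open>For the weighted norm of the same h. The function part of the square is h convolved with
  itself, estimated by the squaring inequality with constant 2 * C, plus 2 * t * h, estimated by the
  bound \<rho> ^ (2 ^ k) for |t|.\<close>

primrec weighted_bound :: "real \<Rightarrow> real \<Rightarrow> real \<Rightarrow> real \<Rightarrow> real \<Rightarrow> nat \<Rightarrow> real" where
  "weighted_bound C \<eta> \<rho> A B 0 = A"
| "weighted_bound C \<eta> \<rho> A B (Suc k) =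
     2 * C * weighted_bound C \<eta> \<rho> A B k powr (2 - \<eta>) * L2_bound \<rho> B k powr \<eta> + 2 * \<rho> ^ (2 ^ k) * weighted_bound C \<eta> \<rho> A B k"

lemma L2_bound_nonneg: "0 \<le> \<rho> \<Longrightarrow> 0 \<le> B \<Longrightarrow> 0 \<le> L2_bound \<rho> B k"
  by (induction k) auto

lemma weighted_bound_nonneg: "0 \<le> \<rho> \<Longrightarrow> 0 \<le> A \<Longrightarrow> 0 \<le> C \<Longrightarrow> 0 \<le> weighted_bound C \<eta> \<rho> A B k"
  by (induction k) auto

text \<open>The recursion is solved by 2 ^ k * \<rho> ^ (2 ^ k - 1) * B. With x = \<rho> / \<sigma>
  < 1 the growing factor is absorbed by n * x ^ (n - 1) \<le> 1 / (1 - x), taken at n = 2 ^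
  k.\<close>

lemma L2_bound_bound:
  assumes "0 \<le> \<rho>" "\<rho> < \<sigma>" "0 \<le> B"
  shows "\<exists>E\<ge>0. \<forall>k. L2_bound \<rho> B k \<le> E * \<sigma> ^ (2 ^ k)"
proof -
  define x where "x = \<rho> / \<sigma>"
  have s0: "0 < \<sigma>" using assms by linarith
  have x: "0 \<le> x" "x < 1" using assms s0 by (auto simp: x_def)
  have b: "L2_bound \<rho> B k = B / \<sigma> * (2 ^ k * x ^ (2 ^ k - 1)) * \<sigma> ^ (2 ^ k)" for k
  proof (induction k)
    case 0
    then show ?case using s0 by simp
  next
    case (Suc k)
    have "(1::nat) \<le> 2 ^ k" by simp
    then have e: "2 ^ Suc k - 1 = 2 ^ k + (2 ^ k - 1 :: nat)" by (simp add: mult_2)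
    have r: "\<rho> ^ (2 ^ k) = x ^ (2 ^ k) * \<sigma> ^ (2 ^ k)" using s0 by (simp add: x_def power_divide)
    have s: "\<sigma> ^ (2 ^ Suc k) = \<sigma> ^ (2 ^ k) * \<sigma> ^ (2 ^ k)" by (simp add: power_add[symmetric] mult_2)
    have x: "x ^ (2 ^ Suc k - 1) = x ^ (2 ^ k) * x ^ (2 ^ k - 1)" by (simp only: e power_add)
    show ?case unfolding L2_bound.simps Suc r s x by (simp only: power_Suc mult_ac)
  qed
  have n: "real n * x ^ (n - 1) \<le> 1 / (1 - x)" for n
  proof -
    have "real n * x ^ (n - 1) = (\<Sum>j<n. x ^ (n - 1))" by simp
    also have "\<dots> \<le> (\<Sum>j<n. x ^ j)" using x by (intro sum_mono power_decreasing) auto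
    also have "\<dots> = (1 - x ^ n) / (1 - x)" using x by (simp add: sum_gp_strict)
    also have "\<dots> \<le> 1 / (1 - x)" using x by (intro divide_right_mono) auto
    finally show ?thesis .
  qed
  show ?thesis
  proof (intro exI[of _ "B / \<sigma> * (1 / (1 - x))"] conjI allI)
    show "0 \<le> B / \<sigma> * (1 / (1 - x))" using assms s0 x by simp
    fix k
    show "L2_bound \<rho> B k \<le> B / \<sigma> * (1 / (1 - x)) * \<sigma> ^ (2 ^ k)"
      unfolding b using n[of "2 ^ k"] assms s0 by (intro mult_right_mono mult_left_mono) auto
  qed
qed

lemma summable_power_two_power:
  assumes "0 \<le> (x::real)" "x < 1"
  shows "summable (\<lambda>k. x ^ (2 ^ k))"
proof (rule summable_comparison_test')
  show "summable (\<lambda>k. x ^ k)" using assms by (simp add: summable_geometric)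
  fix k :: nat
  have "k \<le> 2 ^ k" by (rule less_imp_le[OF less_exp])
  then show "norm (x ^ (2 ^ k)) \<le> x ^ k" using assms by (simp add: power_decreasing)
qed

lemma L2_bound_summable:
  assumes "0 \<le> \<rho>" "\<rho> < 1" "0 \<le> B"
  shows "summable (L2_bound \<rho> B)"
proof -
  have \<sigma>: "\<rho> < (1 + \<rho>) / 2" "(1 + \<rho>) / 2 < 1" using assms by auto
  obtain E where E: "0 \<le> E" "\<And>k. L2_bound \<rho> B k \<le> E * ((1 + \<rho>) / 2) ^ (2 ^ k)"
    using L2_bound_bound[OF assms(1) \<sigma>(1) assms(3)] by blast
  show ?thesis
  proof (rule summable_comparison_test')
    show "summable (\<lambda>k. E * ((1 + \<rho>) / 2) ^ (2 ^ k))"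
      using assms \<sigma> by (intro summable_mult summable_power_two_power) auto
    show "norm (L2_bound \<rho> B k) \<le> E * ((1 + \<rho>) / 2) ^ (2 ^ k)" for k
      using E(2) L2_bound_nonneg[OF assms(1,3)] by simp
  qed
qed

text \<open>Measured against \<open>\<sigma> ^ (2 ^ k)\<close> with \<open>\<rho> < \<sigma> < 1\<close>, the sequence satisfies
  \<open>x (k + 1) \<le> D * x k powr (2 - \<eta>)\<close>, so \<open>ln (x k)\<close> is negligible against \<open>2 ^ k\<close>.\<close>

lemma weighted_bound_summable:
  assumes \<rho>: "0 \<le> \<rho>" "\<rho> < 1" and AB: "0 \<le> A" "0 \<le> B" and C: "0 \<le> C" and \<eta>: "0 < \<eta>" "\<eta> < 1"
  shows "summable (weighted_bound C \<eta> \<rho> A B)"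
proof -
  define \<sigma> where "\<sigma> = (1 + \<rho>) / 2"
  have \<sigma>: "\<rho> < \<sigma>" "\<sigma> < 1" "0 < \<sigma>" using \<rho> by (auto simp: \<sigma>_def)
  obtain E where E: "0 \<le> E" "\<And>k. L2_bound \<rho> B k \<le> E * \<sigma> ^ (2 ^ k)"
    using L2_bound_bound[OF \<rho>(1) \<sigma>(1) AB(2)] by blast
  let ?a = "weighted_bound C \<eta> \<rho> A B" and ?b = "L2_bound \<rho> B"
  have a0: "0 \<le> ?a k" and b0: "0 \<le> ?b k" for k
    using weighted_bound_nonneg L2_bound_nonneg \<rho> AB C by auto
  \<comment> \<open>The cut-off at 1 keeps ln (z k) nonnegative and gives
    \<open>z k \<le> z k powr (2 - \<eta>)\<close>, by which the linear term of the recursion is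
    absorbed into the power; it accounts for the summand 2 in D.\<close>
  define z where "z k = max (?a k / \<sigma> ^ (2 ^ k)) 1" for k
  define D where "D = 2 * C * E powr \<eta> + 2"
  have D: "1 \<le> D" using C by (simp add: D_def)
  have z1: "1 \<le> z k" for k by (simp add: z_def)
  have az: "?a k \<le> z k * \<sigma> ^ (2 ^ k)" for k
  proof -
    have "?a k / \<sigma> ^ (2 ^ k) \<le> z k" by (simp add: z_def)
    then show ?thesis using \<sigma> by (simp add: field_simps)
  qed
  have step: "z (Suc k) \<le> D * z k powr (2 - \<eta>)" for k
  proof -
    let ?s = "\<sigma> ^ (2 ^ k)"
    have s: "0 < ?s" "?s \<le> 1" using \<sigma> by (auto intro: power_le_one)
    have ss: "\<sigma> ^ (2 ^ Suc k) = ?s powr (2 - \<eta>) * ?s powr \<eta>"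
      using s by (simp add: powr_add[symmetric] power_mult[symmetric] mult.commute power2_eq_square)
        (simp add: power_add[symmetric] mult_2)
    have zz: "z k \<le> z k powr (2 - \<eta>)"
      using powr_mono[of 1 "2 - \<eta>" "z k"] z1[of k] \<eta> by simp
    have "?a k powr (2 - \<eta>) \<le> (z k * ?s) powr (2 - \<eta>)"
      using az[of k] a0 \<eta> by (intro powr_mono2) auto
    moreover have "?b k powr \<eta> \<le> (E * ?s) powr \<eta>"
      using E(2)[of k] b0 \<eta> by (intro powr_mono2) auto
    ultimately have "2 * C * ?a k powr (2 - \<eta>) * ?b k powr \<eta>
        \<le> 2 * C * (z k * ?s) powr (2 - \<eta>) * (E * ?s) powr \<eta>"
      using C by (intro mult_mono mult_left_mono) auto
    also have "\<dots> = (2 * C * E powr \<eta>) * z k powr (2 - \<eta>) * \<sigma> ^ (2 ^ Suc k)"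
      unfolding ss using z1[of k] s E by (simp add: powr_mult)
    finally have 1: "2 * C * ?a k powr (2 - \<eta>) * ?b k powr \<eta>
        \<le> (2 * C * E powr \<eta>) * z k powr (2 - \<eta>) * \<sigma> ^ (2 ^ Suc k)" .
    have "2 * \<rho> ^ (2 ^ k) * ?a k \<le> 2 * ?s * (z k * ?s)"
      using \<rho> \<sigma> az[of k] a0 by (intro mult_mono mult_left_mono power_mono) auto
    also have "\<dots> = 2 * z k * \<sigma> ^ (2 ^ Suc k)"
    proof -
      have s2: "\<sigma> ^ (2 ^ Suc k) = ?s * ?s" by (simp add: power_add[symmetric] mult_2)
      show ?thesis unfolding s2 by (simp only: mult_ac)
    qed
    also have "\<dots> \<le> 2 * z k powr (2 - \<eta>) * \<sigma> ^ (2 ^ Suc k)"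
      using zz \<sigma> by (intro mult_right_mono mult_left_mono) auto
    finally have 2: "2 * \<rho> ^ (2 ^ k) * ?a k \<le> 2 * z k powr (2 - \<eta>) * \<sigma> ^ (2 ^ Suc k)" .
    have "?a (Suc k) \<le> D * z k powr (2 - \<eta>) * \<sigma> ^ (2 ^ Suc k)"
      unfolding weighted_bound.simps D_def distrib_right by (intro add_mono 1 2)
    then have "?a (Suc k) / \<sigma> ^ (2 ^ Suc k) \<le> D * z k powr (2 - \<eta>)"
      using \<sigma> by (simp add: divide_le_eq)
    moreover have "1 \<le> D * z k powr (2 - \<eta>)"
      using D zz z1[of k] mult_mono[of 1 D 1 "z k powr (2 - \<eta>)"] by linarith
    ultimately show ?thesis unfolding z_def[of "Suc k"] by simp
  qed
  define L where "L k = ln (z k)" for k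
  have "L (Suc k) \<le> ln D + (2 - \<eta>) * L k" for k
  proof -
    have "ln (z (Suc k)) \<le> ln (D * z k powr (2 - \<eta>))"
      using step[of k] z1[of "Suc k"] D z1[of k] by (intro ln_mono) auto
    also have "\<dots> = ln D + (2 - \<eta>) * L k"
      unfolding L_def using D z1[of k] by (subst ln_mult) (auto simp: ln_powr)
    finally show ?thesis by (simp add: L_def)
  qed
  then have negligible: "(\<lambda>k. L k / 2 ^ k) \<longlonglongrightarrow> 0"
    by (intro subdoubling_tendsto_zero[OF \<eta>, of "ln D"]) (use D z1 in \<open>auto simp: L_def\<close>)
  define lam where "lam = - ln \<sigma>"
  have lam: "0 < lam" using \<sigma> by (simp add: lam_def)
  have ev: "\<forall>\<^sub>F k in sequentially. L k / 2 ^ k < lam / 2"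
    by (rule order_tendstoD(2)[OF negligible]) (use lam in simp)
  have "\<forall>\<^sub>F k in sequentially. norm (?a k) \<le> exp (- (lam / 2)) ^ k"
    using ev
  proof eventually_elim
    fix k assume "L k / 2 ^ k < lam / 2"
    then have Lk: "L k - 2 ^ k * lam \<le> - (2 ^ k * (lam / 2))" by (simp add: field_simps)
    have "real k \<le> 2 ^ k" using of_nat_less_two_power[of k] by (simp add: less_imp_le)
    then have "real k * (lam / 2) \<le> 2 ^ k * (lam / 2)" using lam by (intro mult_right_mono) auto
    with Lk have Lk': "L k - 2 ^ k * lam \<le> - (real k * (lam / 2))" by linarith
    have "?a k \<le> exp (L k) * exp (- lam) ^ (2 ^ k)"
      using az[of k] z1[of k] \<sigma> by (simp add: L_def lam_def)
    also have "\<dots> = exp (L k - 2 ^ k * lam)"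
      by (simp add: exp_of_nat_mult[symmetric] exp_add[symmetric])
    also have "\<dots> \<le> exp (- (real k * (lam / 2)))" using Lk' by simp
    also have "\<dots> = exp (- (lam / 2)) ^ k" by (simp add: exp_of_nat_mult[symmetric])
    finally show "norm (?a k) \<le> exp (- (lam / 2)) ^ k" using a0[of k] by simp
  qed
  then show ?thesis
    by (rule summable_comparison_test_ev) (use lam in \<open>simp add: summable_geometric\<close>)
qed

section \<open>Limits in Lebesgue spaces\<close>

lemma lpn_fatou:
  assumes f: "\<And>n. lpint M p (f n)" and H: "\<And>n. lpn M p (f n) \<le> H" and p: "0 < p"
    and g: "g \<in> borel_measurable M" "\<And>x. 0 \<le> g x" and lim: "AE x in M. (\<lambda>n. f n x) \<longlonglongrightarrow> g x"
  shows "lpint M p g" "lpn M p g \<le> H"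
proof -
  have [measurable]: "g \<in> borel_measurable M" "f n \<in> borel_measurable M" for n
    using g f[of n] by (auto simp: lpint_def)
  have H0: "0 \<le> H" using H[of 0] lpn_nonneg[of M p "f 0"] by linarith
  have I: "(\<integral>\<^sup>+x. ennreal (f n x powr p) \<partial>M) \<le> ennreal (H powr p)" for n
  proof -
    have "(\<integral>\<^sup>+x. ennreal (f n x powr p) \<partial>M) = ennreal (lpn M p (f n) powr p)"
      using lpintD(3)[OF f[of n]] p by (subst nn_integral_eq_integral) (auto simp: lpn_powr)
    also have "\<dots> \<le> ennreal (H powr p)" using H[of n] p by (intro ennreal_leI powr_mono2) auto
    finally show ?thesis .
  qed
  have "(\<integral>\<^sup>+x. ennreal (g x powr p) \<partial>M) = (\<integral>\<^sup>+x. liminf (\<lambda>n. ennreal (f n x powr p)) \<partial>M)"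
  proof (rule nn_integral_cong_AE)
    show "AE x in M. ennreal (g x powr p) = liminf (\<lambda>n. ennreal (f n x powr p))"
      using lim
    proof eventually_elim
      fix x assume "(\<lambda>n. f n x) \<longlonglongrightarrow> g x"
      then have "(\<lambda>n. f n x powr p) \<longlonglongrightarrow> g x powr p"
        using lpintD(2)[OF f] p by (intro tendsto_powr2) auto
      then have "(\<lambda>n. ennreal (f n x powr p)) \<longlonglongrightarrow> ennreal (g x powr p)" by (rule tendsto_ennrealI)
      then show "ennreal (g x powr p) = liminf (\<lambda>n. ennreal (f n x powr p))"
        by (rule lim_imp_Liminf[OF trivial_limit_sequentially, symmetric])
    qed
  qed
  also have "\<dots> \<le> liminf (\<lambda>n. \<integral>\<^sup>+x. ennreal (f n x powr p) \<partial>M)"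
    by (rule nn_integral_liminf) measurable
  also have "\<dots> \<le> ennreal (H powr p)"
    using I by (intro Liminf_le) auto
  finally have le: "(\<integral>\<^sup>+x. ennreal (g x powr p) \<partial>M) \<le> ennreal (H powr p)" .
  have int: "integrable M (\<lambda>x. g x powr p)"
    by (rule integrableI_nonneg) (use le in \<open>auto intro: le_less_trans\<close>)
  then show "lpint M p g" using g by (auto simp: lpint_def)
  have "(LINT x|M. g x powr p) \<le> H powr p"
    using le nn_integral_eq_integral[OF int] by (simp add: ennreal_le_iff)
  then have "lpn M p g \<le> (H powr p) powr (1 / p)"
    unfolding lpn_def using p by (intro powr_mono2) (auto intro: Bochner_Integration.integral_nonneg)
  then show "lpn M p g \<le> H" using p H0 by (simp add: powr_powr)
qed

lemma L2_convergence_AE_subseq: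
  fixes f :: "nat \<Rightarrow> 'a \<Rightarrow> complex"
  assumes f: "\<And>n. lpint M 2 (\<lambda>x. cmod (f n x))" and lim: "(\<lambda>n. lpn M 2 (\<lambda>x. cmod (f n x))) \<longlonglongrightarrow> 0"
  shows "\<exists>r. strict_mono r \<and> (AE x in M. (\<lambda>n. f (r n) x) \<longlonglongrightarrow> 0)"
proof -
  have "(\<lambda>n. lpn M 2 (\<lambda>x. cmod (f n x)) powr 2) \<longlonglongrightarrow> 0 powr 2"
    using lim by (intro tendsto_powr2) auto
  then have "(\<lambda>n. LINT x|M. norm (cmod (f n x) powr 2)) \<longlonglongrightarrow> 0"
    by (simp only: lpn_powr) simp
  with lpintD(3)[OF f] obtain r where r: "strict_mono r" "AE x in M. (\<lambda>n. cmod (f (r n) x) powr 2) \<longlonglongrightarrow> 0"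
    using tendsto_L1_AE_subseq[of M "\<lambda>n x. cmod (f n x) powr 2"] by blast
  have "AE x in M. (\<lambda>n. f (r n) x) \<longlonglongrightarrow> 0"
    using r(2)
  proof eventually_elim
    fix x assume "(\<lambda>n. cmod (f (r n) x) powr 2) \<longlonglongrightarrow> 0"
    then have "(\<lambda>n. (cmod (f (r n) x) powr 2) powr (1 / 2)) \<longlonglongrightarrow> 0 powr (1 / 2)"
      by (intro tendsto_powr2) auto
    then have "(\<lambda>n. cmod (f (r n) x)) \<longlonglongrightarrow> 0" by (simp only: powr_powr) simp
    then show "(\<lambda>n. f (r n) x) \<longlonglongrightarrow> 0" by (simp add: tendsto_norm_zero_iff)
  qed
  with r(1) show ?thesis by blast
qed

section \<open>The weighted convolution algebra\<close>

text \<open>The weights of the three factors in Hoelder's inequality are \<open>(1 - \<eta>) / p\<close>, \<open>\<eta> / 2\<close> and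
  \<open>1 - (1 - \<eta>) / p - \<eta> / 2\<close>.\<close>

locale weighted_group = unimodular_group +
  fixes \<omega> u :: "'a \<Rightarrow> real" and p \<eta> c :: real
  assumes \<omega>_measurable [measurable]: "\<omega> \<in> borel_measurable M"
    and u_measurable [measurable]: "u \<in> borel_measurable M"
    and \<omega>_ge_1: "1 \<le> \<omega> x" and u_nonneg: "0 \<le> u x"
    and p: "1 \<le> p" and \<eta>: "0 < \<eta>" "\<eta> < 1" and exponent: "0 < 1 - (1 - \<eta>) / p - \<eta> / 2"
    and c: "0 < c" and u_low: "AE x in M. c \<le> \<omega> x * u x"
    and \<omega>_sym: "AE x in M. \<omega> (- x) = \<omega> x"
    and \<omega>_ineq: "AE x in M. AE y in M. \<omega> x \<le> \<omega> y * \<omega> (- y + x) * (u y + u (- y + x))"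
    and u_integrable: "integrable M (\<lambda>x. (u x * \<omega> x powr \<eta>) powr (1 / (1 - (1 - \<eta>) / p - \<eta> / 2)))"
    and small_sets: "0 < \<epsilon> \<Longrightarrow> \<exists>W\<in>sets M. 0 < emeasure M W \<and> emeasure M W < ennreal \<epsilon>"
begin

lemma \<omega>_pos: "0 < \<omega> x" using \<omega>_ge_1[of x] by linarith

definition A :: "('a \<Rightarrow> complex) set" where
  "A = {f \<in> borel_measurable M. lpint M p (\<lambda>x. cmod (f x) * \<omega> x) \<and> lpint M 2 (\<lambda>x. cmod (f x))}"

definition P :: "('a \<Rightarrow> complex) \<Rightarrow> real" where
  "P f = lpn M p (\<lambda>x. cmod (f x) * \<omega> x)"

definition N :: "('a \<Rightarrow> complex) \<Rightarrow> real" where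
  "N f = max (P f) (n2 f)"

lemma P_nonneg [simp]: "0 \<le> P f" by (simp add: P_def)

lemma N_nonneg [simp]: "0 \<le> N f" by (simp add: N_def le_max_iff_disj)

lemma A_measurable [measurable_dest]: "f \<in> A \<Longrightarrow> f \<in> borel_measurable M"
  and A_lpint: "f \<in> A \<Longrightarrow> lpint M p (\<lambda>x. cmod (f x) * \<omega> x)"
  and A_L2: "f \<in> A \<Longrightarrow> f \<in> L2"
  by (auto simp: A_def L2_def)

text \<open>The norm of \<open>u * \<omega> powr \<eta>\<close> in L^(1/e), where e is the third
  Hoelder weight.\<close>

definition C0 :: real where
  "C0 = (LINT x|M. (u x * \<omega> x powr \<eta>) powr (1 / (1 - (1 - \<eta>) / p - \<eta> / 2))) powr (1 - (1 - \<eta>) / p - \<eta> / 2)"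

lemma C0_nonneg: "0 \<le> C0" by (simp add: C0_def)

abbreviation Q :: "('a \<Rightarrow> complex) \<Rightarrow> real" where
  "Q f \<equiv> P f powr (1 - \<eta>) * n2 f powr \<eta>"

text \<open>The factors are (|f| \<omega>) powr (1 - \<eta>), |f| powr \<eta> and u * \<omega> powr
  \<eta>. The second one lacks the power \<eta> of \<omega>, since the L^2 norm is unweighted, and
  the third one supplies it.\<close>

lemma interpolation:
  assumes f: "f \<in> A"
  shows "lpint M 1 (\<lambda>x. cmod (f x) * \<omega> x * u x)" "lpn M 1 (\<lambda>x. cmod (f x) * \<omega> x * u x) \<le> C0 * Q f"
proof -
  note [measurable] = A_measurable[OF f]
  let ?e = "1 - (1 - \<eta>) / p - \<eta> / 2"
  let ?X = "\<lambda>x. (cmod (f x) * \<omega> x) powr p" and ?Y = "\<lambda>x. cmod (f x) powr 2"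
  let ?Z = "\<lambda>x. (u x * \<omega> x powr \<eta>) powr (1 / ?e)"
  have w: "0 \<le> (1 - \<eta>) / p" "0 \<le> \<eta> / 2" "0 \<le> ?e" "(1 - \<eta>) / p + \<eta> / 2 + ?e = 1"
    using p \<eta> exponent by auto
  have int: "integrable M ?X" "integrable M ?Y" "integrable M ?Z"
    using lpintD(3)[OF A_lpint[OF f]] lpintD(3)[OF L2_lpint[OF A_L2[OF f]]] u_integrable by auto
  have eq: "?X x powr ((1 - \<eta>) / p) * ?Y x powr (\<eta> / 2) * ?Z x powr ?e = cmod (f x) * \<omega> x * u x" for x
  proof (cases "f x = 0")
    case False
    have z: "?Z x powr ?e = u x * \<omega> x powr \<eta>"
      using exponent u_nonneg[of x] \<omega>_pos[of x] by (simp add: powr_powr)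
    have X: "?X x powr ((1 - \<eta>) / p) = cmod (f x) powr (1 - \<eta>) * \<omega> x powr (1 - \<eta>)"
      using p \<omega>_pos[of x] by (simp add: powr_powr powr_mult)
    have Y: "?Y x powr (\<eta> / 2) = cmod (f x) powr \<eta>" by (subst powr_powr) simp
    have "?X x powr ((1 - \<eta>) / p) * ?Y x powr (\<eta> / 2) * ?Z x powr ?e
      = (cmod (f x) powr (1 - \<eta>) * cmod (f x) powr \<eta>) * (\<omega> x powr (1 - \<eta>) * \<omega> x powr \<eta>) * u x"
      unfolding X Y z by (simp only: mult_ac)
    also have "\<dots> = cmod (f x) * \<omega> x * u x"
      using False \<omega>_pos[of x] by (simp add: powr_add[symmetric])
    finally show ?thesis .
  qed simp
  have "integrable M (\<lambda>x. cmod (f x) * \<omega> x * u x)"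
    using holder3(1)[OF w int] unfolding eq by simp
  then show "lpint M 1 (\<lambda>x. cmod (f x) * \<omega> x * u x)"
    using u_nonneg \<omega>_pos by (auto simp: lpint_1 less_imp_le)
  have "(LINT x|M. cmod (f x) * \<omega> x * u x)
    \<le> (LINT x|M. ?X x) powr ((1 - \<eta>) / p) * (LINT x|M. ?Y x) powr (\<eta> / 2) * (LINT x|M. ?Z x) powr ?e"
    using holder3(2)[OF w int] unfolding eq by simp
  also have "(LINT x|M. ?X x) powr ((1 - \<eta>) / p) = P f powr (1 - \<eta>)"
    by (simp add: P_def lpn_def powr_powr)
  also have "(LINT x|M. ?Y x) powr (\<eta> / 2) = n2 f powr \<eta>"
    unfolding lpn_def by (subst powr_powr) simp
  finally show "lpn M 1 (\<lambda>x. cmod (f x) * \<omega> x * u x) \<le> C0 * Q f"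
    using u_nonneg \<omega>_pos by (subst lpn_1) (auto simp: C0_def less_imp_le mult_ac)
qed

lemma Q_le_N: "Q f \<le> N f"
proof -
  have "Q f \<le> N f powr (1 - \<eta>) * N f powr \<eta>"
    using \<eta> by (intro mult_mono powr_mono2) (auto simp: N_def)
  also have "\<dots> = N f" using N_nonneg[of f] by (cases "N f = 0") (auto simp: powr_add[symmetric])
  finally show ?thesis .
qed

text \<open>The lower bound for \<omega> u gives |f| \<le> |f| \<omega> u / c almost everywhere, and
  \<open>interpolation\<close> bounds the right-hand side in L^1. By Young's inequality the algebra
  therefore acts on L^2.\<close>

lemma A_L1:
  assumes f: "f \<in> A"
  shows "f \<in> L1" "n1 f \<le> C0 / c * N f"
proof -
  note [measurable] = A_measurable[OF f]
  note I = interpolation[OF f]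
  have le: "AE x in M. cmod (f x) \<le> 1 / c * (cmod (f x) * \<omega> x * u x)"
    using u_low
  proof eventually_elim
    fix x assume "c \<le> \<omega> x * u x"
    then have "cmod (f x) * c \<le> cmod (f x) * (\<omega> x * u x)" by (intro mult_left_mono) auto
    then show "cmod (f x) \<le> 1 / c * (cmod (f x) * \<omega> x * u x)" using c by (simp add: field_simps)
  qed
  have m: "(\<lambda>x. cmod (f x)) \<in> borel_measurable M" by measurable
  note l = lpint_mono[OF lpint_cmult(1)[OF I(1), of "1 / c"] _ m _ le]
  show "f \<in> L1" unfolding L1_def using l(1) c by simp
  have "n1 f \<le> 1 / c * lpn M 1 (\<lambda>x. cmod (f x) * \<omega> x * u x)"
    using l(2) lpint_cmult(2)[OF I(1), of "1 / c"] c by simp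
  also have "\<dots> \<le> 1 / c * (C0 * N f)"
    using I(2) mult_left_mono[OF Q_le_N[of f] C0_nonneg] c by (intro mult_left_mono) auto
  finally show "n1 f \<le> C0 / c * N f" by simp
qed

lemma A_L12: "f \<in> A \<Longrightarrow> f \<in> L1 \<inter> L2"
  using A_L1(1) A_L2 by blast

text \<open>The weight inequality splits the weighted convolution into a part with u attached to f
  and a part with u attached to g, to which the two versions of Young's inequality apply. Only the
  factor that carries u is interpolated; for f = g this leaves the power 2 - \<eta> of P.\<close>

lemma A_conv:
  assumes f: "f \<in> A" and g: "g \<in> A"
  shows "f \<star> g \<in> A" "P (f \<star> g) \<le> C0 * (Q f * P g + P f * Q g)"
proof -
  note [measurable] = A_measurable[OF f] A_measurable[OF g]
  let ?a = "\<lambda>x. cmod (f x) * \<omega> x * u x" and ?b = "\<lambda>x. cmod (g x) * \<omega> x"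
  let ?a' = "\<lambda>x. cmod (f x) * \<omega> x" and ?b' = "\<lambda>x. cmod (g x) * \<omega> x * u x"
  note Y = young_left[OF interpolation(1)[OF f] A_lpint[OF g] p]
  note Y' = young_right[OF A_lpint[OF f] interpolation(1)[OF g] p]
  have le: "AE x in M. cmod ((f \<star> g) x) * \<omega> x \<le> rconv ?a ?b x + rconv ?a' ?b' x"
    using Y(1) Y'(1) \<omega>_ineq
  proof eventually_elim
    fix x
    assume i: "integrable M (\<lambda>y. ?a y * ?b (- y + x))" "integrable M (\<lambda>y. ?a' y * ?b' (- y + x))"
      and ae: "AE y in M. \<omega> x \<le> \<omega> y * \<omega> (- y + x) * (u y + u (- y + x))"
    have "cmod ((f \<star> g) x) * \<omega> x \<le> rconv (\<lambda>x. cmod (f x)) (\<lambda>x. cmod (g x)) x * \<omega> x"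
      using \<omega>_pos[of x] by (intro mult_right_mono cmod_conv_le) auto
    also have "\<dots> = (LINT y|M. cmod (f y) * cmod (g (- y + x)) * \<omega> x)" by (simp add: rconv_def)
    also have "\<dots> \<le> (LINT y|M. ?a y * ?b (- y + x) + ?a' y * ?b' (- y + x))"
    proof (rule integral_mono_AE)
      show "integrable M (\<lambda>y. cmod (f y) * cmod (g (- y + x)) * \<omega> x)"
        using rconv_L2(1)[OF L2_lpint[OF A_L2[OF f]] L2_lpint[OF A_L2[OF g]]] by simp
      show "AE y in M. cmod (f y) * cmod (g (- y + x)) * \<omega> x \<le> ?a y * ?b (- y + x) + ?a' y * ?b' (- y + x)"
        using ae
      proof eventually_elim
        fix y assume "\<omega> x \<le> \<omega> y * \<omega> (- y + x) * (u y + u (- y + x))"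
        then have "cmod (f y) * cmod (g (- y + x)) * \<omega> x
          \<le> cmod (f y) * cmod (g (- y + x)) * (\<omega> y * \<omega> (- y + x) * (u y + u (- y + x)))"
          by (intro mult_left_mono) auto
        then show "cmod (f y) * cmod (g (- y + x)) * \<omega> x \<le> ?a y * ?b (- y + x) + ?a' y * ?b' (- y + x)"
          by (simp add: algebra_simps)
      qed
    qed (use i in auto)
    also have "\<dots> = rconv ?a ?b x + rconv ?a' ?b' x" using i by (simp add: rconv_def)
    finally show "cmod ((f \<star> g) x) * \<omega> x \<le> rconv ?a ?b x + rconv ?a' ?b' x" .
  qed
  have m: "(\<lambda>x. cmod ((f \<star> g) x) * \<omega> x) \<in> borel_measurable M" by measurable
  have nn: "0 \<le> cmod ((f \<star> g) x) * \<omega> x" for x using \<omega>_pos[of x] by simp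
  note s = lpint_add[OF Y(2) Y'(2) p]
  have p0: "0 \<le> p" using p by simp
  note l = lpint_mono[OF s(1) p0 m nn le]
  have "f \<star> g \<in> L2" by (rule conv_L2(1)[OF A_L1(1)[OF f] A_L2[OF g]])
  then show "f \<star> g \<in> A" using l(1) by (auto simp: A_def L2_def)
  have "P (f \<star> g) \<le> lpn M 1 ?a * P g + P f * lpn M 1 ?b'"
    using l(2) s(2) Y(3) Y'(3) unfolding P_def by linarith
  also have "\<dots> \<le> (C0 * Q f) * P g + P f * (C0 * Q g)"
    using interpolation(2)[OF f] interpolation(2)[OF g]
    by (intro add_mono mult_right_mono mult_left_mono) auto
  finally show "P (f \<star> g) \<le> C0 * (Q f * P g + P f * Q g)" by (simp add: algebra_simps)
qed

text \<open>Dominates the constants 2 * C0 for the weighted norm and C0 / c for the L^2 norm; the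
  summand 1 makes K at least 1, as the products with scalars in \<open>nrm_pmul\<close>
  require.\<close>

definition K :: real where "K = 2 * C0 + C0 / c + 1"

lemma K_ge_1: "1 \<le> K" using C0_nonneg c by (simp add: K_def)

lemma N_conv:
  assumes f: "f \<in> A" and g: "g \<in> A"
  shows "N (f \<star> g) \<le> K * N f * N g"
proof -
  have "Q f * P g + P f * Q g \<le> N f * N g + N f * N g"
    using Q_le_N[of f] Q_le_N[of g] by (intro add_mono mult_mono) (auto simp: N_def le_max_iff_disj)
  then have "P (f \<star> g) \<le> C0 * (N f * N g + N f * N g)"
    using A_conv(2)[OF f g] mult_left_mono[OF _ C0_nonneg] order_trans by blast
  then have 1: "P (f \<star> g) \<le> 2 * C0 * (N f * N g)" by (simp add: algebra_simps)
  have "n2 (f \<star> g) \<le> n1 f * n2 g" by (rule conv_L2(2)[OF A_L1(1)[OF f] A_L2[OF g]])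
  also have "\<dots> \<le> (C0 / c * N f) * N g" using A_L1(2)[OF f] C0_nonneg c by (intro mult_mono) (auto simp: N_def le_max_iff_disj)
  finally have 2: "n2 (f \<star> g) \<le> C0 / c * (N f * N g)" by simp
  have nn: "0 \<le> N f * N g" by simp
  have "0 \<le> C0 / c" using C0_nonneg c by simp
  then have "2 * C0 \<le> K" "C0 / c \<le> K" unfolding K_def using C0_nonneg by linarith+
  then have "2 * C0 * (N f * N g) \<le> K * (N f * N g)" "C0 / c * (N f * N g) \<le> K * (N f * N g)"
    by (auto intro!: mult_right_mono[OF _ nn] simp del: times_divide_eq_left)
  with 1 2 show ?thesis by (simp add: N_def mult.assoc)
qed

lemma A_add:
  assumes f: "f \<in> A" and g: "g \<in> A"
  shows "(\<lambda>x. f x + g x) \<in> A" "P (\<lambda>x. f x + g x) \<le> P f + P g" "N (\<lambda>x. f x + g x) \<le> N f + N g"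
proof -
  note [measurable] = A_measurable[OF f] A_measurable[OF g]
  note s = lpint_add[OF A_lpint[OF f] A_lpint[OF g] p]
  have m: "(\<lambda>x. cmod (f x + g x) * \<omega> x) \<in> borel_measurable M" by measurable
  have p0: "0 \<le> p" using p by simp
  have nn: "0 \<le> cmod (f x + g x) * \<omega> x" for x using \<omega>_pos[of x] by simp
  have le: "AE x in M. cmod (f x + g x) * \<omega> x \<le> cmod (f x) * \<omega> x + cmod (g x) * \<omega> x"
  proof (rule AE_I2)
    fix x
    show "cmod (f x + g x) * \<omega> x \<le> cmod (f x) * \<omega> x + cmod (g x) * \<omega> x"
      using mult_right_mono[OF norm_triangle_ineq[of "f x" "g x"], of "\<omega> x"] \<omega>_pos[of x] by (simp add: distrib_right)
  qed
  note l = lpint_mono[OF s(1) p0 m nn le]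
  note a = L2_add[OF A_L2[OF f] A_L2[OF g]]
  show "(\<lambda>x. f x + g x) \<in> A" using l(1) a(1) by (auto simp: A_def L2_def)
  show P: "P (\<lambda>x. f x + g x) \<le> P f + P g" using l(2) s(2) by (simp add: P_def)
  show "N (\<lambda>x. f x + g x) \<le> N f + N g" using P a(2) unfolding N_def by linarith
qed

lemma A_scale:
  assumes f: "f \<in> A"
  shows "(\<lambda>x. k * f x) \<in> A" "P (\<lambda>x. k * f x) = cmod k * P f" "N (\<lambda>x. k * f x) = cmod k * N f"
proof -
  note [measurable] = A_measurable[OF f]
  note s = lpint_cmult[OF A_lpint[OF f], of "cmod k"]
  have eq: "cmod (k * f x) * \<omega> x = cmod k * (cmod (f x) * \<omega> x)" for x by (simp add: norm_mult)
  show "(\<lambda>x. k * f x) \<in> A" using s(1) p L2_scale(1)[OF A_L2[OF f], of k] by (auto simp: A_def L2_def eq)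
  show P: "P (\<lambda>x. k * f x) = cmod k * P f" using s(2) p by (simp add: P_def eq)
  show "N (\<lambda>x. k * f x) = cmod k * N f"
    unfolding N_def P L2_scale(2)[OF A_L2[OF f]] by (simp add: max_mult_distrib_left)
qed

lemma A_star:
  assumes f: "f \<in> A"
  shows "star f \<in> A" "N (star f) = N f"
proof -
  note [measurable] = A_measurable[OF f]
  let ?g = "\<lambda>x. cmod (f x) * \<omega> x"
  have ae: "AE x in M. cmod (star f x) * \<omega> x = ?g (- x)"
    using \<omega>_sym by eventually_elim (simp add: star_def)
  have m: "(\<lambda>x. cmod (star f x) * \<omega> x) \<in> borel_measurable M" "(\<lambda>x. ?g (- x)) \<in> borel_measurable M" by measurable
  have p0: "0 \<le> p" using p by simp
  have nn: "0 \<le> cmod (star f x) * \<omega> x" for x using \<omega>_pos[of x] by simp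
  have le: "AE x in M. cmod (star f x) * \<omega> x \<le> ?g (- x)" using ae by eventually_elim simp
  show "star f \<in> A"
    using lpint_mono(1)[OF lpint_uminus[OF A_lpint[OF f]] p0 m(1) nn le] star_L2[OF A_L2[OF f]]
    by (auto simp: A_def L2_def)
  have "P (star f) = P f"
    unfolding P_def lpn_cong_AE[OF m ae] by (rule lpn_uminus[OF A_lpint[OF f]])
  then show "N (star f) = N f" by (simp add: N_def n2_star[OF A_L2[OF f]])
qed

end

section \<open>The unitization on the level of functions\<close>

type_synonym 'a unitized = "('a \<Rightarrow> complex) \<times> complex"

context weighted_group
begin

text \<open>The operator on L^2 given by a pair. Pairs of functions, rather than classes, are used
  at this stage: the convolutions involved are defined at every point, so associativity and
  distributivity become equalities of pairs.\<close>

definition act :: "'a unitized \<Rightarrow> ('a \<Rightarrow> complex) \<Rightarrow> 'a \<Rightarrow> complex" where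
  "act a x = (\<lambda>z. (fst a \<star> x) z + snd a * x z)"

definition pmul :: "'a unitized \<Rightarrow> 'a unitized \<Rightarrow> 'a unitized" where
  "pmul a b = ((\<lambda>z. act a (fst b) z + snd b * fst a z), snd a * snd b)"

definition padd :: "'a unitized \<Rightarrow> 'a unitized \<Rightarrow> 'a unitized" where
  "padd a b = ((\<lambda>z. fst a z + fst b z), snd a + snd b)"

definition pscale :: "complex \<Rightarrow> 'a unitized \<Rightarrow> 'a unitized" where
  "pscale k a = ((\<lambda>z. k * fst a z), k * snd a)"

definition pone :: "'a unitized" where
  "pone = ((\<lambda>z. 0), 1)"

definition pstar :: "'a unitized \<Rightarrow> 'a unitized" where
  "pstar a = (star (fst a), cnj (snd a))"

definition pA :: "('a unitized) set" where
  "pA = A \<times> UNIV"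

definition nrm :: "'a unitized \<Rightarrow> real" where
  "nrm a = N (fst a) + cmod (snd a)"

lemma nrm_nonneg [simp]: "0 \<le> nrm a" by (simp add: nrm_def)

lemma pA_fst: "a \<in> pA \<Longrightarrow> fst a \<in> A" by (auto simp: pA_def)

lemma pA_fst_L12: "a \<in> pA \<Longrightarrow> fst a \<in> L1 \<inter> L2" by (rule A_L12[OF pA_fst])

lemma pA_fst_L1: "a \<in> pA \<Longrightarrow> fst a \<in> L1" and pA_fst_L2: "a \<in> pA \<Longrightarrow> fst a \<in> L2"
  using pA_fst_L12 by auto

lemma zero_A: "(\<lambda>z. 0) \<in> A"
  using p by (auto simp: A_def lpint_def)

lemma N_zero: "N (\<lambda>z. 0) = 0" by (simp add: N_def P_def lpn_def)

lemma conv_zero: "(\<lambda>z. 0) \<star> x = (\<lambda>z. 0)" "x \<star> (\<lambda>z. 0) = (\<lambda>z. 0)"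
  by (auto simp: convolution_def)

lemma pone_pA: "pone \<in> pA" by (simp add: pone_def pA_def zero_A)

lemma act_L2:
  assumes a: "a \<in> pA" and x: "x \<in> L2"
  shows "act a x \<in> L2" "n2 (act a x) \<le> (C0 / c + 1) * nrm a * n2 x"
proof -
  note cv = conv_L2[OF pA_fst_L1[OF a] x] and sc = L2_scale[OF x, of "snd a"]
  note ad = L2_add[OF cv(1) sc(1)]
  show "act a x \<in> L2" unfolding act_def by (rule ad(1))
  have k: "0 \<le> C0 / c" using C0_nonneg c by simp
  have "n2 (act a x) \<le> n1 (fst a) * n2 x + cmod (snd a) * n2 x"
    unfolding act_def using ad(2) cv(2) sc(2) by linarith
  also have "\<dots> \<le> (C0 / c * N (fst a)) * n2 x + cmod (snd a) * n2 x"
    using A_L1(2)[OF pA_fst[OF a]] by (intro add_mono mult_right_mono) auto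
  also have "\<dots> \<le> (C0 / c + 1) * nrm a * n2 x"
  proof -
    have "C0 / c * N (fst a) + cmod (snd a) \<le> (C0 / c + 1) * nrm a"
      using k unfolding nrm_def by (simp add: distrib_left distrib_right del: times_divide_eq_left)
    from mult_right_mono[OF this, of "n2 x"] show ?thesis by (simp add: distrib_right)
  qed
  finally show "n2 (act a x) \<le> (C0 / c + 1) * nrm a * n2 x" .
qed

lemma act_add:
  "a \<in> pA \<Longrightarrow> x \<in> L2 \<Longrightarrow> y \<in> L2 \<Longrightarrow> act a (\<lambda>z. x z + y z) = (\<lambda>z. act a x z + act a y z)"
  using conv_add_right[OF pA_fst_L2] by (auto simp: act_def fun_eq_iff distrib_left)

lemma act_scale: "act a (\<lambda>z. k * x z) = (\<lambda>z. k * act a x z)"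
  by (auto simp: act_def fun_eq_iff conv_scale_right distrib_left mult.left_commute)

lemma act_pmul:
  assumes a: "a \<in> pA" and b: "b \<in> pA" and x: "x \<in> L2"
  shows "act (pmul a b) x = act a (act b x)"
proof
  fix z
  note a12 = pA_fst_L12[OF a] and a2 = pA_fst_L2[OF a] and b2 = pA_fst_L2[OF b]
  have ab: "fst a \<star> fst b \<in> L2" by (rule conv_L2(1)[OF pA_fst_L1[OF a] b2])
  have bx: "fst b \<star> x \<in> L2" by (rule conv_L2(1)[OF pA_fst_L1[OF b] x])
  have e: "(\<lambda>z. act a (fst b) z + snd b * fst a z)
    = (\<lambda>z. ((fst a \<star> fst b) z + snd a * fst b z) + snd b * fst a z)" by (simp add: act_def)
  have "(fst (pmul a b) \<star> x) z = ((fst a \<star> fst b) \<star> x) z + snd a * (fst b \<star> x) z + snd b * (fst a \<star> x) z"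
    unfolding pmul_def fst_conv e
    by (subst conv_add_left, (intro L2_add L2_scale ab a2 b2 x)+, subst conv_add_left,
        (intro L2_add L2_scale ab a2 b2 x)+, simp add: conv_scale_left)
  also have "((fst a \<star> fst b) \<star> x) z = (fst a \<star> (fst b \<star> x)) z"
    using conv_assoc[OF a12 b2 x] pA_fst_L1[OF b] by simp
  finally have 1: "(fst (pmul a b) \<star> x) z = (fst a \<star> (fst b \<star> x)) z + snd a * (fst b \<star> x) z + snd b * (fst a \<star> x) z" .
  have "(fst a \<star> act b x) z = (fst a \<star> (fst b \<star> x)) z + snd b * (fst a \<star> x) z"
    unfolding act_def
    by (subst conv_add_right, (intro L2_scale a2 bx x)+, simp add: conv_scale_right)
  with 1 show "act (pmul a b) x z = act a (act b x) z"
    unfolding act_def[of "pmul a b"] act_def[of a "act b x"]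
    by (simp add: pmul_def act_def[of b] algebra_simps)
qed

lemma N_act:
  assumes a: "a \<in> pA" and f: "f \<in> A"
  shows "act a f \<in> A" "N (act a f) \<le> K * N (fst a) * N f + cmod (snd a) * N f"
proof -
  note cv = A_conv(1)[OF pA_fst[OF a] f] and sc = A_scale[OF f, of "snd a"]
  show "act a f \<in> A" unfolding act_def by (rule A_add(1)[OF cv sc(1)])
  show "N (act a f) \<le> K * N (fst a) * N f + cmod (snd a) * N f"
    unfolding act_def using A_add(3)[OF cv sc(1)] N_conv[OF pA_fst[OF a] f] sc(3) by linarith
qed

lemma pmul_pA: "a \<in> pA \<Longrightarrow> b \<in> pA \<Longrightarrow> pmul a b \<in> pA"
  unfolding pmul_def using A_add(1)[OF N_act(1) A_scale(1)] pA_fst by (auto simp: pA_def)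

lemma padd_pA: "a \<in> pA \<Longrightarrow> b \<in> pA \<Longrightarrow> padd a b \<in> pA"
  unfolding padd_def using A_add(1) pA_fst by (auto simp: pA_def)

lemma pscale_pA: "a \<in> pA \<Longrightarrow> pscale k a \<in> pA"
  unfolding pscale_def using A_scale(1) pA_fst by (auto simp: pA_def)

lemma pstar_pA: "a \<in> pA \<Longrightarrow> pstar a \<in> pA"
  unfolding pstar_def using A_star(1) pA_fst by (auto simp: pA_def)

lemma nrm_pstar: "a \<in> pA \<Longrightarrow> nrm (pstar a) = nrm a"
  by (simp add: nrm_def pstar_def A_star(2)[OF pA_fst])

lemma nrm_pscale: "a \<in> pA \<Longrightarrow> nrm (pscale k a) = cmod k * nrm a"
  by (simp add: nrm_def pscale_def A_scale(3)[OF pA_fst] norm_mult distrib_left)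

lemma nrm_padd: "a \<in> pA \<Longrightarrow> b \<in> pA \<Longrightarrow> nrm (padd a b) \<le> nrm a + nrm b"
  using A_add(3)[OF pA_fst pA_fst, of a b] norm_triangle_ineq[of "snd a" "snd b"]
  by (simp add: nrm_def padd_def)

lemma nrm_pmul:
  assumes a: "a \<in> pA" and b: "b \<in> pA"
  shows "nrm (pmul a b) \<le> K * nrm a * nrm b"
proof -
  note s = A_scale[OF pA_fst[OF a], of "snd b"]
  note n = N_act[OF a pA_fst[OF b]]
  have "nrm (pmul a b) \<le> (K * N (fst a) * N (fst b) + cmod (snd a) * N (fst b)) + cmod (snd b) * N (fst a)
      + cmod (snd a) * cmod (snd b)"
    unfolding nrm_def pmul_def fst_conv snd_conv norm_mult using A_add(3)[OF n(1) s(1)] n(2) s(3) by linarith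
  also have "\<dots> \<le> (K * N (fst a) * N (fst b) + K * (cmod (snd a) * N (fst b))) + K * (cmod (snd b) * N (fst a))
      + K * (cmod (snd a) * cmod (snd b))"
    using K_ge_1 mult_right_mono[OF K_ge_1, of "cmod (snd a) * N (fst b)"]
      mult_right_mono[OF K_ge_1, of "cmod (snd b) * N (fst a)"]
      mult_right_mono[OF K_ge_1, of "cmod (snd a) * cmod (snd b)"]
    by (intro add_mono) auto
  also have "\<dots> = K * nrm a * nrm b" by (simp add: nrm_def algebra_simps)
  finally show ?thesis .
qed

lemma pair_eqI: "(\<And>z. fst a z = fst b z) \<Longrightarrow> snd a = snd b \<Longrightarrow> a = b" for a b :: "'a unitized"
  by (auto simp: prod_eq_iff)

lemma pmul_assoc:
  assumes "a \<in> pA" "b \<in> pA" "d \<in> pA"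
  shows "pmul (pmul a b) d = pmul a (pmul b d)"
proof (rule pair_eqI)
  fix z
  have L: "fst b \<in> L2" "fst d \<in> L2" "act b (fst d) \<in> L2" "(\<lambda>z. snd d * fst b z) \<in> L2"
    using assms pA_fst_L2 act_L2(1) L2_scale(1) by auto
  show "fst (pmul (pmul a b) d) z = fst (pmul a (pmul b d)) z"
    unfolding pmul_def[of "pmul a b"] pmul_def[of a "pmul b d"] act_pmul[OF assms(1,2) L(2)]
    unfolding pmul_def[of b d] pmul_def[of a b] fst_conv snd_conv act_add[OF assms(1) L(3,4)] act_scale
    by (simp add: algebra_simps)
qed (simp add: pmul_def)

lemma pmul_one: "pmul pone a = a" "pmul a pone = a"
  by (auto simp: pmul_def pone_def act_def conv_zero prod_eq_iff)

lemma act_pone: "act pone x = x"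
  by (simp add: act_def pone_def conv_zero)

lemma pmul_padd:
  assumes "a \<in> pA" "b \<in> pA" "d \<in> pA"
  shows "pmul a (padd b d) = padd (pmul a b) (pmul a d)"
proof (rule pair_eqI)
  fix z
  have L: "fst b \<in> L2" "fst d \<in> L2" using assms pA_fst_L2 by auto
  show "fst (pmul a (padd b d)) z = fst (padd (pmul a b) (pmul a d)) z"
    unfolding pmul_def padd_def fst_conv snd_conv act_add[OF assms(1) L] by (simp add: algebra_simps)
qed (simp add: pmul_def padd_def algebra_simps)

lemma act_padd:
  assumes "a \<in> pA" "b \<in> pA" "x \<in> L2"
  shows "act (padd a b) x = (\<lambda>z. act a x z + act b x z)"
  using conv_add_left[OF pA_fst_L2[OF assms(1)] pA_fst_L2[OF assms(2)] assms(3)]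
  by (auto simp: act_def padd_def fun_eq_iff algebra_simps)

lemma act_pscale: "act (pscale k a) x = (\<lambda>z. k * act a x z)"
  by (auto simp: act_def pscale_def fun_eq_iff conv_scale_left algebra_simps)

lemma padd_pmul:
  assumes "a \<in> pA" "b \<in> pA" "d \<in> pA"
  shows "pmul (padd a b) d = padd (pmul a d) (pmul b d)"
  unfolding pmul_def act_padd[OF assms(1,2) pA_fst_L2[OF assms(3)]]
  by (auto simp: padd_def fun_eq_iff algebra_simps)

lemma pscale_pmul: "pmul (pscale k a) b = pscale k (pmul a b)" "pmul a (pscale k b) = pscale k (pmul a b)"
  unfolding pmul_def act_pscale
  by (auto simp: pscale_def act_scale fun_eq_iff algebra_simps)

section \<open>Adjoint, contraction and scalar part\<close>

lemma n2_sq: "f \<in> L2 \<Longrightarrow> (n2 f)\<^sup>2 = (LINT x|M. (cmod (f x))\<^sup>2)"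
  and n2_sq_integrable: "f \<in> L2 \<Longrightarrow> integrable M (\<lambda>x. (cmod (f x))\<^sup>2)"
  using lpn_powr[of 2 M "\<lambda>x. cmod (f x)"] lpintD(3)[OF L2_lpint[of f]] by simp_all

lemma act_adjoint:
  assumes a: "a \<in> pA" and x: "x \<in> L2" and y: "y \<in> L2"
  shows "(LINT z|M. act (pstar a) x z * cnj (y z)) = (LINT z|M. x z * cnj (act a y z))"
proof -
  have i1: "integrable M (\<lambda>z. (star (fst a) \<star> x) z * cnj (y z))"
    by (rule L2_inner[OF conv_L2(1)[OF star_L1[OF pA_fst_L1[OF a]] x] y])
  have i2: "integrable M (\<lambda>z. x z * cnj ((fst a \<star> y) z))"
    by (rule L2_inner[OF x conv_L2(1)[OF pA_fst_L1[OF a] y]])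
  have i3: "integrable M (\<lambda>z. x z * cnj (y z))" by (rule L2_inner[OF x y])
  have "(LINT z|M. act (pstar a) x z * cnj (y z))
    = (LINT z|M. (star (fst a) \<star> x) z * cnj (y z) + cnj (snd a) * (x z * cnj (y z)))"
    by (simp add: act_def pstar_def algebra_simps)
  also have "\<dots> = (LINT z|M. (star (fst a) \<star> x) z * cnj (y z)) + cnj (snd a) * (LINT z|M. x z * cnj (y z))"
    using i1 i3 by simp
  also have "(LINT z|M. (star (fst a) \<star> x) z * cnj (y z)) = (LINT z|M. x z * cnj ((fst a \<star> y) z))"
    by (rule conv_adjoint[OF pA_fst_L12[OF a] x y])
  also have "\<dots> + cnj (snd a) * (LINT z|M. x z * cnj (y z))
    = (LINT z|M. x z * cnj ((fst a \<star> y) z) + cnj (snd a) * (x z * cnj (y z)))"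
    using i2 i3 by simp
  also have "\<dots> = (LINT z|M. x z * cnj (act a y z))"
    by (simp add: act_def algebra_simps)
  finally show ?thesis .
qed

text \<open>With norms in L^2, expanding the square by means of the adjoint gives |x|^2 - 2 e |a
  x|^2 + e^2 |a* a x|^2. The last term is at most e |a x|^2 because e L^2 \<le> 1, and |a x| is at
  least |x| / Y.\<close>

lemma contraction:
  assumes a: "a \<in> pA" and x: "x \<in> L2" and e: "0 < e" "e * L\<^sup>2 \<le> 1"
    and L: "\<And>y. y \<in> L2 \<Longrightarrow> n2 (act (pstar a) y) \<le> L * n2 y"
    and Y: "0 < Y" "n2 x \<le> Y * n2 (act a x)"
  shows "(n2 (\<lambda>z. x z - of_real e * act (pstar a) (act a x) z))\<^sup>2 \<le> (1 - e / Y\<^sup>2) * (n2 x)\<^sup>2"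
proof -
  define y where "y = act a x"
  define v where "v = act (pstar a) y"
  have y: "y \<in> L2" unfolding y_def by (rule act_L2(1)[OF a x])
  have v: "v \<in> L2" unfolding v_def by (rule act_L2(1)[OF pstar_pA[OF a] y])
  have inner: "(LINT z|M. v z * cnj (x z)) = of_real ((n2 y)\<^sup>2)"
    unfolding v_def act_adjoint[OF a y x] y_def[symmetric] n2_sq[OF y] complex_norm_square[symmetric]
    by (simp add: of_real_power[symmetric] integral_complex_of_real del: of_real_power)
  define R where "R z = Re (v z * cnj (x z))" for z
  have ivx: "integrable M R" unfolding R_def using L2_inner[OF v x] by (rule integrable_Re)
  have re: "(LINT z|M. R z) = (n2 y)\<^sup>2"
    unfolding R_def using integral_Re[OF L2_inner[OF v x]] inner by simp
  have d: "(\<lambda>z. x z - of_real e * v z) \<in> L2"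
    using L2_add(1)[OF x L2_scale(1)[OF v, of "- of_real e"]] by simp
  have pt: "(cmod (x z - of_real e * v z))\<^sup>2 = (cmod (x z))\<^sup>2 - 2 * e * R z + e\<^sup>2 * (cmod (v z))\<^sup>2" for z
    unfolding cmod_power2 R_def by (simp add: power2_eq_square algebra_simps)
  have "(n2 (\<lambda>z. x z - of_real e * v z))\<^sup>2
    = (LINT z|M. (cmod (x z))\<^sup>2 - 2 * e * R z + e\<^sup>2 * (cmod (v z))\<^sup>2)"
    unfolding n2_sq[OF d] pt ..
  also have "\<dots> = (n2 x)\<^sup>2 - 2 * e * (n2 y)\<^sup>2 + e\<^sup>2 * (n2 v)\<^sup>2"
    using n2_sq_integrable[OF x] n2_sq_integrable[OF v] ivx
    by (simp add: n2_sq[OF x] n2_sq[OF v] re)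
  also have "e\<^sup>2 * (n2 v)\<^sup>2 \<le> e\<^sup>2 * (L * n2 y)\<^sup>2"
    using L[OF y] unfolding v_def by (intro mult_left_mono power_mono) auto
  also have "e\<^sup>2 * (L * n2 y)\<^sup>2 = e * (e * L\<^sup>2) * (n2 y)\<^sup>2" by (simp add: power2_eq_square algebra_simps)
  also have "\<dots> \<le> e * 1 * (n2 y)\<^sup>2" using e by (intro mult_right_mono mult_left_mono) auto
  finally have 1: "(n2 (\<lambda>z. x z - of_real e * v z))\<^sup>2 \<le> (n2 x)\<^sup>2 - e * (n2 y)\<^sup>2" by simp
  have "(n2 x)\<^sup>2 \<le> (Y * n2 y)\<^sup>2" using Y unfolding y_def by (intro power_mono) auto
  then have "(n2 x)\<^sup>2 / Y\<^sup>2 \<le> (n2 y)\<^sup>2" using Y by (simp add: divide_le_eq power_mult_distrib mult.commute)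
  then have "e * ((n2 x)\<^sup>2 / Y\<^sup>2) \<le> e * (n2 y)\<^sup>2" using e by (intro mult_left_mono) auto
  with 1 have "(n2 (\<lambda>z. x z - of_real e * v z))\<^sup>2 \<le> (n2 x)\<^sup>2 - e * ((n2 x)\<^sup>2 / Y\<^sup>2)" by linarith
  then show ?thesis by (simp add: v_def y_def algebra_simps)
qed

text \<open>The indicator function of a set of measure m has L^1 norm m but L^2 norm sqrt m, so
  Young's inequality bounds the ratio of the norms by \<open>n2 f * sqrt m\<close>. The choice of d
  makes this at most e; the 1 in it prevents a division by zero.\<close>

lemma almost_annihilated:
  assumes f: "f \<in> L2" and e: "0 < e"
  shows "\<exists>x\<in>L2. 0 < n2 x \<and> n2 (f \<star> x) \<le> e * n2 x"
proof -
  define d where "d = (e / (n2 f + 1))\<^sup>2"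
  have nf: "0 < n2 f + 1" using lpn_nonneg[of M 2 "\<lambda>x. cmod (f x)"] by linarith
  have d: "0 < d" using e nf by (simp add: d_def)
  obtain W where W: "W \<in> sets M" "0 < emeasure M W" "emeasure M W < ennreal d"
    using small_sets[OF d] by blast
  define m where "m = measure M W"
  have fin: "emeasure M W < \<infinity>" using W(3) by (auto intro: less_trans)
  have m: "emeasure M W = ennreal m" using fin by (simp add: m_def emeasure_eq_ennreal_measure)
  have m0: "0 < m" "m < d" using W m d by (auto simp: ennreal_less_iff)
  define x :: "'a \<Rightarrow> complex" where "x = (\<lambda>z. indicator W z)"
  have c: "cmod (x z) powr r = indicator W z" for z r by (simp add: x_def indicator_def)
  have [measurable]: "x \<in> borel_measurable M" unfolding x_def using W by measurable
  have i: "integrable M (indicator W :: 'a \<Rightarrow> real)" using W fin by (simp add: less_top)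
  have "lpint M r (\<lambda>z. cmod (x z))" for r unfolding lpint_def c using i by auto
  then have x: "x \<in> L2" "x \<in> L1" by (auto simp: L2_def L1_def)
  have n: "n2 x = m powr (1 / 2)" "n1 x = m" unfolding lpn_def c using m0 W by (simp_all add: m_def)
  have "n2 (f \<star> x) \<le> n2 f * m" using conv_L2'(2)[OF f x(2)] n by simp
  also have "m = m powr (1 / 2) * m powr (1 / 2)" using m0 by (simp add: powr_add[symmetric])
  also have "n2 f * (m powr (1 / 2) * m powr (1 / 2)) \<le> e * m powr (1 / 2)"
  proof -
    have "m powr (1 / 2) \<le> d powr (1 / 2)" using m0 by (intro powr_mono2) auto
    also have "d powr (1 / 2) = e / (n2 f + 1)" using e nf by (simp add: d_def powr_half_sqrt)
    finally have "(n2 f + 1) * m powr (1 / 2) \<le> e" using nf by (simp add: field_simps)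
    then have "n2 f * m powr (1 / 2) \<le> e" by (simp add: distrib_right) (smt (verit) powr_ge_zero)
    then show ?thesis using mult_right_mono[of "n2 f * m powr (1 / 2)" e "m powr (1 / 2)"] by (simp add: mult.assoc)
  qed
  finally have "n2 (f \<star> x) \<le> e * n2 x" by (simp add: n)
  moreover have "0 < n2 x" using m0 by (simp add: n)
  ultimately show ?thesis using x by blast
qed

text \<open>On functions almost annihilated by convolution with \<open>fst a\<close> the operator is
  nearly multiplication by \<open>snd a\<close>; upper and lower bounds of the operator therefore
  pass to this scalar.\<close>

lemma scalar_part_bounds:
  assumes a: "a \<in> pA"
  shows "(\<And>x. x \<in> L2 \<Longrightarrow> n2 (act a x) \<le> \<rho> * n2 x) \<Longrightarrow> cmod (snd a) \<le> \<rho>"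
    and "0 \<le> Y \<Longrightarrow> (\<And>x. x \<in> L2 \<Longrightarrow> n2 x \<le> Y * n2 (act a x)) \<Longrightarrow> 1 \<le> Y * cmod (snd a)"
proof -
  let ?f = "fst a" and ?t = "snd a"
  note f2 = pA_fst_L2[OF a]
  have tri: "cmod ?t * n2 x \<le> n2 (act a x) + n2 (?f \<star> x)" "n2 (act a x) \<le> n2 (?f \<star> x) + cmod ?t * n2 x"
    if x: "x \<in> L2" for x
  proof -
    have fx: "?f \<star> x \<in> L2" by (rule conv_L2(1)[OF pA_fst_L1[OF a] x])
    have eq: "?t * x z = act a x z + (- 1) * (?f \<star> x) z" for z by (simp add: act_def)
    have "n2 (\<lambda>z. ?t * x z) \<le> n2 (act a x) + n2 (?f \<star> x)"
      unfolding eq using L2_add(2)[OF act_L2(1)[OF a x] L2_scale(1)[OF fx, of "- 1"]] 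
      by (simp only: L2_scale(2)[OF fx] norm_minus_cancel norm_one mult_1_left)
    then show "cmod ?t * n2 x \<le> n2 (act a x) + n2 (?f \<star> x)" by (simp only: L2_scale(2)[OF x])
    show "n2 (act a x) \<le> n2 (?f \<star> x) + cmod ?t * n2 x"
      unfolding act_def using L2_add(2)[OF fx L2_scale(1)[OF x, of ?t]] by (simp only: L2_scale(2)[OF x])
  qed
  show "cmod ?t \<le> \<rho>" if H: "\<And>x. x \<in> L2 \<Longrightarrow> n2 (act a x) \<le> \<rho> * n2 x"
  proof (rule field_le_epsilon)
    fix e :: real assume "0 < e"
    then obtain x where x: "x \<in> L2" "0 < n2 x" "n2 (?f \<star> x) \<le> e * n2 x"
      using almost_annihilated[OF f2] by blast
    have "cmod ?t * n2 x \<le> (\<rho> + e) * n2 x"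
      using tri(1)[OF x(1)] H[OF x(1)] x(3) by (simp add: distrib_right)
    then show "cmod ?t \<le> \<rho> + e" using x(2) by simp
  qed
  show "1 \<le> Y * cmod ?t" if Y: "0 \<le> Y" and H: "\<And>x. x \<in> L2 \<Longrightarrow> n2 x \<le> Y * n2 (act a x)"
  proof (rule field_le_epsilon)
    fix e :: real assume e: "0 < e"
    have "0 < e / (Y + 1)" using e Y by simp
    then obtain x where x: "x \<in> L2" "0 < n2 x" "n2 (?f \<star> x) \<le> e / (Y + 1) * n2 x"
      using almost_annihilated[OF f2] by blast
    have "1 * n2 x \<le> Y * n2 (act a x)" using H[OF x(1)] by simp
    also have "\<dots> \<le> Y * (e / (Y + 1) * n2 x + cmod ?t * n2 x)"
      using tri(2)[OF x(1)] x(3) Y by (intro mult_left_mono) linarith+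
    also have "\<dots> = (Y * cmod ?t + Y / (Y + 1) * e) * n2 x" by (simp add: algebra_simps)
    finally have "1 \<le> Y * cmod ?t + Y / (Y + 1) * e" using x(2) by (simp only: mult_le_cancel_right_pos)
    also have "Y / (Y + 1) * e \<le> 1 * e" using Y e by (intro mult_right_mono) auto
    finally show "1 \<le> Y * cmod ?t + e" by simp
  qed
qed

end

section \<open>Faithfulness of convolution on L^2\<close>

context unimodular_group
begin

text \<open>The shear makes the convolution of h with the indicator of A appear as the inner
  integral, so equality of convolutions becomes equality of these measures on rectangles.\<close>

lemma emeasure_sheared_rectangle:
  assumes h [measurable]: "h \<in> borel_measurable M" and h0: "\<And>y. 0 \<le> h y"
    and sf: "sigma_finite_measure (density M (\<lambda>y. ennreal (h y)))"
    and AB [measurable]: "A \<in> sets M" "B \<in> sets M"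
  shows "emeasure (distr (density M (\<lambda>y. ennreal (h y)) \<Otimes>\<^sub>M M) (M \<Otimes>\<^sub>M M) (\<lambda>(y, z). (- y + z, z))) (A \<times> B)
    = (\<integral>\<^sup>+z. indicator B z * (\<integral>\<^sup>+y. ennreal (h y * indicator A (- y + z)) \<partial>M) \<partial>M)"
proof -
  let ?D = "density M (\<lambda>y. ennreal (h y))"
  interpret D: sigma_finite_measure ?D by (rule sf)
  interpret DM: pair_sigma_finite ?D M ..
  let ?f = "\<lambda>w. indicator A (- fst w + snd w) * indicator B (snd w) :: ennreal"
  have m: "(\<lambda>(y, z). (- y + z, z)) \<in> measurable (?D \<Otimes>\<^sub>M M) (M \<Otimes>\<^sub>M M)" by measurable
  have "emeasure (distr (?D \<Otimes>\<^sub>M M) (M \<Otimes>\<^sub>M M) (\<lambda>(y, z). (- y + z, z))) (A \<times> B)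
    = (\<integral>\<^sup>+w. indicator (A \<times> B) w \<partial>distr (?D \<Otimes>\<^sub>M M) (M \<Otimes>\<^sub>M M) (\<lambda>(y, z). (- y + z, z)))"
    by simp
  also have "\<dots> = (\<integral>\<^sup>+w. indicator (A \<times> B) (case w of (y, z) \<Rightarrow> (- y + z, z)) \<partial>(?D \<Otimes>\<^sub>M M))"
    by (rule nn_integral_distr[OF m]) measurable
  also have "\<dots> = (\<integral>\<^sup>+w. ?f w \<partial>(?D \<Otimes>\<^sub>M M))"
    by (intro nn_integral_cong) (auto simp: indicator_def split: prod.split)
  also have "\<dots> = (\<integral>\<^sup>+z. \<integral>\<^sup>+y. ?f (y, z) \<partial>?D \<partial>M)"
    by (rule DM.nn_integral_snd[symmetric]) measurable
  also have "\<dots> = (\<integral>\<^sup>+z. indicator B z * (\<integral>\<^sup>+y. ennreal (h y * indicator A (- y + z)) \<partial>M) \<partial>M)"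
  proof (rule nn_integral_cong)
    fix z
    have "(\<integral>\<^sup>+y. indicator A (- y + z) * indicator B z \<partial>?D)
      = (\<integral>\<^sup>+y. ennreal (h y) * (indicator A (- y + z) * indicator B z) \<partial>M)"
      by (rule nn_integral_density) measurable
    also have "\<dots> = (\<integral>\<^sup>+y. indicator B z * ennreal (h y * indicator A (- y + z)) \<partial>M)"
      by (intro nn_integral_cong) (auto simp: indicator_def)
    also have "\<dots> = indicator B z * (\<integral>\<^sup>+y. ennreal (h y * indicator A (- y + z)) \<partial>M)"
      by (rule nn_integral_cmult) measurable
    finally show "(\<integral>\<^sup>+y. ?f (y, z) \<partial>?D) = \<dots>" by simp
  qed
  finally show ?thesis .
qed

text \<open>Convolution with indicator functions determines the measure \<open>g dy \<otimes> dz\<close> after the shear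
  \<open>(y, z) \<mapsto> (- y + z, z)\<close>, which is invertible.\<close>

lemma conv_indicator_zero:
  fixes g :: "'a \<Rightarrow> real"
  assumes g: "integrable M g"
    and zero: "\<And>A. A \<in> sets M \<Longrightarrow> emeasure M A < \<infinity> \<Longrightarrow> AE z in M. (LINT y|M. g y * indicator A (- y + z)) = 0"
  shows "AE y in M. g y = 0"
proof -
  have [measurable]: "g \<in> borel_measurable M" using g by auto
  \<comment> \<open>Separating the positive and negative parts turns the vanishing of convolutions
    into the equality of two positive measures.\<close>
  define gp gm where "gp y = max (g y) 0" and "gm y = max (- g y) 0" for y
  have [measurable]: "gp \<in> borel_measurable M" "gm \<in> borel_measurable M" unfolding gp_def gm_def by measurable
  have gi: "integrable M gp" "integrable M gm" unfolding gp_def gm_def using g by auto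
  have g0: "0 \<le> gp y" "0 \<le> gm y" and gd: "g y = gp y - gm y" for y by (auto simp: gp_def gm_def)
  let ?D = "\<lambda>h. density M (\<lambda>y. ennreal (h y))"
  have fin: "finite_measure (?D h)" if "integrable M h" "\<And>y. 0 \<le> h y" for h
  proof (rule finite_measureI)
    have "UNIV \<in> sets M" using sets.top[of M] by (simp only: space_M)
    then have "emeasure (?D h) (space (?D h)) = (\<integral>\<^sup>+y. ennreal (h y) \<partial>M)"
      using that by (subst emeasure_density) auto
    also have "\<dots> \<noteq> \<infinity>" using that by (subst nn_integral_eq_integral) auto
    finally show "emeasure (?D h) (space (?D h)) \<noteq> \<infinity>" .
  qed
  interpret Dp: finite_measure "?D gp" by (rule fin[OF gi(1) g0(1)])
  interpret Dm: finite_measure "?D gm" by (rule fin[OF gi(2) g0(2)])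
  interpret DpM: pair_sigma_finite "?D gp" M ..
  interpret DmM: pair_sigma_finite "?D gm" M ..
  let ?S = "\<lambda>h. distr (?D h \<Otimes>\<^sub>M M) (M \<Otimes>\<^sub>M M) (\<lambda>(y, z). (- y + z, z))"
  have int: "integrable M (\<lambda>y. h y * indicator A (- y + z))"
    if "integrable M h" "A \<in> sets M" for h :: "'a \<Rightarrow> real" and A z
  proof (rule Bochner_Integration.integrable_bound[OF that(1)])
    show "(\<lambda>y. h y * indicator A (- y + z)) \<in> borel_measurable M"
      using that by measurable
  qed (auto simp: indicator_def)
  have rect: "emeasure (?S gp) (A \<times> B) = emeasure (?S gm) (A \<times> B)"
    if AB: "A \<in> sets M" "B \<in> sets M" "emeasure M A < \<infinity>" for A B
  proof -
    have "AE z in M. (\<integral>\<^sup>+y. ennreal (gp y * indicator A (- y + z)) \<partial>M) = (\<integral>\<^sup>+y. ennreal (gm y * indicator A (- y + z)) \<partial>M)"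
      using zero[OF AB(1,3)]
    proof eventually_elim
      fix z assume "(LINT y|M. g y * indicator A (- y + z)) = 0"
      then have "(LINT y|M. gp y * indicator A (- y + z)) = (LINT y|M. gm y * indicator A (- y + z))"
        using int[OF gi(1) AB(1), of z] int[OF gi(2) AB(1), of z] by (simp add: gd left_diff_distrib)
      then show "(\<integral>\<^sup>+y. ennreal (gp y * indicator A (- y + z)) \<partial>M) = (\<integral>\<^sup>+y. ennreal (gm y * indicator A (- y + z)) \<partial>M)"
        using int[OF gi(1) AB(1), of z] int[OF gi(2) AB(1), of z] g0 by (simp add: nn_integral_eq_integral)
    qed
    then show ?thesis
      by (subst (1 2) emeasure_sheared_rectangle)
        (auto intro!: nn_integral_cong_AE AB g0 Dp.sigma_finite_measure_axioms Dm.sigma_finite_measure_axioms elim!: eventually_mono)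
  qed
  obtain F :: "nat \<Rightarrow> 'a set" where F: "range F \<subseteq> sets M" "(\<Union>i. F i) = space M" "\<And>i. emeasure M (F i) \<noteq> \<infinity>" "incseq F"
    using sigma_finite_incseq by metis
  have eq: "?S gp = ?S gm"
  proof (rule measure_eqI_generator_eq)
    \<comment> \<open>The hypothesis concerns only sets A of finite measure, so the generator
      consists of rectangles whose first side has finite measure; by \<sigma>-finiteness it still
      generates the product.\<close>
    let ?E = "{A \<times> B | A B. A \<in> sets M \<and> B \<in> sets M \<and> emeasure M A < \<infinity>}"
    show "Int_stable ?E"
    proof (rule Int_stableI)
      fix a b assume "a \<in> ?E" "b \<in> ?E"
      then obtain A B A' B' where *: "a = A \<times> B" "b = A' \<times> B'" "A \<in> sets M" "B \<in> sets M" "A' \<in> sets M" "B' \<in> sets M" "emeasure M A < \<infinity>" by blast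
      have "emeasure M (A \<inter> A') < \<infinity>" using emeasure_mono[of "A \<inter> A'" A M] * by (auto intro: le_less_trans)
      moreover have "a \<inter> b = (A \<inter> A') \<times> (B \<inter> B')" using * by auto
      moreover have "A \<inter> A' \<in> sets M" "B \<inter> B' \<in> sets M" using * by auto
      ultimately show "a \<inter> b \<in> ?E" by blast
    qed
    show "?E \<subseteq> Pow UNIV" by simp
    show "emeasure (?S gp) X = emeasure (?S gm) X" if "X \<in> ?E" for X using that rect by auto
    have sets: "sets (M \<Otimes>\<^sub>M M) = sigma_sets UNIV ?E"
    proof -
      have "sigma_sets UNIV ?E = sigma_sets UNIV {a \<times> b | a b. a \<in> sets M \<and> b \<in> sets M}"
      proof (rule sigma_sets_eqI)
        fix X assume "X \<in> {a \<times> b | a b. a \<in> sets M \<and> b \<in> sets M}"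
        then obtain a b where X: "X = a \<times> b" "a \<in> sets M" "b \<in> sets M" by blast
        have "X = (\<Union>i. (a \<inter> F i) \<times> b)" using F(2) X by auto
        also have "\<dots> \<in> sigma_sets UNIV ?E"
        proof (rule sigma_sets_UNION)
          fix Y assume "Y \<in> range (\<lambda>i. (a \<inter> F i) \<times> b)"
          then obtain i where Y: "Y = (a \<inter> F i) \<times> b" by (elim imageE)
          have Fi: "F i \<in> sets M" using F(1) by auto
          have "emeasure M (a \<inter> F i) \<le> emeasure M (F i)" by (rule emeasure_mono[OF _ Fi]) simp
          also have "\<dots> < \<infinity>" using F(3)[of i] by (simp add: less_top)
          finally have "emeasure M (a \<inter> F i) < \<infinity>" .
          then show "Y \<in> sigma_sets UNIV ?E" unfolding Y
          proof (intro sigma_sets.Basic)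
            assume fin: "emeasure M (a \<inter> F i) < \<infinity>"
            have "a \<inter> F i \<in> sets M" using X(2) Fi by (rule sets.Int)
            with X(3) fin show "(a \<inter> F i) \<times> b \<in> ?E" by blast
          qed
        qed simp
        finally show "X \<in> sigma_sets UNIV ?E" .
      qed (auto intro!: sigma_sets.Basic)
      then show ?thesis by (simp add: sets_pair_measure)
    qed
    show "sets (?S gp) = sigma_sets UNIV ?E" "sets (?S gm) = sigma_sets UNIV ?E" using sets by simp_all
    show "range (\<lambda>i. F i \<times> F i) \<subseteq> ?E" using F(1,3) by (auto simp: less_top)
    show "(\<Union>i. F i \<times> F i) = UNIV"
    proof -
      have "\<exists>i. x \<in> F i \<and> y \<in> F i" for x y
      proof -
        obtain i j where "x \<in> F i" "y \<in> F j" using F(2) by (metis UNIV_I UN_iff space_M)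
        moreover have "F i \<subseteq> F (max i j)" "F j \<subseteq> F (max i j)" by (rule incseqD[OF F(4)], simp)+
        ultimately have "x \<in> F (max i j)" "y \<in> F (max i j)" by blast+
        then show ?thesis by blast
      qed
      then show ?thesis by auto
    qed
    show "emeasure (?S gp) (F i \<times> F i) \<noteq> \<infinity>" for i
    proof -
      have Fi: "F i \<in> sets M" using F(1) by auto
      have "emeasure (?S gp) (F i \<times> F i) = (\<integral>\<^sup>+z. indicator (F i) z * (\<integral>\<^sup>+y. ennreal (gp y * indicator (F i) (- y + z)) \<partial>M) \<partial>M)"
        by (rule emeasure_sheared_rectangle) (use Fi g0 Dp.sigma_finite_measure_axioms in auto)
      also have "\<dots> \<le> (\<integral>\<^sup>+z. indicator (F i) z * (\<integral>\<^sup>+y. ennreal (gp y) \<partial>M) \<partial>M)"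
        using g0 by (intro nn_integral_mono mult_left_mono) (auto simp: indicator_def)
      also have "\<dots> = emeasure M (F i) * (\<integral>\<^sup>+y. ennreal (gp y) \<partial>M)"
        using Fi by (simp add: nn_integral_multc)
      also have "\<dots> < \<infinity>"
        using gi(1) g0 F(3)[of i] by (simp add: nn_integral_eq_integral ennreal_mult_less_top less_top)
      finally show ?thesis by simp
    qed
  qed
  have unshear: "distr (?S h) (M \<Otimes>\<^sub>M M) (\<lambda>(a, z). (z + - a, z)) = distr (?D h \<Otimes>\<^sub>M M) (M \<Otimes>\<^sub>M M) (\<lambda>w. w)" for h
  proof -
    have id: "(\<lambda>(a, z). (z + - a, z)) \<circ> (\<lambda>(y, z). (- y + z, z)) = (\<lambda>w. w :: 'a \<times> 'a)"
    proof -
      have "b - (- a + b) = a" for a b :: 'a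
        by (simp only: diff_conv_add_uminus minus_add minus_minus add.assoc[symmetric] right_minus add_0)
      then show ?thesis by (auto simp: fun_eq_iff)
    qed
    show ?thesis by (subst distr_distr, measurable, simp only: id)
  qed
  have eq': "emeasure (?D gp \<Otimes>\<^sub>M M) X = emeasure (?D gm \<Otimes>\<^sub>M M) X" if "X \<in> sets (M \<Otimes>\<^sub>M M)" for X
  proof -
    have "emeasure (distr (?D gp \<Otimes>\<^sub>M M) (M \<Otimes>\<^sub>M M) (\<lambda>w. w)) X = emeasure (distr (?D gm \<Otimes>\<^sub>M M) (M \<Otimes>\<^sub>M M) (\<lambda>w. w)) X"
      unfolding unshear[symmetric] eq ..
    then show ?thesis using that by (simp add: emeasure_distr space_pair_measure)
  qed
  obtain \<Omega> where \<Omega>: "\<Omega> \<in> sets M" "0 < emeasure M {x. x + 0 \<in> \<Omega>}" "emeasure M {x. x + 0 \<in> \<Omega>} < \<infinity>"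
    using window by blast
  have "?D gp = ?D gm"
  proof (rule measure_eqI)
    fix C assume "C \<in> sets (?D gp)"
    then have C: "C \<in> sets M" by simp
    have "emeasure M \<Omega> * emeasure (?D gp) C = emeasure M \<Omega> * emeasure (?D gm) C"
      using eq'[of "C \<times> \<Omega>"] C \<Omega>(1)
      by (simp add: emeasure_pair_measure_Times mult.commute)
    then show "emeasure (?D gp) C = emeasure (?D gm) C"
      using \<Omega> by (auto simp: ennreal_mult_cancel_left)
  qed simp
  then have "AE y in M. ennreal (gp y) = ennreal (gm y)" by (intro density_unique) auto
  then show ?thesis by eventually_elim (simp add: gd g0)
qed

text \<open>Real and imaginary parts are tested separately on indicators of sets of finite measure.
  This is what makes the embedding into the operators injective on function parts.\<close>

lemma conv_faithful:
  assumes f: "f \<in> L1" and zero: "\<And>x. x \<in> L2 \<Longrightarrow> AE z in M. (f \<star> x) z = 0"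
  shows "AE z in M. f z = 0"
proof -
  have fi: "integrable M f"
    using L1_lpint[OF f] L1_measurable[OF f] by (simp add: lpint_1 integrable_norm_iff)
  have [measurable]: "f \<in> borel_measurable M" using fi by auto
  have z: "AE z in M. (LINT y|M. f y * indicator A (- y + z)) = 0"
    if A: "A \<in> sets M" "emeasure M A < \<infinity>" for A
  proof -
    let ?x = "\<lambda>z. indicator A z :: complex"
    have c: "cmod (?x z) powr 2 = indicator A z" for z by (simp add: indicator_def)
    have "lpint M 2 (\<lambda>z. cmod (?x z))" unfolding lpint_def c using A by (auto simp: less_top)
    then have "?x \<in> L2" using A by (simp add: L2_def)
    from zero[OF this] show ?thesis by (simp add: convolution_def)
  qed
  have int: "integrable M (\<lambda>y. f y * indicator A (- y + z))" if "A \<in> sets M" for A z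
  proof (rule Bochner_Integration.integrable_bound[OF fi])
    show "(\<lambda>y. f y * indicator A (- y + z)) \<in> borel_measurable M" using that by measurable
  qed (auto simp: indicator_def)
  have ind: "(indicator A w :: complex) = of_real (indicator A w)" for A and w :: 'a by (simp add: indicator_def)
  have "AE y in M. Re (f y) = 0"
  proof (rule conv_indicator_zero)
    show "AE z in M. (LINT y|M. Re (f y) * indicator A (- y + z)) = 0"
      if A: "A \<in> sets M" "emeasure M A < \<infinity>" for A
      using z[OF A]
    proof eventually_elim
      fix z assume *: "(LINT y|M. f y * indicator A (- y + z)) = 0"
      have "(LINT y|M. Re (f y) * indicator A (- y + z)) = (LINT y|M. Re (f y * indicator A (- y + z)))"
        by (simp add: ind)
      also have "\<dots> = 0" using * integral_Re[OF int[OF A(1)], of z] by simp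
      finally show "(LINT y|M. Re (f y) * indicator A (- y + z)) = 0" .
    qed
  qed (use fi in simp)
  moreover have "AE y in M. Im (f y) = 0"
  proof (rule conv_indicator_zero)
    show "AE z in M. (LINT y|M. Im (f y) * indicator A (- y + z)) = 0"
      if A: "A \<in> sets M" "emeasure M A < \<infinity>" for A
      using z[OF A]
    proof eventually_elim
      fix z assume *: "(LINT y|M. f y * indicator A (- y + z)) = 0"
      have "(LINT y|M. Im (f y) * indicator A (- y + z)) = (LINT y|M. Im (f y * indicator A (- y + z)))"
        by (simp add: ind)
      also have "\<dots> = 0" using * integral_Im[OF int[OF A(1)], of z] by simp
      finally show "(LINT y|M. Im (f y) * indicator A (- y + z)) = 0" .
    qed
  qed (use fi in simp)
  ultimately show ?thesis by eventually_elim (simp add: complex_eq_iff)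
qed

end

section \<open>The Neumann product\<close>

context weighted_group
begin

primrec dyadic_power :: "'a unitized \<Rightarrow> nat \<Rightarrow> 'a unitized" where
  "dyadic_power T 0 = T"
| "dyadic_power T (Suc k) = pmul (dyadic_power T k) (dyadic_power T k)"

text \<open>Multiplied out, this is the Neumann partial sum with 2 ^ k terms. The product form
  involves only dyadic powers, for which norm bounds are available.\<close>

primrec neumann_prod :: "'a unitized \<Rightarrow> nat \<Rightarrow> 'a unitized" where
  "neumann_prod T 0 = pone"
| "neumann_prod T (Suc k) = pmul (neumann_prod T k) (padd pone (dyadic_power T k))"

definition one_minus :: "'a unitized \<Rightarrow> 'a unitized" where
  "one_minus T = padd pone (pscale (- 1) T)"

text \<open>Adds the bounds for weighted norm, L^2 norm and scalar part; both recursions start at X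
  because \<open>N\<close> dominates both norms.\<close>

definition alg_bound :: "real \<Rightarrow> real \<Rightarrow> nat \<Rightarrow> real" where
  "alg_bound \<rho> X k = weighted_bound C0 \<eta> \<rho> X X k + L2_bound \<rho> X k + \<rho> ^ (2 ^ k)"

lemma alg_bound_nonneg: "0 \<le> \<rho> \<Longrightarrow> 0 \<le> X \<Longrightarrow> 0 \<le> alg_bound \<rho> X k"
  by (simp add: alg_bound_def weighted_bound_nonneg L2_bound_nonneg C0_nonneg)

lemma alg_bound_summable: "0 \<le> \<rho> \<Longrightarrow> \<rho> < 1 \<Longrightarrow> 0 \<le> X \<Longrightarrow> summable (alg_bound \<rho> X)"
  unfolding alg_bound_def
  by (intro summable_add weighted_bound_summable L2_bound_summable summable_power_two_power C0_nonneg \<eta>)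

context
  fixes T :: "'a unitized" and \<rho> X :: real
  assumes T: "T \<in> pA" and \<rho>: "0 \<le> \<rho>" "\<rho> < 1"
    and contr: "\<And>x. x \<in> L2 \<Longrightarrow> n2 (act T x) \<le> \<rho> * n2 x" and X: "N (fst T) \<le> X"
begin

lemma dyadic_power_pA: "dyadic_power T k \<in> pA"
  by (induction k) (simp_all add: T pmul_pA)

lemma neumann_prod_pA: "neumann_prod T k \<in> pA"
  by (induction k) (simp_all add: pone_pA pmul_pA padd_pA dyadic_power_pA)

lemma one_minus_pA: "one_minus (dyadic_power T k) \<in> pA"
  unfolding one_minus_def by (intro padd_pA pone_pA pscale_pA dyadic_power_pA)

lemma dyadic_power_contr: "x \<in> L2 \<Longrightarrow> n2 (act (dyadic_power T k) x) \<le> \<rho> ^ (2 ^ k) * n2 x"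
proof (induction k arbitrary: x)
  case 0
  then show ?case using contr by simp
next
  case (Suc k)
  have "n2 (act (dyadic_power T (Suc k)) x) = n2 (act (dyadic_power T k) (act (dyadic_power T k) x))"
    using Suc by (simp add: act_pmul dyadic_power_pA)
  also have "\<dots> \<le> \<rho> ^ (2 ^ k) * n2 (act (dyadic_power T k) x)" by (rule Suc.IH[OF act_L2(1)[OF dyadic_power_pA Suc.prems]])
  also have "\<dots> \<le> \<rho> ^ (2 ^ k) * (\<rho> ^ (2 ^ k) * n2 x)" using Suc \<rho> by (intro mult_left_mono) auto
  also have "\<dots> = \<rho> ^ (2 ^ Suc k) * n2 x"
    by (simp add: mult.assoc[symmetric] power_add[symmetric]) (simp add: mult_2)
  finally show ?case .
qed

lemma dyadic_power_snd: "cmod (snd (dyadic_power T k)) \<le> \<rho> ^ (2 ^ k)"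
  by (rule scalar_part_bounds(1)[OF dyadic_power_pA dyadic_power_contr])

lemma X_nonneg: "0 \<le> X" using X N_nonneg[of "fst T"] by linarith

lemma dyadic_power_fst_n2: "n2 (fst (dyadic_power T k)) \<le> L2_bound \<rho> X k"
proof (induction k)
  case 0
  then show ?case using X by (simp add: N_def)
next
  case (Suc k)
  let ?h = "fst (dyadic_power T k)" and ?t = "snd (dyadic_power T k)"
  have h: "?h \<in> L2" by (rule pA_fst_L2[OF dyadic_power_pA])
  have "n2 (fst (dyadic_power T (Suc k))) \<le> n2 (act (dyadic_power T k) ?h) + cmod ?t * n2 ?h"
    using L2_add(2)[OF act_L2(1)[OF dyadic_power_pA h] L2_scale(1)[OF h, of ?t]]
    unfolding dyadic_power.simps pmul_def fst_conv by (simp only: L2_scale(2)[OF h])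
  also have "\<dots> \<le> \<rho> ^ (2 ^ k) * n2 ?h + \<rho> ^ (2 ^ k) * n2 ?h"
    by (intro add_mono dyadic_power_contr[OF h] mult_right_mono dyadic_power_snd) simp
  also have "\<dots> \<le> 2 * \<rho> ^ (2 ^ k) * L2_bound \<rho> X k"
    using Suc \<rho> mult_left_mono[OF Suc, of "\<rho> ^ (2 ^ k)"] by simp
  finally show ?case by simp
qed

lemma dyadic_power_fst_P: "P (fst (dyadic_power T k)) \<le> weighted_bound C0 \<eta> \<rho> X X k"
proof (induction k)
  case 0
  then show ?case using X by (simp add: N_def)
next
  case (Suc k)
  let ?h = "fst (dyadic_power T k)" and ?t = "snd (dyadic_power T k)" and ?a = "weighted_bound C0 \<eta> \<rho> X X k" and ?b = "L2_bound \<rho> X k"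
  have h: "?h \<in> A" by (rule pA_fst[OF dyadic_power_pA])
  have a0: "0 \<le> ?a" and b0: "0 \<le> ?b" using \<rho> X_nonneg by (auto intro: weighted_bound_nonneg L2_bound_nonneg C0_nonneg)
  note hh = A_conv[OF h h] and th = A_scale[OF h, of ?t]
  have "P (fst (dyadic_power T (Suc k))) = P (\<lambda>z. (?h \<star> ?h) z + ?t * ?h z + ?t * ?h z)"
    by (simp add: pmul_def act_def)
  also have "\<dots> \<le> P (?h \<star> ?h) + cmod ?t * P ?h + cmod ?t * P ?h"
    using A_add(2)[OF A_add(1)[OF hh(1) th(1)] th(1)] A_add(2)[OF hh(1) th(1)] th(2) by linarith
  also have "\<dots> \<le> 2 * C0 * ?a powr (2 - \<eta>) * ?b powr \<eta> + \<rho> ^ (2 ^ k) * ?a + \<rho> ^ (2 ^ k) * ?a"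
  proof (intro add_mono)
    have q: "P ?h powr (1 - \<eta>) * P ?h = P ?h powr (2 - \<eta>)"
      by (cases "P ?h = 0") (auto simp: powr_diff power2_eq_square)
    have e: "C0 * (Q ?h * P ?h + P ?h * Q ?h) = 2 * C0 * (P ?h powr (1 - \<eta>) * P ?h) * n2 ?h powr \<eta>"
      by (simp add: algebra_simps)
    have "P (?h \<star> ?h) \<le> 2 * C0 * P ?h powr (2 - \<eta>) * n2 ?h powr \<eta>"
      using hh(2) unfolding e q .
    also have "\<dots> \<le> 2 * C0 * ?a powr (2 - \<eta>) * ?b powr \<eta>"
      using Suc dyadic_power_fst_n2[of k] C0_nonneg \<eta> by (intro mult_mono mult_left_mono powr_mono2) auto
    finally show "P (?h \<star> ?h) \<le> 2 * C0 * ?a powr (2 - \<eta>) * ?b powr \<eta>" .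
    show "cmod ?t * P ?h \<le> \<rho> ^ (2 ^ k) * ?a" "cmod ?t * P ?h \<le> \<rho> ^ (2 ^ k) * ?a"
      using Suc dyadic_power_snd[of k] \<rho> by (auto intro!: mult_mono)
  qed
  finally show ?case by simp
qed

lemma nrm_dyadic_power: "nrm (dyadic_power T k) \<le> alg_bound \<rho> X k"
proof -
  have "N (fst (dyadic_power T k)) \<le> P (fst (dyadic_power T k)) + n2 (fst (dyadic_power T k))" by (simp add: N_def)
  then show ?thesis
    using dyadic_power_fst_P[of k] dyadic_power_fst_n2[of k] dyadic_power_snd[of k] by (simp add: nrm_def alg_bound_def)
qed

text \<open>The unit is split off before the norm inequality for products is used: P_(k+1) = P_k +
  P_k T ^ (2 ^ k), so each step costs a factor 1 + K * \<open>alg_bound\<close>, at most an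
  exponential. Estimating P_k (1 + T ^ (2 ^ k)) as one product would cost a factor K every time,
  with no bound uniform in k when K > 1.\<close>

lemma nrm_neumann_prod: "nrm (neumann_prod T k) \<le> exp (K * (\<Sum>j<k. alg_bound \<rho> X j))"
proof (induction k)
  case 0
  then show ?case by (simp add: nrm_def pone_def N_zero)
next
  case (Suc k)
  let ?P = "neumann_prod T k" and ?T = "dyadic_power T k"
  have eq: "neumann_prod T (Suc k) = padd ?P (pmul ?P ?T)"
    using pmul_padd[OF neumann_prod_pA pone_pA dyadic_power_pA, of k k] by (simp add: pmul_one)
  have "nrm (neumann_prod T (Suc k)) \<le> nrm ?P + K * nrm ?P * nrm ?T"
    unfolding eq using nrm_padd[OF neumann_prod_pA pmul_pA[OF neumann_prod_pA dyadic_power_pA]] nrm_pmul[OF neumann_prod_pA dyadic_power_pA]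
    by (meson add_left_mono order_trans)
  also have "\<dots> \<le> nrm ?P + K * nrm ?P * alg_bound \<rho> X k"
    using nrm_dyadic_power[of k] K_ge_1 by (intro add_left_mono mult_left_mono) auto
  also have "\<dots> = nrm ?P * (1 + K * alg_bound \<rho> X k)" by (simp add: algebra_simps)
  also have "\<dots> \<le> exp (K * (\<Sum>j<k. alg_bound \<rho> X j)) * exp (K * alg_bound \<rho> X k)"
    using Suc K_ge_1 alg_bound_nonneg[OF \<rho>(1) X_nonneg, of k] exp_ge_add_one_self[of "K * alg_bound \<rho> X k"]
    by (intro mult_mono) auto
  also have "\<dots> = exp (K * (\<Sum>j<Suc k. alg_bound \<rho> X j))" by (simp add: exp_add[symmetric] distrib_left)
  finally show ?case .
qed

lemma nrm_neumann_prod_le: "nrm (neumann_prod T k) \<le> exp (K * (\<Sum>j. alg_bound \<rho> X j))"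
proof -
  have "(\<Sum>j<k. alg_bound \<rho> X j) \<le> (\<Sum>j. alg_bound \<rho> X j)"
    using alg_bound_summable[OF \<rho> X_nonneg] alg_bound_nonneg[OF \<rho>(1) X_nonneg] by (intro sum_le_suminf) auto
  then show ?thesis using nrm_neumann_prod[of k] K_ge_1
    by (meson exp_le_cancel_iff mult_left_mono order_trans zero_le_one)
qed

lemma dyadic_power_commute: "pmul (dyadic_power T k) T = pmul T (dyadic_power T k)"
proof (induction k)
  case (Suc k)
  let ?t = "dyadic_power T k"
  have "pmul (pmul ?t ?t) T = pmul ?t (pmul T ?t)" by (simp add: pmul_assoc dyadic_power_pA T Suc)
  also have "\<dots> = pmul (pmul T ?t) ?t" by (simp add: pmul_assoc[symmetric] dyadic_power_pA T Suc)
  also have "\<dots> = pmul T (pmul ?t ?t)" by (simp add: pmul_assoc dyadic_power_pA T)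
  finally show ?case by simp
qed simp

text \<open>The new factor 1 + t, with t the dyadic power, commutes with 1 - T, so 1 - T can be
  moved next to the product already treated; what remains is (1 - t) (1 + t) = 1 - t^2.\<close>

lemma telescope: "pmul (neumann_prod T k) (one_minus T) = one_minus (dyadic_power T k)"
proof (induction k)
  case 0
  then show ?case by (simp add: pmul_one)
next
  case (Suc k)
  let ?t = "dyadic_power T k" and ?P = "neumann_prod T k"
  note mem = dyadic_power_pA[of k] neumann_prod_pA[of k] pone_pA T one_minus_pA[of k] one_minus_pA[of 0, unfolded dyadic_power.simps]
  have E0: "pmul (padd pone ?t) (one_minus T) = pmul (one_minus T) (padd pone ?t)"
  proof -
    have "pmul (padd pone ?t) (one_minus T) = padd (one_minus T) (padd ?t (pscale (- 1) (pmul ?t T)))"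
      using mem by (simp add: padd_pmul pmul_one, simp add: one_minus_def pmul_padd pscale_pA pmul_one pscale_pmul)
    also have "\<dots> = pmul (one_minus T) (padd pone ?t)"
      unfolding dyadic_power_commute using mem
      by (simp add: pmul_padd pmul_one, simp add: one_minus_def padd_pmul pscale_pA pmul_one pscale_pmul)
    finally show ?thesis .
  qed
  have "pmul (neumann_prod T (Suc k)) (one_minus T) = pmul ?P (pmul (padd pone ?t) (one_minus T))"
    using mem by (simp add: pmul_assoc padd_pA)
  also have "\<dots> = pmul (pmul ?P (one_minus T)) (padd pone ?t)"
    unfolding E0 using mem by (simp add: pmul_assoc padd_pA)
  also have "\<dots> = padd (one_minus ?t) (pmul (one_minus ?t) ?t)"
    unfolding Suc using mem by (simp add: pmul_padd pmul_one)
  also have "pmul (one_minus ?t) ?t = padd ?t (pscale (- 1) (pmul ?t ?t))"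
    using mem by (simp add: one_minus_def padd_pmul pscale_pA pmul_one pscale_pmul)
  also have "padd (one_minus ?t) \<dots> = one_minus (dyadic_power T (Suc k))"
    by (simp add: one_minus_def padd_def pscale_def)
  finally show ?case .
qed

end

section \<open>Quantitative inversion at the level of functions\<close>

lemma act_cong_AE:
  assumes a: "a \<in> pA" and [measurable]: "x \<in> borel_measurable M" "y \<in> borel_measurable M"
    and ae: "AE z in M. x z = y z"
  shows "AE z in M. act a x z = act a y z"
proof -
  have [measurable]: "fst a \<in> borel_measurable M" using A_measurable[OF pA_fst[OF a]] .
  have eq: "fst a \<star> x = fst a \<star> y" by (rule conv_cong_AE) (use ae in auto)
  show ?thesis using ae by eventually_elim (simp add: act_def eq)
qed

text \<open>Bounds the operator norm of an element of norm X, by \<open>act_L2\<close>. The added 1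
  keeps it at least 1, so that its inverse square e is at most 1.\<close>

definition op_bound :: "real \<Rightarrow> real" where
  "op_bound X = (C0 / c + 1) * X + 1"

text \<open>The square root of the factor 1 - e / Y^2 from \<open>contraction\<close>, with e the
  inverse square of \<open>op_bound X\<close>; truncation keeps it nonnegative for all
  arguments.\<close>

definition rate :: "real \<Rightarrow> real \<Rightarrow> real" where
  "rate X Y = sqrt (max 0 (1 - 1 / (op_bound X)\<^sup>2 / Y\<^sup>2))"

text \<open>The first summand bounds the function part of the inverse through the norms of e P_k a*,
  where e \<le> 1 and K * X^2 bounds the function part of T. The summand Y bounds its scalar part 1
  / t.\<close>

definition control :: "real \<Rightarrow> real \<Rightarrow> real" where
  "control X Y = K * exp (K * (\<Sum>k. alg_bound (rate X Y) (K * X\<^sup>2) k)) * X + Y"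

lemma one_minus_one_minus: "one_minus (one_minus a) = a"
  by (simp add: one_minus_def padd_def pscale_def pone_def)

lemma act_one_minus: "a \<in> pA \<Longrightarrow> x \<in> L2 \<Longrightarrow> act (one_minus a) x = (\<lambda>z. x z - act a x z)"
  unfolding one_minus_def by (simp add: act_padd pone_pA pscale_pA act_pone act_pscale)

text \<open>The elements \<open>B k\<close>, that is e P_k a*, satisfy B_k a = 1 - T ^ (2 ^ k):
  approximate left inverses with bounded algebra norms. Their limit is explicit: for a = (f, t) it
  is (- w / t, 1 / t), where surjectivity supplies w with a w = f. The last clause says that b
  undoes a on L^2.\<close>

lemma norm_control:
  assumes a: "a \<in> pA" and Y: "0 \<le> Y"
    and below: "\<And>x. x \<in> L2 \<Longrightarrow> n2 x \<le> Y * n2 (act a x)"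
    and onto: "\<And>x. x \<in> L2 \<Longrightarrow> \<exists>w\<in>L2. AE z in M. act a w z = x z"
  shows "\<exists>b\<in>pA. nrm b \<le> control (nrm a) Y \<and>
    (\<forall>x\<in>L2. \<forall>w\<in>L2. (AE z in M. act a w z = x z) \<longrightarrow> (AE z in M. act b x z = w z))"
proof -
  define f t where "f = fst a" and "t = snd a"
  have t1: "1 \<le> Y * cmod t" unfolding t_def by (rule scalar_part_bounds(2)[OF a Y below])
  have Ypos: "0 < Y" and tpos: "0 < cmod t" using t1 Y by (auto simp: less_le)
  then have t0: "t \<noteq> 0" by auto
  define X where "X = nrm a"
  define L where "L = op_bound X"
  \<comment> \<open>The largest e that \<open>contraction\<close> admits for the operator bound
    L.\<close>
  define e where "e = 1 / L\<^sup>2"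
  have k0: "0 \<le> C0 / c" using C0_nonneg c by simp
  have L1: "1 \<le> L" unfolding L_def op_bound_def X_def using k0 by simp
  then have e: "0 < e" "e * L\<^sup>2 \<le> 1" "e \<le> 1" by (auto simp: e_def divide_le_eq one_le_power)
  define \<rho> where "\<rho> = rate X Y"
  have \<rho>: "0 \<le> \<rho>" "\<rho> < 1"
    using e Ypos unfolding \<rho>_def rate_def L_def[symmetric] e_def[symmetric] by auto
  have \<rho>2: "1 - e / Y\<^sup>2 \<le> \<rho>\<^sup>2"
    unfolding \<rho>_def rate_def L_def[symmetric] e_def[symmetric] by simp
  note sa = pstar_pA[OF a]
  define Z where "Z = pscale (of_real e) (pmul (pstar a) a)"
  have Z: "Z \<in> pA" unfolding Z_def by (intro pscale_pA pmul_pA sa a)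
  define T where "T = one_minus Z"
  have T: "T \<in> pA" unfolding T_def one_minus_def by (intro padd_pA pone_pA pscale_pA Z)
  have contr: "n2 (act T x) \<le> \<rho> * n2 x" if x: "x \<in> L2" for x
  proof -
    have Lb: "n2 (act (pstar a) y) \<le> L * n2 y" if "y \<in> L2" for y
      using act_L2(2)[OF sa that] mult_right_mono[of "(C0 / c + 1) * X" L "n2 y"]
      by (simp add: nrm_pstar[OF a] X_def[symmetric] L_def op_bound_def)
    have "act T x = (\<lambda>z. x z - of_real e * act (pstar a) (act a x) z)"
      unfolding T_def Z_def act_one_minus[OF Z[unfolded Z_def] x] act_pscale act_pmul[OF sa a x] ..
    then have "(n2 (act T x))\<^sup>2 \<le> (1 - e / Y\<^sup>2) * (n2 x)\<^sup>2"
      using contraction[OF a x e(1,2) Lb Ypos below[OF x]] by simp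
    also have "\<dots> \<le> \<rho>\<^sup>2 * (n2 x)\<^sup>2" using \<rho>2 by (intro mult_right_mono) auto
    finally show ?thesis using \<rho> by (simp add: power_mult_distrib[symmetric] power2_le_iff_abs_le)
  qed
  define X0 where "X0 = K * X\<^sup>2"
  have X0: "N (fst T) \<le> X0"
  proof -
    have "N (fst T) = e * N (fst (pmul (pstar a) a))"
      using A_scale(3)[OF pA_fst[OF pmul_pA[OF sa a]], of "- of_real e"] e
      by (simp add: T_def Z_def one_minus_def padd_def pscale_def pone_def)
    also have "\<dots> \<le> 1 * nrm (pmul (pstar a) a)" using e by (intro mult_mono) (auto simp: nrm_def)
    also have "\<dots> \<le> K * X * X" using nrm_pmul[OF sa a] by (simp add: nrm_pstar[OF a] X_def)
    finally show ?thesis by (simp add: X0_def power2_eq_square)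
  qed
  note N = T \<rho> contr X0
  define H where "H = K * exp (K * (\<Sum>k. alg_bound \<rho> X0 k)) * X"
  define B where "B k = pscale (of_real e) (pmul (neumann_prod T k) (pstar a))" for k
  note Pk = neumann_prod_pA[OF N] and Tk = dyadic_power_pA[OF N]
  have B: "B k \<in> pA" for k unfolding B_def by (intro pscale_pA pmul_pA Pk sa)
  have BH: "nrm (B k) \<le> H" for k
  proof -
    have "nrm (B k) = e * nrm (pmul (neumann_prod T k) (pstar a))"
      unfolding B_def using e by (simp add: nrm_pscale[OF pmul_pA[OF Pk sa]])
    also have "\<dots> \<le> 1 * (K * nrm (neumann_prod T k) * X)"
      using e nrm_pmul[OF Pk sa, of k] K_ge_1 by (intro mult_mono) (auto simp: nrm_pstar[OF a] X_def)
    also have "\<dots> \<le> H"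
      unfolding H_def using nrm_neumann_prod_le[OF N, of k] K_ge_1
      by (simp add: X_def) (intro mult_right_mono mult_left_mono; simp)
    finally show ?thesis .
  qed
  have BHf: "N (fst (B k)) \<le> H" for k using BH[of k] by (simp add: nrm_def) (smt (verit) norm_ge_zero)
  have Ba: "pmul (B k) a = one_minus (dyadic_power T k)" for k
  proof -
    have "pmul (B k) a = pmul (neumann_prod T k) Z"
      unfolding B_def Z_def by (simp add: pscale_pmul pmul_assoc[OF Pk sa a])
    also have "\<dots> = pmul (neumann_prod T k) (one_minus T)" by (simp add: T_def one_minus_one_minus)
    also have "\<dots> = one_minus (dyadic_power T k)" by (rule telescope[OF N])
    finally show ?thesis .
  qed
  have act_B: "AE z in M. act (B k) x z = w z - act (dyadic_power T k) w z"
    if x: "x \<in> L2" and w: "w \<in> L2" and xw: "AE z in M. act a w z = x z" for x w k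
  proof -
    note [measurable] = L2_measurable[OF x] L2_measurable[OF act_L2(1)[OF a w]]
    have ae: "AE z in M. act (B k) (act a w) z = act (B k) x z"
      by (rule act_cong_AE[OF B]) (use xw in auto)
    have eq: "act (B k) (act a w) = (\<lambda>z. w z - act (dyadic_power T k) w z)"
      unfolding act_pmul[OF B a w, symmetric] Ba by (rule act_one_minus[OF Tk w])
    show ?thesis using ae unfolding eq by eventually_elim simp
  qed
  have f2: "f \<in> L2" unfolding f_def by (rule pA_fst_L2[OF a])
  obtain w where w: "w \<in> L2" and wf: "AE z in M. act a w z = f z" using onto[OF f2] by (elim bexE) (rule that)
  \<comment> \<open>Comparing function parts in \<open>Ba\<close> gives act (B k) f + t * g_k = -
    fst (T ^ (2 ^ k)), where g_k is the function part of B k, and \<open>act_B\<close> gives act (B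
    k) f = w - T ^ (2 ^ k) w. Everything involving the dyadic power tends to 0 in L^2, so g_k tends
    to - w / t.\<close>
  define q where "q = (\<lambda>z. (- 1 / t) * w z)"
  have q2: "q \<in> L2" unfolding q_def by (rule L2_scale(1)[OF w])
  define g where "g k = fst (B k)" for k
  have gA: "g k \<in> A" and g2: "g k \<in> L2" for k unfolding g_def using pA_fst[OF B] pA_fst_L2[OF B] by auto
  have gq: "AE z in M. g k z + (- 1) * q z
    = (- 1 / t) * (fst (dyadic_power T k) z + (- 1) * act (dyadic_power T k) w z)" for k
  proof -
    have s: "act (B k) f z + t * g k z = - fst (dyadic_power T k) z" for z
      using arg_cong[OF Ba[of k], of "\<lambda>b. fst b z"]
      by (simp add: pmul_def f_def t_def g_def one_minus_def padd_def pscale_def pone_def)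
    have g_eq: "g k z = (- 1 / t) * (fst (dyadic_power T k) z + act (B k) f z)" for z
    proof -
      have "fst (dyadic_power T k) z = - (act (B k) f z + t * g k z)" using s[of z] by simp
      then have e: "fst (dyadic_power T k) z + act (B k) f z = - (t * g k z)" by simp
      show ?thesis unfolding e using t0 by simp
    qed
    show ?thesis
      using act_B[OF f2 w wf, of k]
    proof eventually_elim
      fix z assume *: "act (B k) f z = w z - act (dyadic_power T k) w z"
      show "g k z + (- 1) * q z = (- 1 / t) * (fst (dyadic_power T k) z + (- 1) * act (dyadic_power T k) w z)"
        unfolding g_eq q_def * by (simp add: algebra_simps)
    qed
  qed
  have r0: "(\<lambda>k. \<rho> ^ (2 ^ k)) \<longlonglongrightarrow> 0"
    by (rule summable_LIMSEQ_zero[OF summable_power_two_power[OF \<rho>]])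
  have b0: "L2_bound \<rho> X0 \<longlonglongrightarrow> 0"
    by (rule summable_LIMSEQ_zero[OF L2_bound_summable[OF \<rho> X_nonneg[OF N]]])
  have d2: "(\<lambda>z. g k z + (- 1) * q z) \<in> L2" for k by (intro L2_add(1) L2_scale(1) g2 q2)
  have gq_le: "n2 (\<lambda>z. g k z + (- 1) * q z) \<le> 1 / cmod t * (L2_bound \<rho> X0 k + \<rho> ^ (2 ^ k) * n2 w)" for k
  proof -
    note h2 = pA_fst_L2[OF Tk[of k]] and tw2 = act_L2(1)[OF Tk w, of k]
    note s2 = L2_scale[OF tw2, of "- 1"]
    note ad = L2_add[OF h2 s2(1)]
    note sc = L2_scale[OF ad(1), of "- 1 / t"]
    have "n2 (\<lambda>z. g k z + (- 1) * q z) = n2 (\<lambda>z. (- 1 / t) * (fst (dyadic_power T k) z + (- 1) * act (dyadic_power T k) w z))"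
      by (rule lpn_cong_AE)
        (use L2_measurable[OF d2] L2_measurable[OF sc(1)] gq[of k] in \<open>auto elim!: eventually_mono intro: borel_measurable_norm\<close>)
    also have "\<dots> = 1 / cmod t * n2 (\<lambda>z. fst (dyadic_power T k) z + (- 1) * act (dyadic_power T k) w z)"
      using sc(2) by (simp only: norm_divide norm_minus_cancel norm_one)
    also have "\<dots> \<le> 1 / cmod t * (L2_bound \<rho> X0 k + \<rho> ^ (2 ^ k) * n2 w)"
    proof (rule mult_left_mono)
      have "n2 (\<lambda>z. (- 1) * act (dyadic_power T k) w z) = n2 (act (dyadic_power T k) w)"
        unfolding s2(2) by simp
      then show "n2 (\<lambda>z. fst (dyadic_power T k) z + (- 1) * act (dyadic_power T k) w z) \<le> L2_bound \<rho> X0 k + \<rho> ^ (2 ^ k) * n2 w"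
        using ad(2) dyadic_power_fst_n2[OF N, of k] dyadic_power_contr[OF N w, of k] by linarith
    qed simp
    finally show ?thesis .
  qed
  have gq0: "(\<lambda>k. n2 (\<lambda>z. g k z + (- 1) * q z)) \<longlonglongrightarrow> 0"
  proof (rule Lim_null_comparison)
    have "(\<lambda>k. 1 / cmod t * (L2_bound \<rho> X0 k + \<rho> ^ (2 ^ k) * n2 w)) \<longlonglongrightarrow> 1 / cmod t * (0 + 0 * n2 w)"
      by (intro tendsto_intros b0 r0)
    then show "(\<lambda>k. 1 / cmod t * (L2_bound \<rho> X0 k + \<rho> ^ (2 ^ k) * n2 w)) \<longlonglongrightarrow> 0" by simp
    show "\<forall>\<^sub>F k in sequentially. norm (n2 (\<lambda>z. g k z + (- 1) * q z))
        \<le> 1 / cmod t * (L2_bound \<rho> X0 k + \<rho> ^ (2 ^ k) * n2 w)"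
      by (rule always_eventually, rule allI, simp only: real_norm_def abs_of_nonneg lpn_nonneg gq_le)
  qed
  \<comment> \<open>Fatou's lemma needs convergence almost everywhere, which L^2 convergence
    provides along a subsequence.\<close>
  obtain r where r: "strict_mono r" "AE z in M. (\<lambda>n. g (r n) z + (- 1) * q z) \<longlonglongrightarrow> 0"
    using L2_convergence_AE_subseq[OF L2_lpint[OF d2] gq0] by blast
  have gr: "AE z in M. (\<lambda>n. cmod (g (r n) z)) \<longlonglongrightarrow> cmod (q z)"
    using r(2)
  proof eventually_elim
    fix z assume "(\<lambda>n. g (r n) z + (- 1) * q z) \<longlonglongrightarrow> 0"
    then have "(\<lambda>n. (g (r n) z + (- 1) * q z) + q z) \<longlonglongrightarrow> 0 + q z" by (intro tendsto_intros)
    then show "(\<lambda>n. cmod (g (r n) z)) \<longlonglongrightarrow> cmod (q z)" by (intro tendsto_norm) simp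
  qed
  note [measurable] = L2_measurable[OF q2]
  have HP: "P (g k) \<le> H" and Hn: "n2 (g k) \<le> H" for k using BHf[of k] by (auto simp: N_def g_def)
  have lim_p: "AE z in M. (\<lambda>n. cmod (g (r n) z) * \<omega> z) \<longlonglongrightarrow> cmod (q z) * \<omega> z"
    using gr by eventually_elim (rule tendsto_mult_right)
  have fp: "lpint M p (\<lambda>z. cmod (q z) * \<omega> z)" "P q \<le> H"
    unfolding P_def
    by (rule lpn_fatou[OF A_lpint[OF gA] HP[unfolded P_def] _ _ _ lim_p]; use p \<omega>_pos in \<open>auto simp: less_imp_le\<close>)+
  have nq: "n2 q \<le> H"
    by (rule lpn_fatou(2)[OF L2_lpint[OF g2] Hn _ _ _ gr]) auto
  have qA: "q \<in> A" using fp(1) q2 by (auto simp: A_def L2_def)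
  define b where "b = (q, 1 / t)"
  have b: "b \<in> pA" using qA by (simp add: b_def pA_def)
  have "nrm b \<le> H + Y"
  proof -
    have "1 / cmod t \<le> Y" using t1 tpos by (simp add: divide_le_eq)
    then show ?thesis using fp(2) nq by (simp add: nrm_def b_def N_def norm_divide)
  qed
  then have nb: "nrm b \<le> control (nrm a) Y"
    by (simp add: control_def H_def X_def X0_def \<rho>_def)
  \<comment> \<open>Passage to the limit in \<open>act_B\<close>: the left-hand side converges at
    every point, by the uniform bound for convolutions of L^2 functions, and the right-hand side
    almost everywhere along a subsequence.\<close>
  have "AE z in M. act b x z = v z"
    if x: "x \<in> L2" and v: "v \<in> L2" and xv: "AE z in M. act a v z = x z" for x v
  proof -
    have lim_conv: "(\<lambda>k. (g k \<star> x) z) \<longlonglongrightarrow> (q \<star> x) z" for z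
    proof (rule Lim_null_comparison[THEN LIM_zero_cancel])
      show "\<forall>\<^sub>F k in sequentially. norm ((g k \<star> x) z - (q \<star> x) z) \<le> n2 (\<lambda>z. g k z + (- 1) * q z) * n2 x"
      proof (rule always_eventually, rule allI)
        fix k
        have "(g k \<star> x) z - (q \<star> x) z = ((\<lambda>z. g k z + (- 1) * q z) \<star> x) z"
          unfolding conv_add_left[OF g2 L2_scale(1)[OF q2] x] conv_scale_left by simp
        then show "norm ((g k \<star> x) z - (q \<star> x) z) \<le> n2 (\<lambda>z. g k z + (- 1) * q z) * n2 x"
          using conv_bound[OF d2 x] by simp
      qed
      show "(\<lambda>k. n2 (\<lambda>z. g k z + (- 1) * q z) * n2 x) \<longlonglongrightarrow> 0"
        using tendsto_mult_right[OF gq0, of "n2 x"] by simp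
    qed
    have "snd (B k) = (1 - snd (dyadic_power T k)) / t" for k
      using arg_cong[OF Ba[of k], of snd] t0
      by (simp add: pmul_def t_def one_minus_def padd_def pscale_def pone_def field_simps)
    moreover have "(\<lambda>k. snd (dyadic_power T k)) \<longlonglongrightarrow> 0"
      by (rule Lim_null_comparison[OF _ r0]) (use dyadic_power_snd[OF N] in simp)
    then have "(\<lambda>k. (1 - snd (dyadic_power T k)) / t) \<longlonglongrightarrow> (1 - 0) / t"
      by (intro tendsto_intros t0)
    ultimately have lim_snd: "(\<lambda>k. snd (B k)) \<longlonglongrightarrow> 1 / t" by simp
    have lim: "(\<lambda>k. act (B k) x z) \<longlonglongrightarrow> act b x z" for z
      unfolding act_def b_def fst_conv snd_conv using lim_conv[of z] unfolding g_def
      by (intro tendsto_intros lim_snd)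
    have "(\<lambda>k. n2 (act (dyadic_power T k) v)) \<longlonglongrightarrow> 0"
    proof (rule Lim_null_comparison)
      show "(\<lambda>k. \<rho> ^ (2 ^ k) * n2 v) \<longlonglongrightarrow> 0" using tendsto_mult_right[OF r0, of "n2 v"] by simp
      show "\<forall>\<^sub>F k in sequentially. norm (n2 (act (dyadic_power T k) v)) \<le> \<rho> ^ (2 ^ k) * n2 v"
        using dyadic_power_contr[OF N v] by (intro always_eventually allI) simp
    qed
    then obtain r' where r': "strict_mono r'" "AE z in M. (\<lambda>n. act (dyadic_power T (r' n)) v z) \<longlonglongrightarrow> 0"
      using L2_convergence_AE_subseq[of M "\<lambda>k. act (dyadic_power T k) v"] L2_lpint[OF act_L2(1)[OF Tk v]] by blast
    have "AE z in M. \<forall>k. act (B k) x z = v z - act (dyadic_power T k) v z"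
      using act_B[OF x v xv] by (simp add: AE_all_countable)
    then show ?thesis using r'(2)
    proof eventually_elim
      fix z assume *: "\<forall>k. act (B k) x z = v z - act (dyadic_power T k) v z"
        and "(\<lambda>n. act (dyadic_power T (r' n)) v z) \<longlonglongrightarrow> 0"
      then have "(\<lambda>n. v z - act (dyadic_power T (r' n)) v z) \<longlonglongrightarrow> v z - 0" by (intro tendsto_intros)
      then have "(\<lambda>n. act (B (r' n)) x z) \<longlonglongrightarrow> v z" using * by simp
      moreover have "(\<lambda>n. act (B (r' n)) x z) \<longlonglongrightarrow> act b x z"
        using LIMSEQ_subseq_LIMSEQ[OF lim r'(1)] by (simp add: comp_def)
      ultimately show "act b x z = v z" by (rule LIMSEQ_unique[symmetric])
    qed
  qed
  with b nb show ?thesis by blast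
qed

lemma control_nonneg:
  assumes "0 \<le> X" "0 \<le> Y"
  shows "0 \<le> control X Y"
  unfolding control_def using assms K_ge_1 by (intro add_nonneg_nonneg mult_nonneg_nonneg) auto

end

section \<open>Passage to classes of functions\<close>

context haar_group
begin

abbreviation \<mu> :: "'a measure" where
  "\<mu> \<equiv> completion \<nu>"

lemma BM_measurable_iff: "f \<in> measurable BM N \<longleftrightarrow> f \<in> measurable baire N"
  by (simp only: measurable_cong_sets[OF sets_BM refl])

lemma BM_measurable_nu:
  assumes "f \<in> borel_measurable BM"
  shows "f \<in> borel_measurable \<nu>"
  using measurable_compose[OF id_nu_baire assms[unfolded BM_measurable_iff]] .

lemma BM_measurable_mu: "f \<in> borel_measurable BM \<Longrightarrow> f \<in> borel_measurable \<mu>"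
  by (intro measurable_completion BM_measurable_nu)

lemma AE_BM_iff: "{x. Q x} \<in> sets baire \<Longrightarrow> (AE x in BM. Q x) \<longleftrightarrow> (AE x in \<nu>. Q x)"
  unfolding BM_def by (rule AE_distr_iff[OF id_nu_baire]) simp

lemma AE_eq_BM_iff:
  fixes f g :: "'a \<Rightarrow> 'b::{second_countable_topology, t2_space}"
  assumes [measurable]: "f \<in> borel_measurable BM" "g \<in> borel_measurable BM"
  shows "(AE x in BM. f x = g x) \<longleftrightarrow> (AE x in \<nu>. f x = g x)"
proof (rule AE_BM_iff)
  have "{x \<in> space BM. f x = g x} \<in> sets BM" by measurable
  then show "{x. f x = g x} \<in> sets baire" by simp
qed

lemma integral_BM:
  fixes f :: "'a \<Rightarrow> 'b::{banach, second_countable_topology}"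
  assumes f: "f \<in> borel_measurable BM"
  shows "integrable \<mu> f \<longleftrightarrow> integrable BM f" "(LINT x|\<mu>. f x) = (LINT x|BM. f x)"
proof -
  have f': "f \<in> borel_measurable baire" using f by (simp only: BM_measurable_iff)
  show "integrable \<mu> f \<longleftrightarrow> integrable BM f"
    unfolding integrable_completion[OF BM_measurable_nu[OF f]] BM_def
    using integrable_distr_eq[OF id_nu_baire f'] by simp
  show "(LINT x|\<mu>. f x) = (LINT x|BM. f x)"
    unfolding integral_completion[OF BM_measurable_nu[OF f]] BM_def
    using integral_distr[OF id_nu_baire f'] by simp
qed

lemma measurable_mu_cong_AE:
  fixes f g :: "'a \<Rightarrow> 'b::topological_space"
  assumes f: "f \<in> borel_measurable \<mu>" and ae: "AE x in \<nu>. f x = g x"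
  shows "g \<in> borel_measurable \<mu>"
proof (rule measurableI)
  fix A :: "'b set" assume A: "A \<in> sets borel"
  show "g -` A \<inter> space \<mu> \<in> sets \<mu>"
  proof (rule completion.in_sets_AE)
    show "f -` A \<inter> space \<mu> \<in> sets \<mu>" by (rule measurable_sets[OF f A])
    show "AE x in \<mu>. x \<in> f -` A \<inter> space \<mu> \<longleftrightarrow> x \<in> g -` A \<inter> space \<mu>"
      unfolding AE_completion_iff using ae by eventually_elim simp
  qed simp
qed simp

lemma ex_BM_function:
  fixes f :: "'a \<Rightarrow> 'b::{banach, second_countable_topology}"
  assumes "f \<in> borel_measurable \<mu>"
  obtains g where "g \<in> borel_measurable BM" "AE x in \<nu>. f x = g x"
proof (rule approx_function[OF assms])
  fix g assume "g \<in> borel_measurable baire" "AE x in \<nu>. f x = g x"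
  then show thesis by (intro that) (simp_all only: BM_measurable_iff)
qed

end

locale unimodular_haar_group = haar_group +
  assumes right_invariant: "A \<in> sets borel \<Longrightarrow> emeasure \<nu> ((\<lambda>z. z + x) -` A) = emeasure \<nu> A"
begin

lemma BM_distr_uminus: "distr BM BM uminus = BM"
proof (rule BM.inversion_invariant)
  fix x A assume "A \<in> sets BM"
  then have A: "A \<in> sets baire" by simp
  then have "(\<lambda>z. z + x) -` A \<in> sets baire" by (intro baire_vimage continuous_translations)
  then show "emeasure BM ((\<lambda>z. z + x) -` A) = emeasure BM A"
    using A sets_baire_subset right_invariant[of A x] by (auto simp: emeasure_BM)
qed

lemma uminus_invariant:
  assumes A: "A \<in> sets borel"
  shows "emeasure \<nu> (uminus -` A) = emeasure \<nu> A"
proof -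
  have "emeasure \<nu> (uminus -` A) = 1 * emeasure \<nu> A"
  proof (rule homeomorphism_scale[where h' = uminus, rotated -1, OF A])
    fix W :: "'a set" assume "cozero W"
    then have W: "W \<in> sets baire" by (rule cozero_baire)
    have W': "uminus -` W \<in> sets baire" using baire_vimage[OF continuous_translations(3) W] by simp
    have "emeasure (distr BM BM uminus) W = emeasure BM (uminus -` W)"
      using W by (subst emeasure_distr) auto
    then show "emeasure \<nu> (uminus -` W) = 1 * emeasure \<nu> W"
      using W W' by (simp add: BM_distr_uminus emeasure_BM)
  qed (use continuous_translations(3) in auto)
  then show ?thesis by simp
qed

sublocale BM: unimodular_group BM
  by unfold_locales (rule BM_distr_uminus)

lemma AE_nu_conv:
  assumes "AE y in \<nu>. Q y"
  shows "AE y in \<nu>. Q (- y + x)"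
proof -
  obtain N where N: "N \<in> sets \<nu>" "emeasure \<nu> N = 0" "{y. \<not> Q y} \<subseteq> N"
    using assms by (auto elim!: AE_E)
  let ?N = "uminus -` ((\<lambda>z. z + x) -` N)"
  have N1: "(\<lambda>z. z + x) -` N \<in> sets borel"
    using measurable_sets[OF borel_measurable_continuous_onI[OF continuous_translations(2)[of x]], of N] N(1) by simp
  have N2: "?N \<in> sets borel"
    using measurable_sets[OF borel_measurable_continuous_onI[OF continuous_translations(3)] N1] by simp
  have "emeasure \<nu> ?N = 0"
    using uminus_invariant[OF N1] right_invariant[of N x] N by simp
  then have "?N \<in> null_sets \<nu>" using N2 by (simp add: null_sets_def)
  then show ?thesis by (rule AE_I') (use N(3) in auto)
qed

lemma AE_nu_uminus:
  assumes "AE y in \<nu>. Q y"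
  shows "AE y in \<nu>. Q (- y)"
  using AE_nu_conv[OF assms, of 0] by simp

section \<open>Classes and their Baire representatives\<close>

definition cls :: "('a \<Rightarrow> complex) \<Rightarrow> 'a fclass" where
  "cls f = ae_class \<mu> f"

lemma cls_iff: "g \<in> cls f \<longleftrightarrow> g \<in> borel_measurable \<mu> \<and> (AE x in \<nu>. g x = f x)"
  by (simp add: cls_def ae_class_def AE_completion_iff)

lemma cls_eqI: "(AE x in \<nu>. f x = g x) \<Longrightarrow> cls f = cls g"
  by (auto simp: set_eq_iff cls_iff elim: eventually_elim2)

lemma cls_eq_iff:
  assumes "f \<in> borel_measurable BM" "g \<in> borel_measurable BM"
  shows "cls f = cls g \<longleftrightarrow> (AE x in BM. f x = g x)"
proof
  assume "cls f = cls g"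
  moreover have "f \<in> cls f" using BM_measurable_mu[OF assms(1)] by (simp add: cls_iff)
  ultimately have "AE x in \<nu>. f x = g x" by (simp add: cls_iff)
  then show "AE x in BM. f x = g x" using AE_eq_BM_iff[OF assms] by simp
next
  assume "AE x in BM. f x = g x"
  then show "cls f = cls g" using AE_eq_BM_iff[OF assms] by (intro cls_eqI) simp
qed

lemma rep_cls:
  assumes "f \<in> borel_measurable BM"
  shows "rep (cls f) \<in> borel_measurable \<mu>" "AE x in \<nu>. rep (cls f) x = f x"
proof -
  have "f \<in> cls f" using BM_measurable_mu[OF assms] by (simp add: cls_iff)
  then have "rep (cls f) \<in> cls f" unfolding rep_def by (rule someI[of "\<lambda>f'. f' \<in> cls f"])
  then show "rep (cls f) \<in> borel_measurable \<mu>" "AE x in \<nu>. rep (cls f) x = f x" by (auto simp: cls_iff)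
qed

lemma ae_class_cls:
  assumes "f \<in> borel_measurable \<mu>"
  obtains g where "g \<in> borel_measurable BM" "AE x in \<nu>. f x = g x" "ae_class \<mu> f = cls g"
proof -
  obtain g where g: "g \<in> borel_measurable BM" "AE x in \<nu>. f x = g x" by (rule ex_BM_function[OF assms])
  have "ae_class \<mu> f = cls g" using cls_eqI[OF g(2)] by (simp add: cls_def)
  with g show thesis by (rule that)
qed

lemma fc_zero_cls: "fc_zero \<mu> = cls (\<lambda>x. 0)"
  by (simp add: fc_zero_def cls_def)

lemma fc_add_cls:
  assumes f: "f \<in> borel_measurable BM" and g: "g \<in> borel_measurable BM"
  shows "fc_add \<mu> (cls f) (cls g) = cls (\<lambda>x. f x + g x)"
  unfolding fc_add_def cls_def[symmetric]
  by (rule cls_eqI) (use rep_cls(2)[OF f] rep_cls(2)[OF g] in eventually_elim, simp)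

lemma fc_scale_cls:
  assumes f: "f \<in> borel_measurable BM"
  shows "fc_scale \<mu> k (cls f) = cls (\<lambda>x. k * f x)"
  unfolding fc_scale_def cls_def[symmetric]
  by (rule cls_eqI) (use rep_cls(2)[OF f] in eventually_elim, simp)

text \<open>The representatives chosen in \<open>fc_conv\<close> are only Haar measurable, and
  measurability of addition on the Baire sets says nothing about their translates. For each x the
  integrand agrees almost everywhere with the Baire one, because y to -y + x preserves null sets,
  and is therefore measurable for the completion.\<close>

lemma fc_conv_cls:
  assumes f: "f \<in> borel_measurable BM" and g: "g \<in> borel_measurable BM"
  shows "fc_conv \<mu> (cls f) (cls g) = cls (convolution BM f g)"
proof -
  have eq: "convolution \<mu> (rep (cls f)) (rep (cls g)) = convolution BM f g"
  proof
    fix x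
    have m: "(\<lambda>y. f y * g (- y + x)) \<in> borel_measurable BM" using f g by measurable
    have ae: "AE y in \<nu>. f y * g (- y + x) = rep (cls f) y * rep (cls g) (- y + x)"
      using rep_cls(2)[OF f] AE_nu_conv[OF rep_cls(2)[OF g], of x] by eventually_elim simp
    have "(LINT y|\<mu>. rep (cls f) y * rep (cls g) (- y + x)) = (LINT y|\<mu>. f y * g (- y + x))"
      by (rule integral_cong_AE)
        (use measurable_mu_cong_AE[OF BM_measurable_mu[OF m] ae] BM_measurable_mu[OF m] ae in
          \<open>auto simp: AE_completion_iff elim: eventually_mono\<close>)
    then show "convolution \<mu> (rep (cls f)) (rep (cls g)) x = convolution BM f g x"
      unfolding convolution_def integral_BM(2)[OF m] .
  qed
  show ?thesis unfolding fc_conv_def eq by (rule cls_def[symmetric])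
qed

lemma fc_norm_cls:
  assumes f: "f \<in> borel_measurable BM"
  shows "fc_norm \<mu> r (cls f) = lpn BM r (\<lambda>x. cmod (f x))"
proof -
  have m: "(\<lambda>x. cmod (f x) powr r) \<in> borel_measurable BM" using f by measurable
  have "(LINT x|\<mu>. cmod (rep (cls f) x) powr r) = (LINT x|\<mu>. cmod (f x) powr r)"
    by (rule integral_cong_AE)
      (use rep_cls[OF f] BM_measurable_mu[OF f] in \<open>auto simp: AE_completion_iff elim!: eventually_mono\<close>)
  then show ?thesis unfolding fc_norm_def Lp_norm_def lpn_def integral_BM(2)[OF m] by simp
qed

lemma Lp2_cls: "Lp \<mu> 2 = cls ` BM.L2"
proof (intro Set.set_eqI iffI)
  fix F assume "F \<in> Lp \<mu> 2"
  then obtain f where f: "f \<in> borel_measurable \<mu>" "integrable \<mu> (\<lambda>x. cmod (f x) powr 2)" "F = ae_class \<mu> f"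
    by (auto simp: Lp_def Lp_functions_def)
  obtain g where g: "g \<in> borel_measurable BM" "AE x in \<nu>. f x = g x" "ae_class \<mu> f = cls g"
    by (rule ae_class_cls[OF f(1)])
  have m: "(\<lambda>x. cmod (g x) powr 2) \<in> borel_measurable BM" using g by measurable
  have "integrable \<mu> (\<lambda>x. cmod (f x) powr 2) \<longleftrightarrow> integrable \<mu> (\<lambda>x. cmod (g x) powr 2)"
    by (rule integrable_cong_AE)
      (use f(1) BM_measurable_mu[OF g(1)] g(2) in \<open>auto simp: AE_completion_iff elim!: eventually_mono\<close>)
  then have "integrable BM (\<lambda>x. cmod (g x) powr 2)" using f(2) integral_BM(1)[OF m] by simp
  then have "g \<in> BM.L2" using g(1) by (simp add: BM.L2_def lpint_def)
  then show "F \<in> cls ` BM.L2" using f(3) g(3) by simp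
next
  fix F assume "F \<in> cls ` BM.L2"
  then obtain g where g: "g \<in> BM.L2" "F = cls g" by auto
  note gm = BM.L2_measurable[OF g(1)]
  have m: "(\<lambda>x. cmod (g x) powr 2) \<in> borel_measurable BM" using gm by measurable
  have "integrable \<mu> (\<lambda>x. cmod (g x) powr 2)"
    using lpintD(3)[OF BM.L2_lpint[OF g(1)]] integral_BM(1)[OF m] by simp
  then show "F \<in> Lp \<mu> 2"
    using BM_measurable_mu[OF gm] g(2) by (simp add: Lp_def Lp_functions_def cls_def)
qed

end

text \<open>\<omega>' is a Baire modification of \<omega>: the classes and norms of the unitization
  are formed with \<omega>, the estimates with \<omega>'.\<close>

locale weighted_haar_group = unimodular_haar_group + BM: weighted_group BM \<omega>' u p \<eta> c
  for \<omega>' u p \<eta> c +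
  fixes \<omega> :: "'a \<Rightarrow> real"
  assumes \<omega>_mu: "\<omega> \<in> borel_measurable \<mu>" and \<omega>_AE: "AE x in \<nu>. \<omega> x = \<omega>' x"
begin

lemma fc_norm_weighted_cls:
  assumes f: "f \<in> borel_measurable BM"
  shows "fc_norm_weighted \<mu> p \<omega> (cls f) = BM.P f"
proof -
  have m: "(\<lambda>x. (cmod (f x) * \<omega>' x) powr p) \<in> borel_measurable BM" using f by measurable
  have "(LINT x|\<mu>. cmod (rep (cls f) x * of_real (\<omega> x)) powr p) = (LINT x|\<mu>. (cmod (f x) * \<omega>' x) powr p)"
  proof (rule integral_cong_AE)
    show "(\<lambda>x. cmod (rep (cls f) x * of_real (\<omega> x)) powr p) \<in> borel_measurable \<mu>"
      using rep_cls(1)[OF f] \<omega>_mu by measurable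
    show "AE x in \<mu>. cmod (rep (cls f) x * of_real (\<omega> x)) powr p = (cmod (f x) * \<omega>' x) powr p"
      unfolding AE_completion_iff using rep_cls(2)[OF f] \<omega>_AE
    proof eventually_elim
      fix x assume "rep (cls f) x = f x" "\<omega> x = \<omega>' x"
      then show "cmod (rep (cls f) x * of_real (\<omega> x)) powr p = (cmod (f x) * \<omega>' x) powr p"
        using BM.\<omega>_pos[of x] by (simp add: norm_mult)
    qed
  qed (rule BM_measurable_mu[OF m])
  then show ?thesis
    unfolding fc_norm_weighted_def Lp_norm_def BM.P_def lpn_def integral_BM(2)[OF m] by simp
qed

lemma conv_algebra_norm_cls: "f \<in> borel_measurable BM \<Longrightarrow> conv_algebra_norm \<mu> p \<omega> (cls f) = BM.N f"
  by (simp add: conv_algebra_norm_def fc_norm_weighted_cls fc_norm_cls BM.N_def)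

lemma conv_algebra_cls: "conv_algebra \<mu> p \<omega> = cls ` BM.A"
proof (intro Set.set_eqI iffI)
  fix F assume "F \<in> conv_algebra \<mu> p \<omega>"
  then have F: "F \<in> Lp_weighted \<mu> p \<omega>" "F \<in> cls ` BM.L2" by (auto simp: conv_algebra_def Lp2_cls)
  obtain g where g: "g \<in> BM.L2" "F = cls g" using F(2) by auto
  obtain f where f: "f \<in> borel_measurable \<mu>" "integrable \<mu> (\<lambda>x. cmod (f x * of_real (\<omega> x)) powr p)" "F = ae_class \<mu> f"
    using F(1) by (auto simp: Lp_weighted_def Lp_functions_def)
  note gm = BM.L2_measurable[OF g(1)]
  have "f \<in> cls g" using f(1) unfolding g(2)[symmetric] f(3) by (simp add: ae_class_def)
  then have ae: "AE x in \<nu>. f x = g x" by (simp add: cls_iff)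
  have m: "(\<lambda>x. (cmod (g x) * \<omega>' x) powr p) \<in> borel_measurable BM" using gm by measurable
  have "integrable \<mu> (\<lambda>x. cmod (f x * of_real (\<omega> x)) powr p) \<longleftrightarrow> integrable \<mu> (\<lambda>x. (cmod (g x) * \<omega>' x) powr p)"
  proof (rule integrable_cong_AE)
    show "(\<lambda>x. cmod (f x * of_real (\<omega> x)) powr p) \<in> borel_measurable \<mu>"
      using f(1) \<omega>_mu by measurable
    show "AE x in \<mu>. cmod (f x * of_real (\<omega> x)) powr p = (cmod (g x) * \<omega>' x) powr p"
      unfolding AE_completion_iff using ae \<omega>_AE
    proof eventually_elim
      fix x assume "f x = g x" "\<omega> x = \<omega>' x"
      then show "cmod (f x * of_real (\<omega> x)) powr p = (cmod (g x) * \<omega>' x) powr p"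
        using BM.\<omega>_pos[of x] by (simp add: norm_mult)
    qed
  qed (rule BM_measurable_mu[OF m])
  then have "integrable BM (\<lambda>x. (cmod (g x) * \<omega>' x) powr p)" using f(2) integral_BM(1)[OF m] by simp
  moreover have "(\<lambda>x. cmod (g x) * \<omega>' x) \<in> borel_measurable BM" using gm by measurable
  ultimately have "g \<in> BM.A"
    using g(1) BM.\<omega>_pos by (auto simp: BM.A_def BM.L2_def lpint_def less_imp_le)
  then show "F \<in> cls ` BM.A" using g(2) by simp
next
  fix F assume "F \<in> cls ` BM.A"
  then obtain g where g: "g \<in> BM.A" "F = cls g" by auto
  note gm = BM.A_measurable[OF g(1)]
  have m: "(\<lambda>x. (cmod (g x) * \<omega>' x) powr p) \<in> borel_measurable BM" using gm by measurable
  have "integrable \<mu> (\<lambda>x. (cmod (g x) * \<omega>' x) powr p)"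
    using lpintD(3)[OF BM.A_lpint[OF g(1)]] integral_BM(1)[OF m] by simp
  moreover have "integrable \<mu> (\<lambda>x. cmod (g x * of_real (\<omega> x)) powr p) \<longleftrightarrow> integrable \<mu> (\<lambda>x. (cmod (g x) * \<omega>' x) powr p)"
  proof (rule integrable_cong_AE)
    show "(\<lambda>x. cmod (g x * of_real (\<omega> x)) powr p) \<in> borel_measurable \<mu>"
      using BM_measurable_mu[OF gm] \<omega>_mu by measurable
    show "AE x in \<mu>. cmod (g x * of_real (\<omega> x)) powr p = (cmod (g x) * \<omega>' x) powr p"
      unfolding AE_completion_iff using \<omega>_AE
    proof eventually_elim
      fix x assume "\<omega> x = \<omega>' x"
      then show "cmod (g x * of_real (\<omega> x)) powr p = (cmod (g x) * \<omega>' x) powr p"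
        using BM.\<omega>_pos[of x] by (simp add: norm_mult)
    qed
  qed (rule BM_measurable_mu[OF m])
  ultimately have "(\<lambda>x. g x * of_real (\<omega> x)) \<in> Lp_functions \<mu> p"
    using BM_measurable_mu[OF gm] \<omega>_mu unfolding Lp_functions_def by auto
  then have "F \<in> Lp_weighted \<mu> p \<omega>"
    using BM_measurable_mu[OF gm] g(2) unfolding Lp_weighted_def cls_def by blast
  moreover have "F \<in> Lp \<mu> 2" unfolding Lp2_cls using BM.A_L2[OF g(1)] g(2) by blast
  ultimately show "F \<in> conv_algebra \<mu> p \<omega>" by (simp add: conv_algebra_def)
qed

section \<open>The embedding into the bounded operators\<close>

definition pc :: "'a unitized \<Rightarrow> 'a fclass \<times> complex" where
  "pc a = (cls (fst a), snd a)"

abbreviation (input) UA where "UA \<equiv> unitization \<mu> p \<omega>"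
abbreviation (input) BO where "BO \<equiv> bounded_ops_L2 \<mu>"
abbreviation (input) \<phi> where "\<phi> \<equiv> conv_operator \<mu>"

lemma carrier_UA: "carrier UA = pc ` BM.pA"
  by (force simp: unitization_def conv_algebra_cls BM.pA_def pc_def)

lemma pA_measurable: "a \<in> BM.pA \<Longrightarrow> fst a \<in> borel_measurable BM"
  using BM.A_measurable[OF BM.pA_fst] .

lemma alg_norm_pc: "a \<in> BM.pA \<Longrightarrow> alg_norm UA (pc a) = BM.nrm a"
  by (simp add: unitization_def pc_def conv_algebra_norm_cls pA_measurable BM.nrm_def)

lemma act_measurable:
  assumes "a \<in> BM.pA" "x \<in> borel_measurable BM"
  shows "BM.act a x \<in> borel_measurable BM"
  unfolding BM.act_def using pA_measurable[OF assms(1)] assms(2) by measurable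

lemma mult_pc:
  assumes a: "a \<in> BM.pA" and b: "b \<in> BM.pA"
  shows "pc a \<otimes>\<^bsub>UA\<^esub> pc b = pc (BM.pmul a b)"
proof -
  note [measurable] = pA_measurable[OF a] pA_measurable[OF b]
  have "fc_add \<mu> (fc_add \<mu> (fc_conv \<mu> (cls (fst a)) (cls (fst b))) (fc_scale \<mu> (snd b) (cls (fst a)))) (fc_scale \<mu> (snd a) (cls (fst b)))
    = cls (\<lambda>x. convolution BM (fst a) (fst b) x + snd b * fst a x + snd a * fst b x)"
    by (subst fc_conv_cls, measurable, subst fc_scale_cls[of "fst a"], measurable, subst fc_scale_cls[of "fst b"], measurable,
        subst fc_add_cls, measurable, subst fc_add_cls, measurable)
  also have "(\<lambda>x. convolution BM (fst a) (fst b) x + snd b * fst a x + snd a * fst b x) = fst (BM.pmul a b)"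
    by (simp add: BM.pmul_def BM.act_def fun_eq_iff)
  finally show ?thesis by (simp add: unitization_def pc_def BM.pmul_def)
qed

lemma add_pc: "a \<in> BM.pA \<Longrightarrow> b \<in> BM.pA \<Longrightarrow> pc a \<oplus>\<^bsub>UA\<^esub> pc b = pc (BM.padd a b)"
  by (simp add: unitization_def pc_def fc_add_cls pA_measurable BM.padd_def)

lemma smult_pc: "a \<in> BM.pA \<Longrightarrow> k \<odot>\<^bsub>UA\<^esub> pc a = pc (BM.pscale k a)"
  by (simp add: unitization_def pc_def fc_scale_cls pA_measurable BM.pscale_def)

lemma one_pc: "\<one>\<^bsub>UA\<^esub> = pc BM.pone"
  by (simp add: unitization_def pc_def BM.pone_def fc_zero_cls)

lemma \<phi>_pc_cls:
  assumes a: "a \<in> BM.pA" and x: "x \<in> BM.L2"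
  shows "\<phi> (pc a) (cls x) = cls (BM.act a x)"
proof -
  note [measurable] = pA_measurable[OF a] BM.L2_measurable[OF x]
  have "cls x \<in> Lp \<mu> 2" using x by (simp add: Lp2_cls)
  then have "\<phi> (pc a) (cls x) = fc_add \<mu> (fc_conv \<mu> (cls (fst a)) (cls x)) (fc_scale \<mu> (snd a) (cls x))"
    by (simp add: conv_operator_def pc_def)
  also have "\<dots> = cls (\<lambda>z. convolution BM (fst a) x z + snd a * x z)"
    by (subst fc_conv_cls, measurable, subst fc_scale_cls, measurable, subst fc_add_cls, measurable)
  finally show ?thesis by (simp add: BM.act_def)
qed

lemma \<phi>_extensional: "\<phi> (pc a) \<in> extensional (Lp \<mu> 2)"
  by (auto simp: conv_operator_def pc_def)

lemma ops_eqI: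
  assumes "S \<in> extensional (Lp \<mu> 2)" "T \<in> extensional (Lp \<mu> 2)"
    "\<And>x. x \<in> BM.L2 \<Longrightarrow> S (cls x) = T (cls x)"
  shows "S = T"
  by (rule extensionalityI[OF assms(1,2)]) (use assms(3) in \<open>auto simp: Lp2_cls\<close>)

lemma fc_norm_L2: "x \<in> BM.L2 \<Longrightarrow> fc_norm \<mu> 2 (cls x) = BM.n2 x"
  by (simp add: fc_norm_cls BM.L2_measurable)

lemma fc_add_L2: "x \<in> BM.L2 \<Longrightarrow> y \<in> BM.L2 \<Longrightarrow> fc_add \<mu> (cls x) (cls y) = cls (\<lambda>z. x z + y z)"
  by (simp add: fc_add_cls BM.L2_measurable)

lemma fc_scale_L2: "x \<in> BM.L2 \<Longrightarrow> fc_scale \<mu> k (cls x) = cls (\<lambda>z. k * x z)"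
  by (simp add: fc_scale_cls BM.L2_measurable)

lemma \<phi>_carrier:
  assumes a: "a \<in> BM.pA"
  shows "\<phi> (pc a) \<in> carrier BO"
proof -
  have "\<phi> (pc a) \<in> Lp \<mu> 2 \<rightarrow>\<^sub>E Lp \<mu> 2"
    using \<phi>_extensional[of a] by (auto simp: PiE_def Lp2_cls \<phi>_pc_cls[OF a] BM.act_L2(1)[OF a])
  moreover have "\<phi> (pc a) (fc_add \<mu> F G) = fc_add \<mu> (\<phi> (pc a) F) (\<phi> (pc a) G)"
    if FG: "F \<in> Lp \<mu> 2" "G \<in> Lp \<mu> 2" for F G
  proof -
    obtain x y where xy: "x \<in> BM.L2" "F = cls x" "y \<in> BM.L2" "G = cls y"
      using FG unfolding Lp2_cls by blast
    show ?thesis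
      unfolding xy(2,4) fc_add_L2[OF xy(1,3)] \<phi>_pc_cls[OF a xy(1)] \<phi>_pc_cls[OF a xy(3)]
        \<phi>_pc_cls[OF a BM.L2_add(1)[OF xy(1,3)]] fc_add_L2[OF BM.act_L2(1)[OF a xy(1)] BM.act_L2(1)[OF a xy(3)]]
      by (simp only: BM.act_add[OF a xy(1,3)])
  qed
  moreover have "\<phi> (pc a) (fc_scale \<mu> k F) = fc_scale \<mu> k (\<phi> (pc a) F)" if F: "F \<in> Lp \<mu> 2" for k F
  proof -
    obtain x where x: "x \<in> BM.L2" "F = cls x" using F unfolding Lp2_cls by blast
    show ?thesis
      unfolding x(2) fc_scale_L2[OF x(1)] \<phi>_pc_cls[OF a x(1)] \<phi>_pc_cls[OF a BM.L2_scale(1)[OF x(1)]]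
        fc_scale_L2[OF BM.act_L2(1)[OF a x(1)]]
      by (simp only: BM.act_scale)
  qed
  moreover have "\<forall>F\<in>Lp \<mu> 2. fc_norm \<mu> 2 (\<phi> (pc a) F) \<le> ((BM.C0 / c + 1) * BM.nrm a) * fc_norm \<mu> 2 F"
    by (auto simp: Lp2_cls \<phi>_pc_cls[OF a] fc_norm_L2 BM.act_L2[OF a])
  ultimately show ?thesis unfolding bounded_ops_L2_def by auto
qed

lemma \<phi>_mult:
  assumes a: "a \<in> BM.pA" and b: "b \<in> BM.pA"
  shows "\<phi> (pc a \<otimes>\<^bsub>UA\<^esub> pc b) = \<phi> (pc a) \<otimes>\<^bsub>BO\<^esub> \<phi> (pc b)"
  unfolding mult_pc[OF a b]
proof (rule ops_eqI[OF \<phi>_extensional])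
  show "\<phi> (pc a) \<otimes>\<^bsub>BO\<^esub> \<phi> (pc b) \<in> extensional (Lp \<mu> 2)"
    by (simp add: bounded_ops_L2_def compose_extensional)
  fix x assume x: "x \<in> BM.L2"
  then have "cls x \<in> Lp \<mu> 2" by (simp add: Lp2_cls)
  then show "\<phi> (pc (BM.pmul a b)) (cls x) = (\<phi> (pc a) \<otimes>\<^bsub>BO\<^esub> \<phi> (pc b)) (cls x)"
    using a b x by (simp add: bounded_ops_L2_def compose_def \<phi>_pc_cls BM.pmul_pA BM.act_pmul BM.act_L2)
qed

lemma \<phi>_add:
  assumes a: "a \<in> BM.pA" and b: "b \<in> BM.pA"
  shows "\<phi> (pc a \<oplus>\<^bsub>UA\<^esub> pc b) = \<phi> (pc a) \<oplus>\<^bsub>BO\<^esub> \<phi> (pc b)"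
  unfolding add_pc[OF a b]
proof (rule ops_eqI[OF \<phi>_extensional])
  show "\<phi> (pc a) \<oplus>\<^bsub>BO\<^esub> \<phi> (pc b) \<in> extensional (Lp \<mu> 2)"
    by (simp add: bounded_ops_L2_def)
  fix x assume x: "x \<in> BM.L2"
  then have "cls x \<in> Lp \<mu> 2" by (simp add: Lp2_cls)
  then show "\<phi> (pc (BM.padd a b)) (cls x) = (\<phi> (pc a) \<oplus>\<^bsub>BO\<^esub> \<phi> (pc b)) (cls x)"
    using a b x by (simp add: bounded_ops_L2_def \<phi>_pc_cls BM.padd_pA BM.act_padd BM.act_L2 fc_add_L2)
qed

lemma \<phi>_smult:
  assumes a: "a \<in> BM.pA"
  shows "\<phi> (k \<odot>\<^bsub>UA\<^esub> pc a) = k \<odot>\<^bsub>BO\<^esub> \<phi> (pc a)"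
  unfolding smult_pc[OF a]
proof (rule ops_eqI[OF \<phi>_extensional])
  show "k \<odot>\<^bsub>BO\<^esub> \<phi> (pc a) \<in> extensional (Lp \<mu> 2)"
    by (simp add: bounded_ops_L2_def)
  fix x assume x: "x \<in> BM.L2"
  then have "cls x \<in> Lp \<mu> 2" by (simp add: Lp2_cls)
  then show "\<phi> (pc (BM.pscale k a)) (cls x) = (k \<odot>\<^bsub>BO\<^esub> \<phi> (pc a)) (cls x)"
    using a x by (simp add: bounded_ops_L2_def \<phi>_pc_cls BM.pscale_pA BM.act_pscale BM.act_L2 fc_scale_L2)
qed

lemma \<phi>_one: "\<phi> \<one>\<^bsub>UA\<^esub> = \<one>\<^bsub>BO\<^esub>"
  unfolding one_pc
proof (rule ops_eqI[OF \<phi>_extensional])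
  show "\<one>\<^bsub>BO\<^esub> \<in> extensional (Lp \<mu> 2)" by (simp add: bounded_ops_L2_def)
  fix x assume x: "x \<in> BM.L2"
  then have "cls x \<in> Lp \<mu> 2" by (simp add: Lp2_cls)
  then show "\<phi> (pc BM.pone) (cls x) = \<one>\<^bsub>BO\<^esub> (cls x)"
    using x by (simp add: bounded_ops_L2_def \<phi>_pc_cls BM.pone_pA BM.act_pone)
qed

text \<open>The difference of two elements with the same image acts as 0. By
  \<open>scalar_part_bounds\<close> with bound 0 its scalar part vanishes, so its function part
  convolves L^2 to 0 and is null by \<open>conv_faithful\<close>.\<close>

lemma \<phi>_inj: "inj_on \<phi> (carrier UA)"
proof (rule inj_onI)
  fix v w assume "v \<in> carrier UA" "w \<in> carrier UA" and eq: "\<phi> v = \<phi> w"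
  then obtain a b where a: "a \<in> BM.pA" "v = pc a" and b: "b \<in> BM.pA" "w = pc b" by (auto simp: carrier_UA)
  define d where "d = BM.padd a (BM.pscale (- 1) b)"
  have d: "d \<in> BM.pA" unfolding d_def by (intro BM.padd_pA BM.pscale_pA a b)
  have d0: "AE z in BM. BM.act d x z = 0" if x: "x \<in> BM.L2" for x
  proof -
    have "cls (BM.act a x) = cls (BM.act b x)"
      using eq by (simp add: \<phi>_pc_cls[OF a(1) x, symmetric] \<phi>_pc_cls[OF b(1) x, symmetric] a(2) b(2))
    then have "AE z in BM. BM.act a x z = BM.act b x z"
      by (simp add: cls_eq_iff act_measurable a b BM.L2_measurable[OF x])
    then show ?thesis
      unfolding d_def BM.act_padd[OF a(1) BM.pscale_pA[OF b(1)] x] BM.act_pscale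
      by eventually_elim simp
  qed
  have "BM.n2 (BM.act d x) \<le> 0 * BM.n2 x" if x: "x \<in> BM.L2" for x
  proof -
    have "BM.n2 (BM.act d x) = lpn BM 2 (\<lambda>z. 0)"
      by (rule lpn_cong_AE)
        (use d0[OF x] BM.L2_measurable[OF BM.act_L2(1)[OF d x]] in \<open>auto elim!: eventually_mono\<close>)
    then show ?thesis by (simp add: lpn_def)
  qed
  then have "cmod (snd d) \<le> 0" by (rule BM.scalar_part_bounds(1)[OF d])
  then have s: "snd d = 0" by simp
  then have t: "snd a = snd b" by (simp add: d_def BM.padd_def BM.pscale_def)
  have "AE z in BM. fst d z = 0"
  proof (rule BM.conv_faithful[OF BM.pA_fst_L1[OF d]])
    fix x assume "x \<in> BM.L2"
    then show "AE z in BM. convolution BM (fst d) x z = 0"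
      using d0[of x] by (simp add: BM.act_def s)
  qed
  then have "AE z in BM. fst a z = fst b z"
    by eventually_elim (simp add: d_def BM.padd_def BM.pscale_def)
  then have "cls (fst a) = cls (fst b)"
    using cls_eq_iff pA_measurable a b by blast
  with t show "v = w" by (simp add: a b pc_def)
qed

lemma embedding: "unital_embedding \<phi> UA BO"
  unfolding unital_embedding_def
proof (intro conjI allI ballI \<phi>_inj ring_hom_memI)
  show "\<phi> v \<in> carrier BO" if "v \<in> carrier UA" for v using that \<phi>_carrier by (auto simp: carrier_UA)
  show "\<phi> (v \<otimes>\<^bsub>UA\<^esub> w) = \<phi> v \<otimes>\<^bsub>BO\<^esub> \<phi> w" if "v \<in> carrier UA" "w \<in> carrier UA" for v w
    using that \<phi>_mult by (auto simp: carrier_UA)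
  show "\<phi> (v \<oplus>\<^bsub>UA\<^esub> w) = \<phi> v \<oplus>\<^bsub>BO\<^esub> \<phi> w" if "v \<in> carrier UA" "w \<in> carrier UA" for v w
    using that \<phi>_add by (auto simp: carrier_UA)
  show "\<phi> (k \<odot>\<^bsub>UA\<^esub> v) = k \<odot>\<^bsub>BO\<^esub> \<phi> v" if "v \<in> carrier UA" for k v
    using that \<phi>_smult by (auto simp: carrier_UA)
qed (rule \<phi>_one)

section \<open>Units of the operator algebra and their inverses\<close>

lemma carrier_BO_cls:
  assumes S: "S \<in> carrier BO" and x: "x \<in> BM.L2"
  obtains w where "w \<in> BM.L2" "S (cls x) = cls w"
proof -
  have "S (cls x) \<in> Lp \<mu> 2" using S x unfolding bounded_ops_L2_def by (auto simp: Lp2_cls)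
  then show thesis using that by (auto simp: Lp2_cls)
qed

lemma alg_norm_BO:
  assumes S: "S \<in> carrier BO"
  shows "0 \<le> alg_norm BO S" and "F \<in> Lp \<mu> 2 \<Longrightarrow> fc_norm \<mu> 2 (S F) \<le> alg_norm BO S * fc_norm \<mu> 2 F"
proof -
  have "\<exists>C. \<forall>F\<in>Lp \<mu> 2. fc_norm \<mu> 2 (S F) \<le> C * fc_norm \<mu> 2 F"
    using S unfolding bounded_ops_L2_def by simp
  then obtain C where C: "\<And>F. F \<in> Lp \<mu> 2 \<Longrightarrow> fc_norm \<mu> 2 (S F) \<le> C * fc_norm \<mu> 2 F" by blast
  have sc: "S (fc_scale \<mu> k F) = fc_scale \<mu> k (S F)" if "F \<in> Lp \<mu> 2" for k F
    using S that unfolding bounded_ops_L2_def by auto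
  have nn: "0 \<le> fc_norm \<mu> 2 F" for F by (simp add: fc_norm_def Lp_norm_def)
  let ?U = "{F \<in> Lp \<mu> 2. fc_norm \<mu> 2 F \<le> 1}"
  \<comment> \<open>The operator norm is a real \<open>SUP\<close>, which bounds its members only
    when the set is bounded above.\<close>
  have bdd: "bdd_above ((\<lambda>F. fc_norm \<mu> 2 (S F)) ` ?U)"
  proof (rule bdd_aboveI2)
    fix F assume F: "F \<in> ?U"
    have "fc_norm \<mu> 2 (S F) \<le> C * fc_norm \<mu> 2 F" using C F by simp
    also have "\<dots> \<le> max C 0 * 1" using F nn[of F] by (intro mult_mono) auto
    finally show "fc_norm \<mu> 2 (S F) \<le> max C 0" by simp
  qed
  have up: "fc_norm \<mu> 2 (S F) \<le> alg_norm BO S" if "F \<in> ?U" for F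
    using cSUP_upper[OF that bdd] by (simp add: bounded_ops_L2_def)
  have z: "(\<lambda>_. 0) \<in> BM.L2" by (rule BM.A_L2[OF BM.zero_A])
  have "cls (\<lambda>_. 0) \<in> ?U" using z by (simp add: Lp2_cls fc_norm_L2) (simp add: lpn_def)
  then show "0 \<le> alg_norm BO S" using up nn order_trans by blast
  show "fc_norm \<mu> 2 (S F) \<le> alg_norm BO S * fc_norm \<mu> 2 F" if F: "F \<in> Lp \<mu> 2" for F
  proof (cases "fc_norm \<mu> 2 F = 0")
    case True
    then show ?thesis using C[OF F] by simp
  next
    case False
    obtain x where x: "x \<in> BM.L2" "F = cls x" using F by (auto simp: Lp2_cls)
    obtain w where w: "w \<in> BM.L2" "S (cls x) = cls w" by (rule carrier_BO_cls[OF S x(1)])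
    have pos: "0 < BM.n2 x" using False x by (simp add: fc_norm_L2 less_le)
    let ?k = "of_real (1 / BM.n2 x) :: complex"
    have k: "cmod ?k = 1 / BM.n2 x" unfolding norm_of_real using pos by simp
    have "fc_scale \<mu> ?k (cls x) \<in> ?U"
      unfolding fc_scale_L2[OF x(1)] mem_Collect_eq fc_norm_L2[OF BM.L2_scale(1)[OF x(1)]] BM.L2_scale(2)[OF x(1)] k
    proof
      show "cls (\<lambda>z. ?k * x z) \<in> Lp \<mu> 2" unfolding Lp2_cls using BM.L2_scale(1)[OF x(1)] by (rule imageI)
    qed (use pos in simp)
    from up[OF this] have "1 / BM.n2 x * BM.n2 w \<le> alg_norm BO S"
      unfolding sc[OF F[unfolded x(2)]] w(2) fc_scale_L2[OF w(1)] fc_norm_L2[OF BM.L2_scale(1)[OF w(1)]]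
        BM.L2_scale(2)[OF w(1)] k .
    then show ?thesis using pos x w by (simp add: fc_norm_L2 field_simps)
  qed
qed

text \<open>Any right inverse T of the operator of a satisfies a (T x) = x, and the element b from
  \<open>norm_control\<close> then forces T x = b x. This shows at once that the inverse comes from
  b and that the description behind \<open>inv\<close> has a unique solution.\<close>

lemma unit_inverse:
  assumes a: "a \<in> BM.pA" and unit: "\<phi> (pc a) \<in> Units BO"
  obtains b where "b \<in> BM.pA" "inv\<^bsub>BO\<^esub> (\<phi> (pc a)) = \<phi> (pc b)"
    "BM.nrm b \<le> BM.control (BM.nrm a) (alg_norm BO (inv\<^bsub>BO\<^esub> (\<phi> (pc a))))"
    "0 \<le> alg_norm BO (inv\<^bsub>BO\<^esub> (\<phi> (pc a)))"
proof -
  obtain S where S: "S \<in> carrier BO" "S \<otimes>\<^bsub>BO\<^esub> \<phi> (pc a) = \<one>\<^bsub>BO\<^esub>" "\<phi> (pc a) \<otimes>\<^bsub>BO\<^esub> S = \<one>\<^bsub>BO\<^esub>"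
    using unit unfolding Units_def by blast
  have right: "\<phi> (pc a) (T (cls x)) = cls x"
    if T: "\<phi> (pc a) \<otimes>\<^bsub>BO\<^esub> T = \<one>\<^bsub>BO\<^esub>" and x: "x \<in> BM.L2" for T x
  proof -
    have "cls x \<in> Lp \<mu> 2" using x by (simp add: Lp2_cls)
    then show ?thesis using fun_cong[OF T, of "cls x"] by (simp add: bounded_ops_L2_def compose_def)
  qed
  have left: "S (\<phi> (pc a) (cls x)) = cls x" if x: "x \<in> BM.L2" for x
  proof -
    have "cls x \<in> Lp \<mu> 2" using x by (simp add: Lp2_cls)
    then show ?thesis using fun_cong[OF S(2), of "cls x"] by (simp add: bounded_ops_L2_def compose_def)
  qed
  have act_eq: "AE z in BM. BM.act a w z = x z"
    if x: "x \<in> BM.L2" and w: "w \<in> BM.L2" and T: "\<phi> (pc a) \<otimes>\<^bsub>BO\<^esub> T = \<one>\<^bsub>BO\<^esub>" "T (cls x) = cls w" for x w T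
  proof -
    have "cls (BM.act a w) = cls x" using right[OF T(1) x] by (simp add: T(2) \<phi>_pc_cls[OF a w])
    then show ?thesis
      using cls_eq_iff[OF act_measurable[OF a BM.L2_measurable[OF w]] BM.L2_measurable[OF x]] by simp
  qed
  have Y: "0 \<le> alg_norm BO S" by (rule alg_norm_BO(1)[OF S(1)])
  have below: "BM.n2 x \<le> alg_norm BO S * BM.n2 (BM.act a x)" if x: "x \<in> BM.L2" for x
  proof -
    have ax: "BM.act a x \<in> BM.L2" by (rule BM.act_L2(1)[OF a x])
    have "fc_norm \<mu> 2 (S (cls (BM.act a x))) \<le> alg_norm BO S * fc_norm \<mu> 2 (cls (BM.act a x))"
      by (rule alg_norm_BO(2)[OF S(1)]) (simp add: Lp2_cls ax)
    then show ?thesis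
      using left[OF x] by (simp add: \<phi>_pc_cls[OF a x] fc_norm_L2[OF x] fc_norm_L2[OF ax])
  qed
  have onto: "\<exists>w\<in>BM.L2. AE z in BM. BM.act a w z = x z" if x: "x \<in> BM.L2" for x
  proof -
    obtain w where w: "w \<in> BM.L2" "S (cls x) = cls w" by (rule carrier_BO_cls[OF S(1) x])
    from act_eq[OF x w(1) S(3) w(2)] w(1) show ?thesis by blast
  qed
  obtain b where b: "b \<in> BM.pA" "BM.nrm b \<le> BM.control (BM.nrm a) (alg_norm BO S)"
    "\<And>x w. x \<in> BM.L2 \<Longrightarrow> w \<in> BM.L2 \<Longrightarrow> AE z in BM. BM.act a w z = x z \<Longrightarrow> AE z in BM. BM.act b x z = w z"
    using BM.norm_control[OF a Y below onto] by blast
  have uniq: "T = \<phi> (pc b)" if T: "T \<in> carrier BO" "\<phi> (pc a) \<otimes>\<^bsub>BO\<^esub> T = \<one>\<^bsub>BO\<^esub>" for T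
  proof (rule ops_eqI[OF _ \<phi>_extensional])
    show "T \<in> extensional (Lp \<mu> 2)" using T(1) by (auto simp: bounded_ops_L2_def PiE_def)
    fix x assume x: "x \<in> BM.L2"
    obtain w where w: "w \<in> BM.L2" "T (cls x) = cls w" by (rule carrier_BO_cls[OF T(1) x])
    have "AE z in BM. BM.act b x z = w z" by (rule b(3)[OF x w(1) act_eq[OF x w(1) T(2) w(2)]])
    then have "cls (BM.act b x) = cls w"
      using cls_eq_iff[OF act_measurable[OF b(1) BM.L2_measurable[OF x]] BM.L2_measurable[OF w(1)]] by simp
    then show "T (cls x) = \<phi> (pc b) (cls x)" by (simp add: \<phi>_pc_cls[OF b(1) x] w(2))
  qed
  have SB: "S = \<phi> (pc b)" by (rule uniq[OF S(1,3)])
  have inv: "inv\<^bsub>BO\<^esub> (\<phi> (pc a)) = S"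
    unfolding m_inv_def
  proof (rule the_equality)
    show "T = S" if "T \<in> carrier BO \<and> \<phi> (pc a) \<otimes>\<^bsub>BO\<^esub> T = \<one>\<^bsub>BO\<^esub> \<and> T \<otimes>\<^bsub>BO\<^esub> \<phi> (pc a) = \<one>\<^bsub>BO\<^esub>" for T
      using uniq[of T] that SB by simp
  qed (use S in simp)
  show thesis
    by (rule that[OF b(1)]) (use inv SB b(2) Y in simp_all)
qed

theorem inverse_closed_controlled: "inverse_closed \<phi> UA BO \<and> norm_controlled_inversion \<phi> UA BO"
proof -
  have ic: "inverse_closed \<phi> UA BO"
    unfolding inverse_closed_def
  proof (intro conjI embedding ballI impI)
    fix v assume "v \<in> carrier UA" "\<phi> v \<in> Units BO"
    then obtain a where a: "a \<in> BM.pA" "v = pc a" "\<phi> (pc a) \<in> Units BO"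
      unfolding carrier_UA by blast
    obtain b where "b \<in> BM.pA" "inv\<^bsub>BO\<^esub> (\<phi> (pc a)) = \<phi> (pc b)" by (rule unit_inverse[OF a(1,3)])
    then show "inv\<^bsub>BO\<^esub> (\<phi> v) \<in> \<phi> ` carrier UA" by (simp add: a(2) carrier_UA)
  qed
  define h where "h x y = (if 0 \<le> x \<and> 0 \<le> y then BM.control x y else 0)" for x y
  have "alg_norm UA (the_inv_into (carrier UA) \<phi> (inv\<^bsub>BO\<^esub> (\<phi> v)))
      \<le> h (alg_norm UA v) (alg_norm BO (inv\<^bsub>BO\<^esub> (\<phi> v)))"
    if v: "v \<in> carrier UA" "\<phi> v \<in> Units BO" for v
  proof -
    obtain a where a: "a \<in> BM.pA" "v = pc a" "\<phi> (pc a) \<in> Units BO"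
      using v unfolding carrier_UA by blast
    obtain b where b: "b \<in> BM.pA" "inv\<^bsub>BO\<^esub> (\<phi> (pc a)) = \<phi> (pc b)"
      "BM.nrm b \<le> BM.control (BM.nrm a) (alg_norm BO (inv\<^bsub>BO\<^esub> (\<phi> (pc a))))"
      "0 \<le> alg_norm BO (inv\<^bsub>BO\<^esub> (\<phi> (pc a)))"
      by (rule unit_inverse[OF a(1,3)])
    have "the_inv_into (carrier UA) \<phi> (inv\<^bsub>BO\<^esub> (\<phi> v)) = pc b"
      unfolding a(2) b(2) by (rule the_inv_into_f_f[OF \<phi>_inj]) (simp add: carrier_UA b(1))
    then show ?thesis using b(3,4) by (simp add: alg_norm_pc a b(1) h_def)
  qed
  moreover have "0 \<le> h x y" for x y unfolding h_def using BM.control_nonneg by simp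
  ultimately have "norm_controlled_inversion \<phi> UA BO"
    unfolding norm_controlled_inversion_def using ic by blast
  with ic show ?thesis by blast
qed

end

section \<open>Reduction to Baire functions and choice of the exponent\<close>

context haar_group
begin

text \<open>By left invariance all points have the same mass. Were it positive, a neighbourhood of 0
  inside a compact set would be finite; in a Hausdorff group {0}, and then every set, would be
  open.\<close>

lemma singleton_null:
  assumes nd: "\<not> (\<forall>S :: 'a set. open S)"
  shows "emeasure \<nu> {0} = 0"
proof (rule ccontr)
  assume pos: "emeasure \<nu> {0} \<noteq> 0"
  obtain V C where V: "open V" "compact C" "(0::'a) \<in> V" "V \<subseteq> C"
    by (rule locally_compactE[OF loc_compact, of 0])
  have pt: "emeasure \<nu> {x} = emeasure \<nu> {0}" for x
    using left_image[of "{0}" x] by simp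
  have "finite V"
  proof (rule ccontr)
    assume inf: "infinite V"
    have bound: "of_nat n * emeasure \<nu> {0} \<le> emeasure \<nu> C" for n
    proof -
      obtain F where F: "finite F" "card F = n" "F \<subseteq> V" using infinite_arbitrarily_large[OF inf] by blast
      have "of_nat n * emeasure \<nu> {0} = (\<Sum>x\<in>F. emeasure \<nu> {0})" using F by simp
      also have "\<dots> = (\<Sum>x\<in>F. emeasure \<nu> {x})" by (intro sum.cong refl pt[symmetric])
      also have "\<dots> = emeasure \<nu> F" using F(1) by (intro emeasure_eq_sum_singleton[symmetric]) auto
      also have "\<dots> \<le> emeasure \<nu> C" using F V by (intro emeasure_mono) (auto intro: borel_compact)
      finally show ?thesis .
    qed
    have "(SUP n. of_nat n * emeasure \<nu> {0}) \<le> emeasure \<nu> C" using bound by (rule SUP_least)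
    then have "(\<infinity>::ennreal) * emeasure \<nu> {0} \<le> emeasure \<nu> C"
      by (simp add: SUP_mult_right_ennreal[symmetric] ennreal_SUP_of_nat_eq_top)
    then show False using pos compact_finite[OF V(2)] by (simp add: ennreal_top_mult top_unique)
  qed
  then have "closed (V - {0})" by (intro finite_imp_closed) simp
  then have "open (V - (V - {0}))" using V(1) by (rule open_Diff[rotated])
  moreover have "V - (V - {0}) = {0}" using V(3) by auto
  ultimately have o: "open {0::'a}" by simp
  have "open S" for S :: "'a set"
  proof -
    have "open {x}" for x :: 'a
    proof -
      have "open ((\<lambda>y. - x + y) -` {0})" using o continuous_translations(1) by (intro open_vimage)
      moreover have "(\<lambda>y. - x + y) -` {0} = {x}" using left_image_eq[of x "{0}"] by simp
      ultimately show ?thesis by simp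
    qed
    then have "open (\<Union>x\<in>S. {x})" by blast
    then show ?thesis by simp
  qed
  with nd show False by blast
qed

lemma small_baire_sets:
  assumes nd: "\<not> (\<forall>S :: 'a set. open S)" and e: "0 < (\<epsilon>::real)"
  shows "\<exists>W\<in>sets BM. 0 < emeasure BM W \<and> emeasure BM W < ennreal \<epsilon>"
proof -
  have "(INF U\<in>{U. open U \<and> {0} \<subseteq> U}. emeasure \<nu> U) < ennreal \<epsilon>"
    using singleton_null[OF nd] e by (subst outer_regular[symmetric]) auto
  then obtain U where U: "open U" "0 \<in> U" "emeasure \<nu> U < ennreal \<epsilon>" by (auto simp: INF_less_iff)
  obtain W where W: "cozero W" "0 \<in> W" "W \<subseteq> U" by (rule cozero_nbhd[OF loc_compact U(1,2)])
  have "0 < emeasure \<nu> W" using W by (intro open_pos cozero_open) auto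
  moreover have "emeasure \<nu> W < ennreal \<epsilon>"
    using emeasure_mono[OF W(3), of \<nu>] U by (auto intro: le_less_trans)
  ultimately show ?thesis using W(1) by (intro bexI[of _ W]) (auto simp: emeasure_BM cozero_baire)
qed

text \<open>For a product measurable R the set of x whose section has null complement is again Baire
  measurable, so the two quantifiers can be transferred one after the other from \<nu> to its
  restriction.\<close>

lemma AE_nested_BM:
  assumes R: "{w. R (fst w) (snd w)} \<in> sets (BM \<Otimes>\<^sub>M BM)"
    and ae: "AE x in \<nu>. AE y in \<nu>. R x y"
  shows "AE x in BM. AE y in BM. R x y"
proof -
  let ?B = "{w. \<not> R (fst w) (snd w)}"
  have "space (BM \<Otimes>\<^sub>M BM) - {w. R (fst w) (snd w)} \<in> sets (BM \<Otimes>\<^sub>M BM)" by (rule sets.compl_sets[OF R])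
  also have "space (BM \<Otimes>\<^sub>M BM) - {w. R (fst w) (snd w)} = ?B" by (auto simp: space_pair_measure)
  finally have B: "?B \<in> sets (BM \<Otimes>\<^sub>M BM)" .
  have sec: "{y. \<not> R x y} \<in> sets BM" for x
    using sets_Pair1[OF B, of x] by (simp add: vimage_def)
  have iff: "(AE y in BM. R x y) \<longleftrightarrow> emeasure BM (Pair x -` ?B) = 0" for x
    using sec[of x] by (subst AE_iff_measurable[of "{y. \<not> R x y}"]) (auto simp: vimage_def)
  have "(\<lambda>x. emeasure BM (Pair x -` ?B)) \<in> borel_measurable BM"
    by (rule BM.measurable_emeasure_Pair[OF B])
  then have "{x \<in> space BM. emeasure BM (Pair x -` ?B) = 0} \<in> sets BM" by measurable
  then have m: "{x. AE y in BM. R x y} \<in> sets baire" by (simp add: iff)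
  have sec': "{y. R x y} \<in> sets baire" for x
    using sets.compl_sets[OF sec[of x]] by (simp add: Collect_neg_eq)
  show ?thesis
    unfolding AE_BM_iff[OF m] using ae by eventually_elim (simp add: AE_BM_iff[OF sec'])
qed

end

context unimodular_haar_group
begin

text \<open>\<omega> and u are replaced by Baire functions equal to them almost everywhere.
  Truncation at 1 and 0 keeps the bounds \<omega> \<ge> 1 and u \<ge> 0 at every point; the
  remaining relations are transferred almost everywhere, the form in which
  \<open>weighted_group\<close> asks for them.\<close>

lemma ex_weighted_haar_group:
  fixes \<omega> u :: "'a \<Rightarrow> real" and p \<eta> c :: real
  assumes nd: "\<not> (\<forall>S :: 'a set. open S)"
    and meas: "\<omega> \<in> borel_measurable \<mu>" "u \<in> borel_measurable \<mu>"
    and w1: "\<And>x. 1 \<le> \<omega> x" and w_sym: "\<And>x. \<omega> (- x) = \<omega> x"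
    and u0: "\<And>x. 0 \<le> u x" and c: "0 < c" "\<And>x. c \<le> \<omega> x * u x"
    and ineq: "\<And>x y. \<omega> (x + y) \<le> \<omega> x * \<omega> y * (u x + u y)"
    and p: "1 \<le> p" and \<eta>: "0 < \<eta>" "\<eta> < 1" and exponent: "0 < 1 - (1 - \<eta>) / p - \<eta> / 2"
    and fin: "(\<integral>\<^sup>+x. ennreal ((u x * \<omega> x powr \<eta>) powr (1 / (1 - (1 - \<eta>) / p - \<eta> / 2))) \<partial>\<mu>) < \<infinity>"
  shows "\<exists>W U. weighted_haar_group \<nu> W U p \<eta> c \<omega>"
proof -
  obtain W0 where W0: "W0 \<in> borel_measurable BM" "AE x in \<nu>. \<omega> x = W0 x" by (rule ex_BM_function[OF meas(1)])
  obtain U0 where U0: "U0 \<in> borel_measurable BM" "AE x in \<nu>. u x = U0 x" by (rule ex_BM_function[OF meas(2)])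
  define W where "W x = max 1 (W0 x)" for x
  define U where "U x = max 0 (U0 x)" for x
  have [measurable]: "W \<in> borel_measurable BM" "U \<in> borel_measurable BM"
    unfolding W_def U_def using W0 U0 by measurable
  have W: "AE x in \<nu>. \<omega> x = W x" using W0(2)
  proof eventually_elim
    fix x assume "\<omega> x = W0 x"
    then show "\<omega> x = W x" using w1[of x] by (simp add: W_def)
  qed
  have U: "AE x in \<nu>. u x = U x" using U0(2)
  proof eventually_elim
    fix x assume "u x = U0 x"
    then show "u x = U x" using u0[of x] by (simp add: U_def)
  qed
  let ?e = "1 - (1 - \<eta>) / p - \<eta> / 2"
  have "weighted_group BM W U p \<eta> c"
  proof (intro weighted_group.intro BM.unimodular_group_axioms weighted_group_axioms.intro)
    show "AE x in BM. c \<le> W x * U x"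
    proof -
      have "{x \<in> space BM. c \<le> W x * U x} \<in> sets BM" by measurable
      then have m: "{x. c \<le> W x * U x} \<in> sets baire" by simp
      show ?thesis unfolding AE_BM_iff[OF m] using W U
      proof eventually_elim
        fix x assume "\<omega> x = W x" "u x = U x"
        then show "c \<le> W x * U x" using c(2)[of x] by simp
      qed
    qed
    show "AE x in BM. W (- x) = W x"
    proof (subst AE_eq_BM_iff)
      show "AE x in \<nu>. W (- x) = W x"
        using W AE_nu_uminus[OF W]
      proof eventually_elim
        fix x assume "\<omega> x = W x" "\<omega> (- x) = W (- x)"
        then show "W (- x) = W x" using w_sym[of x] by simp
      qed
    qed measurable
    show "AE x in BM. AE y in BM. W x \<le> W y * W (- y + x) * (U y + U (- y + x))"
    proof (rule AE_nested_BM)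
      have "{w \<in> space (BM \<Otimes>\<^sub>M BM). W (fst w) \<le> W (snd w) * W (- snd w + fst w) * (U (snd w) + U (- snd w + fst w))}
        \<in> sets (BM \<Otimes>\<^sub>M BM)" by measurable
      then show "{w. W (fst w) \<le> W (snd w) * W (- snd w + fst w) * (U (snd w) + U (- snd w + fst w))}
        \<in> sets (BM \<Otimes>\<^sub>M BM)" by (simp add: space_pair_measure)
      show "AE x in \<nu>. AE y in \<nu>. W x \<le> W y * W (- y + x) * (U y + U (- y + x))"
        using W
      proof eventually_elim
        fix x assume x: "\<omega> x = W x"
        show "AE y in \<nu>. W x \<le> W y * W (- y + x) * (U y + U (- y + x))"
          using W U AE_nu_conv[OF W, of x] AE_nu_conv[OF U, of x]
        proof eventually_elim
          fix y assume "\<omega> y = W y" "u y = U y" "\<omega> (- y + x) = W (- y + x)" "u (- y + x) = U (- y + x)"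
          then show "W x \<le> W y * W (- y + x) * (U y + U (- y + x))"
            using ineq[of y "- y + x"] x by (simp add: add.assoc[symmetric])
        qed
      qed
    qed
    show "integrable BM (\<lambda>x. (U x * W x powr \<eta>) powr (1 / ?e))"
    proof -
      have m: "(\<lambda>x. (U x * W x powr \<eta>) powr (1 / ?e)) \<in> borel_measurable BM" by measurable
      have "(\<integral>\<^sup>+x. ennreal ((U x * W x powr \<eta>) powr (1 / ?e)) \<partial>\<mu>)
        = (\<integral>\<^sup>+x. ennreal ((u x * \<omega> x powr \<eta>) powr (1 / ?e)) \<partial>\<mu>)"
      proof (rule nn_integral_cong_AE)
        show "AE x in \<mu>. ennreal ((U x * W x powr \<eta>) powr (1 / ?e)) = ennreal ((u x * \<omega> x powr \<eta>) powr (1 / ?e))"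
          unfolding AE_completion_iff using W U by eventually_elim simp
      qed
      then have "integrable \<mu> (\<lambda>x. (U x * W x powr \<eta>) powr (1 / ?e))"
        using fin BM_measurable_mu[OF m] by (intro integrableI_nonneg) auto
      then show ?thesis using integral_BM(1)[OF m] by simp
    qed
    show "\<exists>A\<in>sets BM. 0 < emeasure BM A \<and> emeasure BM A < ennreal \<epsilon>" if "0 < \<epsilon>" for \<epsilon>
      by (rule small_baire_sets[OF nd that])
  qed (use p \<eta> exponent c in \<open>simp_all add: W_def U_def\<close>, measurable)
  then have "weighted_haar_group \<nu> W U p \<eta> c \<omega>"
    by (intro weighted_haar_group.intro unimodular_haar_group_axioms weighted_haar_group_axioms.intro meas W)
  then show ?thesis by blast
qed

end

text \<open>As \<eta> tends to 0 the third Hoelder weight e tends to 1 - 1 / p = 1 / q, so 1 / e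
  approaches q > s and \<eta> / e approaches 0 < r; a small \<eta> satisfies everything.\<close>

lemma holder_exponent:
  fixes p s r :: real
  assumes p: "1 < p" and s: "0 < s" "s < p / (p - 1)" and r: "0 < r"
  shows "\<exists>\<eta>>0. \<eta> < 1 \<and> 0 < 1 - (1 - \<eta>) / p - \<eta> / 2 \<and>
    s \<le> 1 / (1 - (1 - \<eta>) / p - \<eta> / 2) \<and> \<eta> / (1 - (1 - \<eta>) / p - \<eta> / 2) \<le> r"
proof -
  define q where "q = p / (p - 1)"
  have q: "0 < q" "1 / q = 1 - 1 / p" using p by (auto simp: q_def field_simps)
  \<comment> \<open>Since e differs from 1 / q by at most \<eta> / 2, the bound 1 / q gives e \<ge>
    1 / (2 q), then r / (2 q) gives \<eta> / e \<le> r, and 2 (1 / s - 1 / q) gives e \<le> 1 /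
    s.\<close>
  define \<eta> where "\<eta> = min (1 / 2) (min (1 / q) (min (r / (2 * q)) (2 * (1 / s - 1 / q))))"
  have sq: "1 / q < 1 / s" using s q(1) by (intro divide_strict_left_mono mult_pos_pos) (auto simp: q_def[symmetric])
  have \<eta>: "0 < \<eta>" "\<eta> \<le> 1 / 2" "\<eta> \<le> 1 / q" "\<eta> \<le> r / (2 * q)" "\<eta> \<le> 2 * (1 / s - 1 / q)"
  proof -
    have "0 < 1 / q" "0 < r / (2 * q)" "0 < 2 * (1 / s - 1 / q)" using q(1) r sq by simp_all
    then show "0 < \<eta>" "\<eta> \<le> 1 / 2" "\<eta> \<le> 1 / q" "\<eta> \<le> r / (2 * q)" "\<eta> \<le> 2 * (1 / s - 1 / q)"
      unfolding \<eta>_def by linarith+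
  qed
  let ?e = "1 - (1 - \<eta>) / p - \<eta> / 2"
  have e: "?e = 1 / q + \<eta> * (1 / p - 1 / 2)" using p unfolding q(2) by (simp add: field_simps)
  have ip: "0 < 1 / p" "1 / p < 1" using p by auto
  have lo: "\<eta> * (- (1 / 2)) \<le> \<eta> * (1 / p - 1 / 2)" and hi: "\<eta> * (1 / p - 1 / 2) \<le> \<eta> * (1 / 2)"
    using \<eta>(1) ip by (intro mult_left_mono; linarith)+
  have e1: "1 / (2 * q) \<le> ?e" unfolding e using lo \<eta>(3) by simp
  have half: "x * (1 / 2) \<le> y" if "x \<le> 2 * y" for x y :: real using that by simp
  have e2: "?e \<le> 1 / s" unfolding e using order_trans[OF hi half[OF \<eta>(5)]] by linarith
  have q2: "0 < 1 / (2 * q)" using q by simp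
  have epos: "0 < ?e" using e1 q2 by linarith
  have "s \<le> 1 / ?e" using e2 epos s by (simp add: field_simps)
  moreover have "\<eta> / ?e \<le> r"
  proof -
    have "\<eta> \<le> r * (1 / (2 * q))" using \<eta>(4) by simp
    also have "\<dots> \<le> r * ?e" using e1 r by (intro mult_left_mono) auto
    finally show ?thesis using epos by (simp add: divide_le_eq)
  qed
  ultimately show ?thesis using \<eta> epos by (intro exI[of _ \<eta>]) auto
qed

theorem theorem5p10:
  fixes \<mu> :: "'a::{topological_group_add, t2_space} measure"
    and \<omega> u :: "'a \<Rightarrow> real"
    and p s r :: real
    and q :: ereal
  assumes loc_compact: "locally_compact_space (euclidean :: 'a topology)"
    and non_discrete: "\<not> (\<forall>S :: 'a set. open S)"
    and haar: "left_haar_measure \<mu>"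
    and weight: "weight \<mu> \<omega>"
    and weight_ge_1: "\<forall>x. \<omega> x \<ge> 1"
    and p_ge_1: "1 \<le> p"
    and q_gt_1: "1 < q"
    and conjugate: "1 / ereal p + 1 / q = 1"
    and u_measurable: "u \<in> borel_measurable \<mu>"
    and u_nonneg: "\<forall>x. 0 \<le> u x"
    and u_bounded: "\<exists>C. \<forall>x. u x \<le> C"
    and s_less: "ereal s < q"
    and r_pos: "0 < r"
    and bounded_away: "\<exists>c>0. \<forall>x. c \<le> \<omega> x * u x"
    and weight_ineq: "\<forall>x y. \<omega> (x + y) / (\<omega> x * \<omega> y) \<le> u x + u y"
    and finite_integral:
      "(\<integral>\<^sup>+ x. ennreal (u x powr s * \<omega> x powr r) \<partial>\<mu>) < \<infinity>"
  shows "inverse_closed (conv_operator \<mu>) (unitization \<mu> p \<omega>) (bounded_ops_L2 \<mu>) \<and>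
         norm_controlled_inversion (conv_operator \<mu>) (unitization \<mu> p \<omega>) (bounded_ops_L2 \<mu>)"
proof -
  obtain \<nu> where \<nu>: "left_haar_borel \<nu>" "\<mu> = completion \<nu>" using haar unfolding left_haar_measure_def by blast
  have w1: "1 \<le> \<omega> x" for x using weight_ge_1 by blast
  have w0: "0 < \<omega> x" for x using w1[of x] by linarith
  have w_meas: "\<omega> \<in> borel_measurable \<mu>" and w_sym: "\<omega> (- x) = \<omega> x" and w_sub: "\<omega> (x + y) \<le> \<omega> x * \<omega> y" for x y
    using weight unfolding weight_def by metis+
  note [measurable] = w_meas u_measurable
  have u0: "0 \<le> u x" for x using u_nonneg by blast
  obtain c where c: "0 < c" "\<And>x. c \<le> \<omega> x * u x" using bounded_away by blast
  obtain C' where C': "\<And>x. u x \<le> C'" using u_bounded by blast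
  define C where "C = max C' 1"
  have C: "u x \<le> C" "1 \<le> C" for x using C'[of x] by (auto simp: C_def)
  have upos: "0 < u x" for x
  proof (rule ccontr)
    assume "\<not> 0 < u x"
    then have "u x = 0" using u0[of x] by simp
    then show False using c(2)[of x] c(1) by simp
  qed
  have ineq: "\<omega> (x + y) \<le> \<omega> x * \<omega> y * (u x + u y)" for x y
    using weight_ineq[rule_format, of x y] w0[of x] w0[of y] by (simp add: divide_le_eq mult_ac)
  \<comment> \<open>A nonpositive s is replaced by 1 / 2, which is still below q, and r1 is chosen
    smaller than s1, as \<open>weight_consequences\<close> requires. Since u is bounded and \<omega>
    \<ge> 1, raising the exponent of u and lowering that of \<omega> keeps the integral finite; this
    is \<open>dom\<close>.\<close>
  define s1 where "s1 = (if 0 < s then s else 1 / 2)"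
  define r1 where "r1 = min r (s1 / 2)"
  have s1: "0 < s1" "s \<le> s1" by (auto simp: s1_def)
  have s1q: "ereal s1 < q"
  proof (cases "0 < s")
    case False
    have "ereal (1 / 2) < 1" by (simp add: one_ereal_def)
    then have "ereal (1 / 2) < q" using q_gt_1 by (rule less_trans)
    then show ?thesis using False by (simp add: s1_def)
  qed (simp add: s1_def s_less)
  have r1: "0 < r1" "r1 < s1" "r1 \<le> r" using r_pos s1 by (auto simp: r1_def)
  have dom: "u x powr t * \<omega> x powr a \<le> C powr (t - s) * (u x powr s * \<omega> x powr r)"
    if "s \<le> t" "a \<le> r" for t a x
  proof -
    have "u x powr t = u x powr (t - s) * u x powr s" using upos[of x] by (simp add: powr_add[symmetric])
    also have "\<dots> \<le> C powr (t - s) * u x powr s"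
      using that C(1)[of x] u0[of x] by (intro mult_right_mono powr_mono2) auto
    finally have "u x powr t * \<omega> x powr a \<le> (C powr (t - s) * u x powr s) * \<omega> x powr r"
      using that w1[of x] by (intro mult_mono powr_mono) auto
    then show ?thesis by (simp add: mult.assoc)
  qed
  have fin_dom: "(\<integral>\<^sup>+x. ennreal (f x) \<partial>\<mu>) < \<infinity>"
    if "\<And>x. f x \<le> k * (u x powr s * \<omega> x powr r)" "0 \<le> k" for f k
  proof -
    have "(\<integral>\<^sup>+x. ennreal (f x) \<partial>\<mu>) \<le> (\<integral>\<^sup>+x. ennreal k * ennreal (u x powr s * \<omega> x powr r) \<partial>\<mu>)"
      using that by (intro nn_integral_mono) (simp add: ennreal_mult[symmetric] ennreal_leI)
    also have "\<dots> = ennreal k * (\<integral>\<^sup>+x. ennreal (u x powr s * \<omega> x powr r) \<partial>\<mu>)"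
      by (intro nn_integral_cmult) measurable
    also have "\<dots> < \<infinity>" using finite_integral by (simp add: ennreal_mult_less_top)
    finally show ?thesis .
  qed
  have fin1: "(\<integral>\<^sup>+x. ennreal (u x powr s1 * \<omega> x powr r1) \<partial>\<mu>) < \<infinity>"
    by (rule fin_dom[OF dom]) (use s1 r1 in auto)
  interpret haar_group \<nu>
  proof
    show "\<exists>v\<in>borel_measurable (completion \<nu>). (\<forall>x. 0 < v x) \<and> (\<integral>\<^sup>+x. v x \<partial>completion \<nu>) < \<infinity>"
    proof (intro bexI conjI allI)
      show "(\<integral>\<^sup>+x. ennreal (u x powr s * \<omega> x powr r) \<partial>completion \<nu>) < \<infinity>"
        using finite_integral \<nu>(2) by simp
      show "0 < ennreal (u x powr s * \<omega> x powr r)" for x using upos[of x] w0[of x] by simp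
      show "(\<lambda>x. ennreal (u x powr s * \<omega> x powr r)) \<in> borel_measurable (completion \<nu>)"
        unfolding \<nu>(2)[symmetric] by measurable
    qed
  qed (use loc_compact \<nu>(1) in auto)
  note W = weight_consequences[OF w_meas[unfolded \<nu>(2)] u_measurable[unfolded \<nu>(2)] w1 w_sym w_sub u0 c ineq r1(1,2)
      fin1[unfolded \<nu>(2)]]
  interpret unimodular_haar_group \<nu> by unfold_locales (rule W(1))
  have "\<exists>u' c' \<eta>. u' \<in> borel_measurable \<mu> \<and> (\<forall>x. 0 \<le> u' x) \<and> 0 < c' \<and> (\<forall>x. c' \<le> \<omega> x * u' x) \<and>
      (\<forall>x y. \<omega> (x + y) \<le> \<omega> x * \<omega> y * (u' x + u' y)) \<and> 0 < \<eta> \<and> \<eta> < 1 \<and> 0 < 1 - (1 - \<eta>) / p - \<eta> / 2 \<and>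
      (\<integral>\<^sup>+x. ennreal ((u' x * \<omega> x powr \<eta>) powr (1 / (1 - (1 - \<eta>) / p - \<eta> / 2))) \<partial>\<mu>) < \<infinity>"
  proof (cases "p = 1")
    case False
    then have p1: "1 < p" using p_ge_1 by simp
    have q: "q = ereal (p / (p - 1))"
      using conjugate q_gt_1 p1 by (cases q) (auto simp: one_ereal_def field_simps)
    have sp: "s1 < p / (p - 1)" using s1q by (simp add: q)
    obtain \<eta> where \<eta>: "0 < \<eta>" "\<eta> < 1" "0 < 1 - (1 - \<eta>) / p - \<eta> / 2"
      "s1 \<le> 1 / (1 - (1 - \<eta>) / p - \<eta> / 2)" "\<eta> / (1 - (1 - \<eta>) / p - \<eta> / 2) \<le> r1"
      using holder_exponent[OF p1 s1(1) sp r1(1)] by blast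
    let ?m = "1 / (1 - (1 - \<eta>) / p - \<eta> / 2)"
    have "(\<integral>\<^sup>+x. ennreal ((u x * \<omega> x powr \<eta>) powr ?m) \<partial>\<mu>) < \<infinity>"
    proof (rule fin_dom)
      fix x
      have "(u x * \<omega> x powr \<eta>) powr ?m = u x powr ?m * \<omega> x powr (\<eta> * ?m)"
        using upos[of x] w0[of x] by (simp add: powr_mult powr_powr)
      also have "\<dots> \<le> C powr (?m - s) * (u x powr s * \<omega> x powr r)"
        using \<eta>(4,5) s1 r1 by (intro dom) auto
      finally show "(u x * \<omega> x powr \<eta>) powr ?m \<le> C powr (?m - s) * (u x powr s * \<omega> x powr r)" .
    qed simp
    then show ?thesis using u_measurable u0 c ineq \<eta> by blast
  next
    case True
    define \<theta> where "\<theta> = r1 / s1"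
    define k where "k = s1 - r1"
    have \<theta>: "0 < \<theta>" "\<theta> < 1" and k: "0 < k" using r1 s1 by (auto simp: \<theta>_def k_def)
    obtain D where D: "0 < D" "\<And>x y. \<omega> (x + y) \<le> D * \<omega> x * \<omega> y * (\<omega> x powr - \<theta> + \<omega> y powr - \<theta>)"
      using W(2) unfolding \<theta>_def by blast
    \<comment> \<open>The second part of \<open>weight_consequences\<close> is the weight inequality
      for this function, and \<omega> u' is at least D because \<theta> < 1.\<close>
    define u' where "u' x = D * \<omega> x powr - \<theta>" for x
    \<comment> \<open>The solution of 2 (\<eta> - \<theta>) / \<eta> = - k. It turns the function to
      be integrated into a multiple of \<omega> powr - k, which is integrable because \<omega> u is
      bounded away from 0; see \<open>low\<close>.\<close>
    define \<eta> where "\<eta> = 2 * \<theta> / (2 + k)"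
    have \<eta>: "0 < \<eta>" "\<eta> < 1" using \<theta> k by (auto simp: \<eta>_def divide_less_eq)
    have e: "1 - (1 - \<eta>) / p - \<eta> / 2 = \<eta> / 2" by (simp add: True)
    have exponent: "(\<eta> - \<theta>) * (1 / (\<eta> / 2)) = - k"
    proof -
      have "\<eta> * (2 + k) = 2 * \<theta>" using k by (simp add: \<eta>_def)
      then show ?thesis using \<eta>(1) by (simp add: field_simps)
    qed
    have low: "\<omega> x powr - k \<le> (1 / c powr s1 * C powr (s1 - s)) * (u x powr s * \<omega> x powr r)" for x
    proof -
      have "c / \<omega> x \<le> u x" using c(2)[of x] w0[of x] by (simp add: divide_le_eq mult.commute)
      then have "(c / \<omega> x) powr s1 \<le> u x powr s1" using c w0[of x] s1 by (intro powr_mono2) auto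
      then have "(c / \<omega> x) powr s1 * \<omega> x powr r1 \<le> u x powr s1 * \<omega> x powr r1" by (intro mult_right_mono) auto
      also have "\<dots> \<le> C powr (s1 - s) * (u x powr s * \<omega> x powr r)" using s1 r1 by (intro dom) auto
      also have "(c / \<omega> x) powr s1 * \<omega> x powr r1 = c powr s1 * \<omega> x powr - k"
        using c w0[of x] by (simp add: k_def powr_divide powr_diff)
      finally show ?thesis using c by (simp add: field_simps)
    qed
    have "(\<integral>\<^sup>+x. ennreal ((u' x * \<omega> x powr \<eta>) powr (1 / (1 - (1 - \<eta>) / p - \<eta> / 2))) \<partial>\<mu>) < \<infinity>"
      unfolding e
    proof (rule fin_dom)
      fix x
      have "(u' x * \<omega> x powr \<eta>) powr (1 / (\<eta> / 2)) = (D * \<omega> x powr (\<eta> - \<theta>)) powr (1 / (\<eta> / 2))"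
        by (simp add: u'_def powr_add[symmetric] mult.assoc)
      also have "\<dots> = D powr (1 / (\<eta> / 2)) * \<omega> x powr ((\<eta> - \<theta>) * (1 / (\<eta> / 2)))"
        using D(1) w0[of x] by (simp only: powr_mult powr_powr powr_ge_zero less_imp_le)
      also have "\<dots> \<le> D powr (1 / (\<eta> / 2)) * ((1 / c powr s1 * C powr (s1 - s)) * (u x powr s * \<omega> x powr r))"
        unfolding exponent using low[of x] by (intro mult_left_mono) auto
      finally show "(u' x * \<omega> x powr \<eta>) powr (1 / (\<eta> / 2))
        \<le> (D powr (1 / (\<eta> / 2)) * (1 / c powr s1 * C powr (s1 - s))) * (u x powr s * \<omega> x powr r)"
        by (simp only: mult.assoc)
    qed simp
    moreover have "u' \<in> borel_measurable \<mu>" unfolding u'_def by measurable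
    moreover have "0 \<le> u' x" for x using D(1) by (simp add: u'_def)
    moreover have "D \<le> \<omega> x * u' x" for x
    proof -
      have "\<omega> x * u' x = D * (\<omega> x powr 1 * \<omega> x powr - \<theta>)" using w0[of x] by (simp add: u'_def)
      also have "\<dots> = D * \<omega> x powr (1 - \<theta>)" by (simp only: powr_add[symmetric]) simp
      finally show ?thesis using D(1) ge_one_powr_ge_zero[OF w1[of x], of "1 - \<theta>"] \<theta> by simp
    qed
    moreover have "\<omega> (x + y) \<le> \<omega> x * \<omega> y * (u' x + u' y)" for x y
      using D(2)[of x y] by (simp add: u'_def algebra_simps)
    moreover have "0 < 1 - (1 - \<eta>) / p - \<eta> / 2" unfolding e using \<eta> by simp
    ultimately show ?thesis using D(1) \<eta> by blast
  qed
  then obtain u' c' \<eta> where u': "u' \<in> borel_measurable \<mu>" "\<And>x. 0 \<le> u' x" "0 < c'" "\<And>x. c' \<le> \<omega> x * u' x"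
      "\<And>x y. \<omega> (x + y) \<le> \<omega> x * \<omega> y * (u' x + u' y)" "0 < \<eta>" "\<eta> < 1" "0 < 1 - (1 - \<eta>) / p - \<eta> / 2"
      "(\<integral>\<^sup>+x. ennreal ((u' x * \<omega> x powr \<eta>) powr (1 / (1 - (1 - \<eta>) / p - \<eta> / 2))) \<partial>\<mu>) < \<infinity>"
    by blast
  obtain W U where "weighted_haar_group \<nu> W U p \<eta> c' \<omega>"
    using ex_weighted_haar_group[OF non_discrete w_meas[unfolded \<nu>(2)] u'(1)[unfolded \<nu>(2)] w1 w_sym u'(2-5) p_ge_1 u'(6-8)
        u'(9)[unfolded \<nu>(2)]] by blast
  then interpret weighted_haar_group \<nu> W U p \<eta> c' \<omega> .
  show ?thesis unfolding \<nu>(2) by (rule inverse_closed_controlled)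
qed

end
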